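(* Let $X$ and $Y$ be complex Banach spaces, let $n\in\mathbb{N}$, and let $P\colon\mathcal{A}(X)\to Y$ be a continuous $n$-homogeneous polynomial. Suppose that the dual space $X^*$ has the bounded approximation property. Then the following conditions are equivalent: (1) the polynomial $P$ is orthogonally additive, i.e., $P(S+T)=P(S)+P(T)$ whenever $S,T\in\mathcal{A}(X)$ are such that $ST=TS=0$; (2) the polynomial $P$ is orthogonally additive on $\mathcal{F}(X)$, i.e., $P(S+T)=P(S)+P(T)$ whenever $S,T\in\mathcal{F}(X)$ are such that $ST=TS=0$; (3) there exists a unique continuous linear map $\Phi\colon\mathcal{A}(X)\to Y$ such that $P(T)=\Phi(T^n)$ for each $T\in\mathcal{A}(X)$.
   Context: All algebras and linear spaces are complex; $\mathbb{N}=\{1,2,\dots\}$. For a Banach space $X$, $\mathcal{B}(X)$ is the Banach algebra of continuous linear operators on $X$ with the operator norm, $\mathcal{F}(X)$ is the two-sided ideal of finite-rank operators in $\mathcal{B}(X)$, and $\mathcal{A}(X)$ (the algebra of approximable operators) is the closure of $\mathcal{F}(X)$ in $\mathcal{B}(X)$ with respect to the operator norm. A map $P\colon V\to W$ between linear spaces is an $n$-homogeneous polynomial if there is an $n$-linear map $\varphi\colon V^n\to W$ with $P(x)=\varphi(x,\dots,x)$ for all $x\in V$. A Banach space $Z$ has the bounded approximation property if there is a constant $C$ such that for every compact $K\subset Z$ and every $\varepsilon>0$ there is a finite-rank operator $F\in\mathcal{F}(Z)$ with $\|F\|\le C$ and $\|Fz-z\|<\varepsilon$ for all $z\in K$. 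*)

theory Defs
  imports "HOL-Analysis.Analysis"
begin

section \<open>Complex normed spaces and complex Banach spaces\<close>

class complex_normed_vector = real_normed_vector +
  fixes scaleC :: "complex \<Rightarrow> 'a \<Rightarrow> 'a"  (infixr \<open>*\<^sub>C\<close> 75)
  assumes scaleC_add_right: "a *\<^sub>C (x + y) = a *\<^sub>C x + a *\<^sub>C y"
    and scaleC_add_left: "(a + b) *\<^sub>C x = a *\<^sub>C x + b *\<^sub>C x"
    and scaleC_scaleC: "a *\<^sub>C b *\<^sub>C x = (a * b) *\<^sub>C x"
    and scaleC_one: "1 *\<^sub>C x = x"
    and scaleR_scaleC: "r *\<^sub>R x = complex_of_real r *\<^sub>C x"
    and norm_scaleC: "norm (a *\<^sub>C x) = cmod a * norm x"

class complex_banach = complex_normed_vector + banach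

interpretation complex_vector: vector_space "scaleC :: complex \<Rightarrow> 'a \<Rightarrow> 'a::complex_normed_vector"
  by standard (simp_all add: scaleC_add_right scaleC_add_left scaleC_scaleC scaleC_one)

instantiation complex :: complex_banach
begin

definition scaleC_complex :: "complex \<Rightarrow> complex \<Rightarrow> complex"
  where "scaleC_complex a x = a * x"

instance
  by standard
    (simp_all add: scaleC_complex_def algebra_simps norm_mult scaleR_conv_of_real)

end

lemma bounded_linear_scaleC: "bounded_linear (\<lambda>x::'a::complex_normed_vector. c *\<^sub>C x)"
proof (rule bounded_linear_intro[where K = "cmod c"])
  show "c *\<^sub>C (x + y) = c *\<^sub>C x + c *\<^sub>C y" for x y :: 'a
    by (rule scaleC_add_right)
  show "c *\<^sub>C (r *\<^sub>R x) = r *\<^sub>R (c *\<^sub>C x)" for r and x :: 'a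
    by (simp add: scaleR_scaleC mult.commute)
  show "norm (c *\<^sub>C x) \<le> norm x * cmod c" for x :: 'a
    by (simp add: norm_scaleC mult.commute)
qed

section \<open>Continuous complex-linear operators\<close>

text \<open>
  The complex-linear operators are carved out of the library's real-linear ones and inherit
  their operator norm, which depends only on the norms of the two spaces.
\<close>

typedef (overloaded) ('a, 'b) cblinfun (\<open>(_ \<Rightarrow>\<^sub>C\<^sub>L /_)\<close> [22, 21] 21) =
  "{T :: 'a::complex_normed_vector \<Rightarrow>\<^sub>L 'b::complex_normed_vector.
      Vector_Spaces.linear scaleC scaleC (blinfun_apply T)}"
  morphisms blinfun_of_cblinfun Abs_cblinfun
  by (rule exI[of _ 0])
    (simp add: Vector_Spaces.linear_iff complex_vector.vector_space_axioms)

setup_lifting type_definition_cblinfun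

lemma clinear_blinfun_iff:
  fixes T :: "'a::complex_normed_vector \<Rightarrow>\<^sub>L 'b::complex_normed_vector"
  shows "Vector_Spaces.linear scaleC scaleC (blinfun_apply T) \<longleftrightarrow>
    (\<forall>c x. blinfun_apply T (c *\<^sub>C x) = c *\<^sub>C blinfun_apply T x)"
  by (simp add: Vector_Spaces.linear_iff complex_vector.vector_space_axioms blinfun.add_right)

lift_definition cblinfun_apply :: "('a::complex_normed_vector \<Rightarrow>\<^sub>C\<^sub>L 'b::complex_normed_vector) \<Rightarrow> 'a \<Rightarrow> 'b"
  is blinfun_apply .

lift_definition id_cblinfun :: "'a::complex_normed_vector \<Rightarrow>\<^sub>C\<^sub>L 'a" is id_blinfun
  by (simp add: Vector_Spaces.linear_iff complex_vector.vector_space_axioms)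

lift_definition cblinfun_compose ::
  "('b::complex_normed_vector \<Rightarrow>\<^sub>C\<^sub>L 'c::complex_normed_vector) \<Rightarrow> ('a::complex_normed_vector \<Rightarrow>\<^sub>C\<^sub>L 'b) \<Rightarrow> ('a \<Rightarrow>\<^sub>C\<^sub>L 'c)"
  (infixl \<open>o\<^sub>C\<^sub>L\<close> 67) is blinfun_compose
  by (simp add: clinear_blinfun_iff)

lemma cblinfun_eqI: "(\<And>x. cblinfun_apply S x = cblinfun_apply T x) \<Longrightarrow> S = T"
  by transfer (rule blinfun_eqI)

primrec cblinfun_power :: "('a::complex_normed_vector \<Rightarrow>\<^sub>C\<^sub>L 'a) \<Rightarrow> nat \<Rightarrow> ('a \<Rightarrow>\<^sub>C\<^sub>L 'a)"
  where
    "cblinfun_power T 0 = id_cblinfun"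
  | "cblinfun_power T (Suc n) = T o\<^sub>C\<^sub>L cblinfun_power T n"

instantiation cblinfun :: (complex_normed_vector, complex_normed_vector) real_normed_vector
begin

lift_definition norm_cblinfun :: "('a \<Rightarrow>\<^sub>C\<^sub>L 'b) \<Rightarrow> real" is norm .

lift_definition zero_cblinfun :: "'a \<Rightarrow>\<^sub>C\<^sub>L 'b" is 0
  by (simp add: clinear_blinfun_iff)

lift_definition plus_cblinfun :: "('a \<Rightarrow>\<^sub>C\<^sub>L 'b) \<Rightarrow> ('a \<Rightarrow>\<^sub>C\<^sub>L 'b) \<Rightarrow> ('a \<Rightarrow>\<^sub>C\<^sub>L 'b)" is "(+)"
  by (simp add: clinear_blinfun_iff blinfun.add_left scaleC_add_right)

lift_definition minus_cblinfun :: "('a \<Rightarrow>\<^sub>C\<^sub>L 'b) \<Rightarrow> ('a \<Rightarrow>\<^sub>C\<^sub>L 'b) \<Rightarrow> ('a \<Rightarrow>\<^sub>C\<^sub>L 'b)" is "(-)"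
  by (simp add: clinear_blinfun_iff blinfun.diff_left complex_vector.scale_right_diff_distrib)

lift_definition uminus_cblinfun :: "('a \<Rightarrow>\<^sub>C\<^sub>L 'b) \<Rightarrow> ('a \<Rightarrow>\<^sub>C\<^sub>L 'b)" is uminus
  by (simp add: clinear_blinfun_iff blinfun.minus_left)

lift_definition scaleR_cblinfun :: "real \<Rightarrow> ('a \<Rightarrow>\<^sub>C\<^sub>L 'b) \<Rightarrow> ('a \<Rightarrow>\<^sub>C\<^sub>L 'b)" is scaleR
  by (simp add: clinear_blinfun_iff blinfun.scaleR_left scaleR_scaleC mult.commute)

definition dist_cblinfun :: "('a \<Rightarrow>\<^sub>C\<^sub>L 'b) \<Rightarrow> ('a \<Rightarrow>\<^sub>C\<^sub>L 'b) \<Rightarrow> real"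
  where "dist_cblinfun S T = norm (S - T)"

definition sgn_cblinfun :: "('a \<Rightarrow>\<^sub>C\<^sub>L 'b) \<Rightarrow> ('a \<Rightarrow>\<^sub>C\<^sub>L 'b)"
  where "sgn_cblinfun T = inverse (norm T) *\<^sub>R T"

definition uniformity_cblinfun :: "(('a \<Rightarrow>\<^sub>C\<^sub>L 'b) \<times> ('a \<Rightarrow>\<^sub>C\<^sub>L 'b)) filter"
  where [code del]: "uniformity_cblinfun = (INF e\<in>{0 <..}. principal {(x, y). dist x y < e})"

definition open_cblinfun :: "('a \<Rightarrow>\<^sub>C\<^sub>L 'b) set \<Rightarrow> bool"
  where [code del]: "open_cblinfun S = (\<forall>x\<in>S. \<forall>\<^sub>F (x', y) in uniformity. x' = x \<longrightarrow> y \<in> S)"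

instance
proof
  fix S T U :: "'a \<Rightarrow>\<^sub>C\<^sub>L 'b" and r s :: real
  show "dist S T = norm (S - T)" by (rule dist_cblinfun_def)
  show "S + T + U = S + (T + U)" by transfer (rule add.assoc)
  show "S + T = T + S" by transfer (rule add.commute)
  show "0 + S = S" by transfer simp
  show "- S + S = 0" by transfer simp
  show "S - T = S + - T" by transfer simp
  show "r *\<^sub>R (S + T) = r *\<^sub>R S + r *\<^sub>R T" by transfer (rule scaleR_add_right)
  show "(r + s) *\<^sub>R S = r *\<^sub>R S + s *\<^sub>R S" by transfer (rule scaleR_add_left)
  show "r *\<^sub>R s *\<^sub>R S = (r * s) *\<^sub>R S" by transfer simp
  show "1 *\<^sub>R S = S" by transfer simp
  show "sgn S = inverse (norm S) *\<^sub>R S" by (rule sgn_cblinfun_def)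
  show "uniformity = (INF e\<in>{0 <..}. principal {(x :: 'a \<Rightarrow>\<^sub>C\<^sub>L 'b, y). dist x y < e})"
    by (rule uniformity_cblinfun_def)
  show "open V = (\<forall>x\<in>V. \<forall>\<^sub>F (x', y) in uniformity. x' = x \<longrightarrow> y \<in> V)" for V :: "('a \<Rightarrow>\<^sub>C\<^sub>L 'b) set"
    by (rule open_cblinfun_def)
  show "(norm S = 0) = (S = 0)" by transfer simp
  show "norm (S + T) \<le> norm S + norm T" by transfer (rule norm_triangle_ineq)
  show "norm (r *\<^sub>R S) = \<bar>r\<bar> * norm S" by transfer simp
qed

end

lemma cblinfun_apply_plus: "cblinfun_apply (S + T) x = cblinfun_apply S x + cblinfun_apply T x"
  by transfer (rule blinfun.add_left)

lemma cblinfun_apply_scaleR: "cblinfun_apply (r *\<^sub>R T) x = r *\<^sub>R cblinfun_apply T x"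
  by transfer (rule blinfun.scaleR_left)

lemma norm_cblinfun_onorm: "norm T = onorm (cblinfun_apply T)"
  by transfer (simp add: norm_blinfun.rep_eq)

lemma norm_cblinfun_apply: "norm (cblinfun_apply T x) \<le> norm T * norm x"
  by transfer (rule norm_blinfun)

lemma norm_cblinfun_bound:
  "0 \<le> b \<Longrightarrow> (\<And>x. norm (cblinfun_apply T x) \<le> b * norm x) \<Longrightarrow> norm T \<le> b"
  by transfer (rule norm_blinfun_bound)

instantiation cblinfun :: (complex_normed_vector, complex_normed_vector) complex_normed_vector
begin

lift_definition scaleC_cblinfun :: "complex \<Rightarrow> ('a \<Rightarrow>\<^sub>C\<^sub>L 'b) \<Rightarrow> ('a \<Rightarrow>\<^sub>C\<^sub>L 'b)"
  is "\<lambda>c T. Blinfun (\<lambda>x. c *\<^sub>C blinfun_apply T x)"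
  by (simp add: Vector_Spaces.linear_iff complex_vector.vector_space_axioms
      bounded_linear_Blinfun_apply scaleC_add_right mult.commute
      bounded_linear_compose[OF bounded_linear_scaleC blinfun.bounded_linear_right])

lemma cblinfun_apply_scaleC:
  fixes T :: "'a \<Rightarrow>\<^sub>C\<^sub>L 'b"
  shows "cblinfun_apply (c *\<^sub>C T) x = c *\<^sub>C cblinfun_apply T x"
  by transfer
    (simp add: bounded_linear_Blinfun_apply
      bounded_linear_compose[OF bounded_linear_scaleC blinfun.bounded_linear_right])

lemma norm_cblinfun_scaleC_le:
  fixes T :: "'a \<Rightarrow>\<^sub>C\<^sub>L 'b"
  shows "norm (c *\<^sub>C T) \<le> cmod c * norm T"
proof (rule norm_cblinfun_bound)
  show "0 \<le> cmod c * norm T"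
    by (intro mult_nonneg_nonneg norm_ge_zero)
  show "norm (cblinfun_apply (c *\<^sub>C T) x) \<le> cmod c * norm T * norm x" for x
    using mult_left_mono[OF norm_cblinfun_apply[of T x], of "cmod c"]
    by (simp add: cblinfun_apply_scaleC norm_scaleC mult_ac)
qed

instance
proof
  fix S T :: "'a \<Rightarrow>\<^sub>C\<^sub>L 'b" and r :: real and a b :: complex
  show "a *\<^sub>C (S + T) = a *\<^sub>C S + a *\<^sub>C T"
    by (rule cblinfun_eqI) (simp add: cblinfun_apply_scaleC cblinfun_apply_plus scaleC_add_right)
  show "(a + b) *\<^sub>C S = a *\<^sub>C S + b *\<^sub>C S"
    by (rule cblinfun_eqI) (simp add: cblinfun_apply_scaleC cblinfun_apply_plus scaleC_add_left)
  show "a *\<^sub>C b *\<^sub>C S = (a * b) *\<^sub>C S"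
    by (rule cblinfun_eqI) (simp add: cblinfun_apply_scaleC)
  show "1 *\<^sub>C S = S"
    by (rule cblinfun_eqI) (simp add: cblinfun_apply_scaleC)
  show "r *\<^sub>R S = complex_of_real r *\<^sub>C S"
    by (rule cblinfun_eqI) (simp add: cblinfun_apply_scaleC cblinfun_apply_scaleR scaleR_scaleC)
  show "norm (a *\<^sub>C S) = cmod a * norm S"
  proof (cases "a = 0")
    case True
    then show ?thesis
      using norm_cblinfun_scaleC_le[of a S] by simp
  next
    case False
    have "inverse a *\<^sub>C a *\<^sub>C S = S"
      using False by (intro cblinfun_eqI) (simp add: cblinfun_apply_scaleC)
    then have "norm S \<le> inverse (cmod a) * norm (a *\<^sub>C S)"
      using norm_cblinfun_scaleC_le[of "inverse a" "a *\<^sub>C S"] by (simp add: norm_inverse)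
    then have "cmod a * norm S \<le> norm (a *\<^sub>C S)"
      using False by (simp add: field_simps)
    then show ?thesis
      using norm_cblinfun_scaleC_le[of a S] by simp
  qed
qed

end

instance cblinfun :: (complex_normed_vector, complex_banach) complex_banach
proof
  fix X :: "nat \<Rightarrow> 'a \<Rightarrow>\<^sub>C\<^sub>L 'b"
  assume X: "Cauchy X"
  have d: "dist (blinfun_of_cblinfun S) (blinfun_of_cblinfun T) = dist S T" for S T :: "'a \<Rightarrow>\<^sub>C\<^sub>L 'b"
    by (simp add: dist_norm norm_cblinfun.rep_eq minus_cblinfun.rep_eq)
  from X have "Cauchy (\<lambda>n. blinfun_of_cblinfun (X n))"
    by (simp add: Cauchy_def d)
  then obtain L where L: "(\<lambda>n. blinfun_of_cblinfun (X n)) \<longlonglongrightarrow> L"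
    by (auto simp: Cauchy_convergent_iff convergent_def)
  have "blinfun_apply L (c *\<^sub>C x) = c *\<^sub>C blinfun_apply L x" for c x
  proof (rule LIMSEQ_unique)
    show "(\<lambda>n. blinfun_apply (blinfun_of_cblinfun (X n)) (c *\<^sub>C x)) \<longlonglongrightarrow> blinfun_apply L (c *\<^sub>C x)"
      by (intro blinfun.tendsto L tendsto_const)
    have "(\<lambda>n. c *\<^sub>C blinfun_apply (blinfun_of_cblinfun (X n)) x) \<longlonglongrightarrow> c *\<^sub>C blinfun_apply L x"
      by (intro bounded_linear.tendsto[OF bounded_linear_scaleC] blinfun.tendsto L tendsto_const)
    moreover have "blinfun_apply (blinfun_of_cblinfun (X n)) (c *\<^sub>C x) =
        c *\<^sub>C blinfun_apply (blinfun_of_cblinfun (X n)) x" for n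
      using blinfun_of_cblinfun[of "X n"] by (simp add: clinear_blinfun_iff)
    ultimately show "(\<lambda>n. blinfun_apply (blinfun_of_cblinfun (X n)) (c *\<^sub>C x)) \<longlonglongrightarrow> c *\<^sub>C blinfun_apply L x"
      by simp
  qed
  then have "blinfun_of_cblinfun (Abs_cblinfun L) = L"
    by (simp add: Abs_cblinfun_inverse clinear_blinfun_iff)
  with L d[of _ "Abs_cblinfun L"] have "X \<longlonglongrightarrow> Abs_cblinfun L"
    by (simp add: tendsto_iff)
  then show "convergent X"
    by (auto simp: convergent_def)
qed

section \<open>Finite-rank and approximable operators\<close>

definition finite_rank_ops :: "('a::complex_normed_vector \<Rightarrow>\<^sub>C\<^sub>L 'a) set"
  where "finite_rank_ops =
    {T. \<exists>B. finite B \<and> range (cblinfun_apply T) \<subseteq> complex_vector.span B}"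

definition approximable_ops :: "('a::complex_normed_vector \<Rightarrow>\<^sub>C\<^sub>L 'a) set"
  where "approximable_ops = closure finite_rank_ops"

definition bounded_approximation_property :: "'z::complex_banach itself \<Rightarrow> bool"
  where "bounded_approximation_property _ \<longleftrightarrow>
    (\<exists>C. \<forall>K :: 'z set. compact K \<longrightarrow> (\<forall>\<epsilon>>0. \<exists>F\<in>finite_rank_ops.
       norm F \<le> C \<and> (\<forall>z\<in>K. norm (cblinfun_apply F z - z) < \<epsilon>)))"

section \<open>Homogeneous polynomials and orthogonal additivity\<close>

text \<open>
  In the following definitions \<open>V\<close> is meant to be a complex linear subspace, and maps \<open>V \<rightarrow> W\<close>
  are represented by total functions of which only the values on \<open>V\<close> matter.
\<close>

definition clinear_on :: "'v::complex_normed_vector set \<Rightarrow> ('v \<Rightarrow> 'w::complex_normed_vector) \<Rightarrow> bool"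
  where "clinear_on V f \<longleftrightarrow>
    (\<forall>x\<in>V. \<forall>y\<in>V. f (x + y) = f x + f y) \<and> (\<forall>c. \<forall>x\<in>V. f (c *\<^sub>C x) = c *\<^sub>C f x)"

text \<open>
  Elements of \<open>V\<^sup>n\<close> are the extensional functions in \<open>{..<n} \<rightarrow>\<^sub>E V\<close>. Extensionality is essential:
  it keeps \<open>\<phi>\<close> from depending on coordinates outside \<open>{..<n}\<close>.
\<close>

definition multilinear_on ::
  "nat \<Rightarrow> 'v::complex_normed_vector set \<Rightarrow> ((nat \<Rightarrow> 'v) \<Rightarrow> 'w::complex_normed_vector) \<Rightarrow> bool"
  where "multilinear_on n V \<phi> \<longleftrightarrow>
    (\<forall>x \<in> {..<n} \<rightarrow>\<^sub>E V. \<forall>i<n. clinear_on V (\<lambda>v. \<phi> (x(i := v))))"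

definition homogeneous_polynomial_on ::
  "nat \<Rightarrow> 'v::complex_normed_vector set \<Rightarrow> ('v \<Rightarrow> 'w::complex_normed_vector) \<Rightarrow> bool"
  where "homogeneous_polynomial_on n V P \<longleftrightarrow>
    (\<exists>\<phi>. multilinear_on n V \<phi> \<and> (\<forall>x\<in>V. P x = \<phi> (\<lambda>i\<in>{..<n}. x)))"

definition orthogonally_additive_on ::
  "('a::complex_normed_vector \<Rightarrow>\<^sub>C\<^sub>L 'a) set \<Rightarrow> (('a \<Rightarrow>\<^sub>C\<^sub>L 'a) \<Rightarrow> 'w::complex_normed_vector) \<Rightarrow> bool"
  where "orthogonally_additive_on V P \<longleftrightarrow>
    (\<forall>S\<in>V. \<forall>T\<in>V. S o\<^sub>C\<^sub>L T = 0 \<and> T o\<^sub>C\<^sub>L S = 0 \<longrightarrow> P (S + T) = P S + P T)"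

end

theory Submission
  imports Defs "HOL-Computational_Algebra.Fundamental_Theorem_Algebra"
begin

text \<open>
  Let \<open>P\<close> be orthogonally additive on the finite-rank operators. Two things have to be
  produced: a linear map \<open>\<Phi>\<close> with \<open>P T = \<Phi> (T\<^sup>n)\<close> on the finite-rank operators, and a bound
  for it, so that it extends to their closure. Both come from the derivative of \<open>P\<close>: if
  \<open>P T = \<Phi> (T\<^sup>n)\<close>, if \<open>e T = T e = T\<close>, and if \<open>s\<close> is a scalar, then
  \<open>(e + s T)\<^sup>n = e\<^sup>n + n s T + O(s\<^sup>2)\<close>, and therefore \<open>n \<Phi>(T)\<close> must be the coefficient \<open>D e T\<close>
  of \<open>s\<close> in the polynomial \<open>P (e + s T)\<close>. This also gives uniqueness.

  Conversely, \<open>D e T\<close> is linear in \<open>T\<close>. Fix an idempotent \<open>E\<close> of finite rank. If \<open>T\<close> is a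
  combination of pairwise orthogonal idempotents \<open>e\<^sub>i\<close> with sum \<open>E\<close>, then orthogonal
  additivity evaluates both sides and gives \<open>n P T = D E (T\<^sup>n)\<close> (\<open>P_eq_D_diagonalizable\<close>).
  Such \<open>T\<close> are dense among the operators that satisfy \<open>E T = T E = T\<close> (\<open>diagonalizable_dense\<close>,
  the density of diagonalizable matrices), so continuity removes the restriction on \<open>T\<close>
  (\<open>P_eq_D\<close>). Comparing coefficients once more, \<open>D e T\<close> does not depend on the choice of the
  local unit \<open>e\<close> of \<open>T\<close> (\<open>D_eq_D\<close>), and \<open>\<Phi>(T) = D e T / n\<close> is a well-defined linear map.

  The coefficient \<open>D e T\<close> is an average, with unimodular weights, of values of \<open>P\<close> on
  operators of norm at most \<open>\<parallel>e\<parallel> + \<parallel>T\<parallel>\<close>. So \<open>\<Phi>\<close> is bounded as soon as every finite-rank \<open>T\<close>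
  has a finite-rank local unit whose norm is bounded independently of \<open>T\<close>
  (\<open>bounded_local_units\<close>); this is where the approximation property of the dual space enters.
  That property supplies finite-rank operators \<open>F\<close> on the dual space, which need not be
  adjoints. A weak form of the principle of local reflexivity
  (\<open>finite_rank_approx_by_adjoints\<close>, resting on the Helly-type \<open>helly_bidual\<close>) replaces them
  by adjoints of operators \<open>e\<close> on the space itself, and a separation argument turns weak into
  norm approximation. This yields bounded \<open>e\<close> with \<open>h \<circ> e\<close> close to \<open>h\<close> for finitely many
  functionals \<open>h\<close>, and after a second separation also with \<open>e b\<close> close to \<open>b\<close> for finitely
  many vectors \<open>b\<close>. The two kinds are combined, and a small perturbation makes the approximate
  unit an exact one. All separations are instances of a Hahn-Banach theorem,
  \<open>sandwich_linear\<close>.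

  In the other direction, a representation \<open>P T = \<Phi> (T\<^sup>n)\<close> implies orthogonal additivity even
  on all approximable operators, since \<open>(S + T)\<^sup>n = S\<^sup>n + T\<^sup>n\<close> when \<open>S T = T S = 0\<close> and
  \<open>n \<ge> 1\<close>.
\<close>

section \<open>Sublinear functionals and the Hahn-Banach theorem\<close>

definition sublinear :: "('v::real_vector \<Rightarrow> real) \<Rightarrow> bool"
  where "sublinear p \<longleftrightarrow> (\<forall>x y. p (x + y) \<le> p x + p y) \<and> (\<forall>t>0. \<forall>x. p (t *\<^sub>R x) = t * p x)"

lemma sublinearD:
  assumes "sublinear p"
  shows "p (x + y) \<le> p x + p y" and "t > 0 \<Longrightarrow> p (t *\<^sub>R x) = t * p x"
    and "p 0 = 0" and "- p (- x) \<le> p x"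
proof -
  show a: "p (x + y) \<le> p x + p y" for x y
    using assms unfolding sublinear_def by blast
  show s: "t > 0 \<Longrightarrow> p (t *\<^sub>R x) = t * p x" for t x
    using assms unfolding sublinear_def by blast
  show z: "p 0 = 0"
    using s[of 2 0] by simp
  show "- p (- x) \<le> p x"
    using a[of x "- x"] z by simp
qed

text \<open>
  Every auxiliary functional below is an infimum of this kind: the infimum over a chain in
  Zorn's lemma, and the infimal convolutions in the two extension arguments.
\<close>

lemma sublinear_INF:
  fixes q :: "'i \<Rightarrow> 'v::real_vector \<Rightarrow> real"
  assumes ne: "I \<noteq> {}"
    and bdd: "\<And>i x. i \<in> I \<Longrightarrow> b x \<le> q i x"
    and add: "\<And>i j x y. i \<in> I \<Longrightarrow> j \<in> I \<Longrightarrow> \<exists>k\<in>I. q k (x + y) \<le> q i x + q j y"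
    and scale: "\<And>t i x. t > 0 \<Longrightarrow> i \<in> I \<Longrightarrow> \<exists>k\<in>I. q k (t *\<^sub>R x) \<le> t * q i x"
  shows "sublinear (\<lambda>x. INF i\<in>I. q i x)"
proof -
  have bb: "bdd_below ((\<lambda>i. q i x) ` I)" for x
    using bdd by (intro bdd_belowI2) auto
  have le: "(INF i\<in>I. q i x) \<le> q i x" if "i \<in> I" for i x
    by (rule cINF_lower[OF bb that])
  have sc: "(INF i\<in>I. q i (t *\<^sub>R x)) \<le> t * (INF i\<in>I. q i x)" if t: "t > 0" for t x
  proof -
    have "(INF i\<in>I. q i (t *\<^sub>R x)) / t \<le> q i x" if "i \<in> I" for i
    proof -
      obtain k where "k \<in> I" "q k (t *\<^sub>R x) \<le> t * q i x"
        using scale[OF t \<open>i \<in> I\<close>] by blast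
      then show ?thesis
        using le[of k "t *\<^sub>R x"] t by (simp add: field_simps)
    qed
    then have "(INF i\<in>I. q i (t *\<^sub>R x)) / t \<le> (INF i\<in>I. q i x)"
      by (intro cINF_greatest ne)
    then show ?thesis
      using t by (simp add: field_simps)
  qed
  have sc': "t * (INF i\<in>I. q i x) \<le> (INF i\<in>I. q i (t *\<^sub>R x))" if t: "t > 0" for t x
    using sc[of "inverse t" "t *\<^sub>R x"] t by (simp add: field_simps)
  have "(INF i\<in>I. q i (x + y)) \<le> (INF i\<in>I. q i x) + (INF i\<in>I. q i y)" for x y
  proof -
    have "(INF i\<in>I. q i (x + y)) - q i x \<le> q j y" if ij: "i \<in> I" "j \<in> I" for i j
    proof -
      obtain k where "k \<in> I" "q k (x + y) \<le> q i x + q j y"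
        using add[OF ij] by blast
      then show ?thesis
        using le[of k "x + y"] by simp
    qed
    then have "(INF i\<in>I. q i (x + y)) - q i x \<le> (INF i\<in>I. q i y)" if "i \<in> I" for i
      using that by (intro cINF_greatest ne)
    then have "(INF i\<in>I. q i (x + y)) - (INF i\<in>I. q i y) \<le> q i x" if "i \<in> I" for i
      using that by (simp add: algebra_simps)
    then have "(INF i\<in>I. q i (x + y)) - (INF i\<in>I. q i y) \<le> (INF i\<in>I. q i x)"
      by (intro cINF_greatest ne)
    then show ?thesis
      by simp
  qed
  then show ?thesis
    unfolding sublinear_def using sc sc' by (simp add: order_antisym)
qed

text \<open>
  The functional \<open>\<lambda>x. INF t\<ge>0. q (x + t w) - t q w\<close> is sublinear and below \<open>q\<close>. Minimality
  makes it equal to \<open>q\<close>, and comparing with \<open>t = 1\<close> shows that \<open>q\<close> is superadditive.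
\<close>

lemma minimal_sublinear_linear:
  fixes q :: "'v::real_vector \<Rightarrow> real"
  assumes q: "sublinear q"
    and min: "\<And>q'. sublinear q' \<Longrightarrow> (\<And>x. q' x \<le> q x) \<Longrightarrow> q' = q"
  shows "linear q"
proof -
  note qD = sublinearD[OF q]
  have q0: "q (t *\<^sub>R x) = t * q x" if "t \<ge> 0" for t x
    using that qD(2,3) by (cases "t = 0") auto
  have super: "q v + q w \<le> q (v + w)" for v w
  proof -
    \<comment> \<open>at \<open>t = 0\<close> this is \<open>q x\<close>, so its infimum over \<open>t\<close> is at most \<open>q x\<close>\<close>
    let ?r = "\<lambda>t x. q (x + t *\<^sub>R w) - t * q w"
    let ?q' = "\<lambda>x. INF t\<in>{0..}. ?r t x"
    have lower: "- q (- x) \<le> ?r t x" if "t \<in> {0..}" for t x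
      using qD(1)[of "x + t *\<^sub>R w" "- x"] q0[of t w] that by simp
    have "sublinear ?q'"
    proof (rule sublinear_INF[where b = "\<lambda>x. - q (- x)"])
      show "- q (- x) \<le> ?r t x" if "t \<in> {0..}" for t x
        by (rule lower[OF that])
      show "\<exists>k\<in>{0..}. ?r k (x + y) \<le> ?r i x + ?r j y" if "i \<in> {0..}" "j \<in> {0..}" for i j x y
        using that qD(1)[of "x + i *\<^sub>R w" "y + j *\<^sub>R w"]
        by (intro bexI[of _ "i + j"]) (auto simp: algebra_simps)
      show "\<exists>k\<in>{0..}. ?r k (t *\<^sub>R x) \<le> t * ?r i x" if "t > 0" "i \<in> {0..}" for t i x
        using that qD(2)[of t "x + i *\<^sub>R w"]
        by (intro bexI[of _ "t * i"]) (auto simp: algebra_simps)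
    qed simp
    moreover have bb: "bdd_below ((\<lambda>t. ?r t x) ` {0..})" for x
      using lower by (intro bdd_belowI2) auto
    moreover have "?q' x \<le> q x" for x
      using cINF_lower[OF bb[of x], of 0] by simp
    ultimately have "?q' = q"
      by (intro min) auto
    then have "q v = ?q' v"
      by (rule fun_cong[symmetric])
    also have "\<dots> \<le> ?r 1 v"
      by (rule cINF_lower[OF bb]) simp
    finally show ?thesis
      by simp
  qed
  have add: "q (x + y) = q x + q y" for x y
    using super[of x y] qD(1)[of x y] by simp
  have neg: "q (- x) = - q x" for x
    using add[of x "- x"] qD(3) by simp
  show ?thesis
  proof (rule linearI)
    show "q (r *\<^sub>R x) = r *\<^sub>R q x" for r x
      using q0[of r x] q0[of "- r" x] neg[of "r *\<^sub>R x"] by (cases "r \<ge> 0") auto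
  qed (rule add)
qed

theorem ex_linear_le_sublinear:
  fixes p :: "'v::real_vector \<Rightarrow> real"
  assumes p: "sublinear p"
  obtains f where "linear f" and "\<And>x. f x \<le> p x"
proof -
  let ?A = "{q. sublinear q \<and> (\<forall>x. q x \<le> p x)}"
  let ?r = "{(q', q). q \<in> ?A \<and> q' \<in> ?A \<and> (\<forall>x. q x \<le> q' x)}"
  have "Field ?r = ?A"
    by (auto simp: Field_def)
  moreover have "Partial_order ?r"
    by (auto simp: partial_order_on_def preorder_on_def refl_on_def trans_def antisym_def
        Field_def fun_eq_iff intro: order_trans order_antisym)
  moreover have "\<exists>u\<in>?A. \<forall>q\<in>C. (q, u) \<in> ?r" if C: "C \<in> Chains ?r" for C
  proof (cases "C = {}")
    case True
    then show ?thesis using p by auto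
  next
    case False
    have CA: "q \<in> ?A" if "q \<in> C" for q
      using C that by (auto simp: Chains_def)
    have tot: "(\<forall>x. q x \<le> q' x) \<or> (\<forall>x. q' x \<le> q x)" if "q \<in> C" "q' \<in> C" for q q'
      using C that by (auto simp: Chains_def)
    have lower: "- p (- x) \<le> q x" if "q \<in> C" for q x
    proof -
      have "- q (- x) \<le> q x"
        using CA[OF that] sublinearD(4) by blast
      moreover have "q (- x) \<le> p (- x)"
        using CA[OF that] by blast
      ultimately show ?thesis by linarith
    qed
    let ?u = "\<lambda>x. INF q\<in>C. q x"
    have "sublinear ?u"
    proof (rule sublinear_INF[where b = "\<lambda>x. - p (- x)" and q = "\<lambda>q. q"])
      show "\<exists>k\<in>C. k (x + y) \<le> i x + j y" if "i \<in> C" "j \<in> C" for i j x y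
      proof -
        have "i (x + y) \<le> i x + i y" "j (x + y) \<le> j x + j y"
          using CA that sublinearD(1) by blast+
        then show ?thesis
          using tot[OF that] that by (meson add_left_mono add_right_mono order_trans)
      qed
      show "\<exists>k\<in>C. k (t *\<^sub>R x) \<le> t * i x" if "t > 0" "i \<in> C" for t i x
        using CA that sublinearD(2) by (metis (mono_tags, lifting) mem_Collect_eq order_refl)
    qed (use False lower in auto)
    moreover have le: "?u x \<le> q x" if "q \<in> C" for q x
      using lower by (intro cINF_lower that bdd_belowI2)
    moreover have "?u x \<le> p x" for x
    proof -
      obtain q where "q \<in> C" using False by blast
      then have "?u x \<le> q x" "q x \<le> p x"
        using le CA by blast+
      then show ?thesis by linarith
    qed
    ultimately have "?u \<in> ?A" by blast
    then show ?thesis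
      using CA le by (intro bexI[of _ ?u]) auto
  qed
  ultimately obtain q where q: "q \<in> ?A" and max: "\<forall>q'\<in>?A. (q, q') \<in> ?r \<longrightarrow> q' = q"
    using Zorns_po_lemma[of ?r] by auto
  have "linear q"
  proof (rule minimal_sublinear_linear)
    show "q' = q" if "sublinear q'" "\<And>x. q' x \<le> q x" for q'
    proof -
      have "q' \<in> ?A"
        using that q by (auto intro: order_trans)
      then show ?thesis
        using max q that by auto
    qed
  qed (use q in auto)
  with q that show thesis by auto
qed

text \<open>
  The cone \<open>I\<close> prescribes lower bounds for the functional: its graph elements \<open>(v, r)\<close> ask for
  \<open>r \<le> f v\<close>. With a cone over a linear subspace this is the extension form of the Hahn-Banach
  theorem, with the cone over a translated convex set it is the separation theorem. Any linear
  functional below the infimal convolution of \<open>p\<close> with the negative of the prescribed bounds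
  does both jobs.
\<close>

theorem sandwich_linear:
  fixes p :: "'v::real_vector \<Rightarrow> real" and I :: "('v \<times> real) set"
  assumes p: "sublinear p"
    and zero: "(0, 0) \<in> I"
    and add: "\<And>v r w s. (v, r) \<in> I \<Longrightarrow> (w, s) \<in> I \<Longrightarrow> (v + w, r + s) \<in> I"
    and scale: "\<And>t v r. t > 0 \<Longrightarrow> (v, r) \<in> I \<Longrightarrow> (t *\<^sub>R v, t * r) \<in> I"
    and le: "\<And>v r. (v, r) \<in> I \<Longrightarrow> r \<le> p v"
  obtains f where "linear f" and "\<And>x. f x \<le> p x" and "\<And>v r. (v, r) \<in> I \<Longrightarrow> r \<le> f v"
proof -
  note pD = sublinearD[OF p]
  let ?q = "\<lambda>i x. p (x + fst i) - snd i"
  let ?s = "\<lambda>x. INF i\<in>I. ?q i x"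
  have lower: "- p (- x) \<le> ?q i x" if "i \<in> I" for i x
    using pD(1)[of "x + fst i" "- x"] le[of "fst i" "snd i"] that by simp
  have "sublinear ?s"
  proof (rule sublinear_INF[where b = "\<lambda>x. - p (- x)"])
    show "\<exists>k\<in>I. ?q k (x + y) \<le> ?q i x + ?q j y" if "i \<in> I" "j \<in> I" for i j x y
      using that add[of "fst i" "snd i" "fst j" "snd j"] pD(1)[of "x + fst i" "y + fst j"]
      by (intro bexI[of _ "(fst i + fst j, snd i + snd j)"]) (auto simp: algebra_simps)
    show "\<exists>k\<in>I. ?q k (t *\<^sub>R x) \<le> t * ?q i x" if "t > 0" "i \<in> I" for t i x
      using that scale[of t "fst i" "snd i"] pD(2)[of t "x + fst i"]
      by (intro bexI[of _ "(t *\<^sub>R fst i, t * snd i)"]) (auto simp: algebra_simps)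
  qed (use zero lower in auto)
  then obtain f where f: "linear f" and fs: "\<And>x. f x \<le> ?s x"
    using ex_linear_le_sublinear by blast
  have fq: "f x \<le> ?q i x" if "i \<in> I" for i x
    using fs[of x] cINF_lower[of "\<lambda>i. ?q i x" I i] lower that
    by (meson bdd_belowI2 order_trans)
  show thesis
  proof
    show "f x \<le> p x" for x
      using fq[OF zero, of x] by simp
    show "r \<le> f v" if "(v, r) \<in> I" for v r
      using fq[OF that, of "- v"] pD(3) linear_neg[OF f, of v] by simp
  qed (rule f)
qed

text \<open>
  The space \<open>W\<^sup>N\<close> with the maximum norm is realised inside the bounded sequences in \<open>W\<close>, since
  \<open>N\<close> has to remain a variable.
\<close>

definition seq_of :: "nat \<Rightarrow> (nat \<Rightarrow> 'w::real_normed_vector) \<Rightarrow> (nat \<Rightarrow>\<^sub>C 'w)"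
  where "seq_of N x = Bcontfun (\<lambda>k. if k < N then x k else 0)"

lemma apply_seq_of [simp]: "apply_bcontfun (seq_of N x) k = (if k < N then x k else 0)"
proof -
  have "range (\<lambda>k. if k < N then x k else 0) \<subseteq> insert 0 (x ` {..<N})"
    by auto
  then have "(\<lambda>k. if k < N then x k else 0) \<in> bcontfun"
    by (auto simp: bcontfun_def intro!: finite_imp_bounded dest: finite_subset)
  then show ?thesis
    by (simp add: seq_of_def Bcontfun_inverse)
qed

lemma seq_of_add: "seq_of N x + seq_of N y = seq_of N (\<lambda>k. x k + y k)"
  by (rule bcontfun_eqI) (simp add: plus_bcontfun.rep_eq)

lemma seq_of_scaleR: "t *\<^sub>R seq_of N x = seq_of N (\<lambda>k. t *\<^sub>R x k)"
  by (rule bcontfun_eqI) (simp add: scaleR_bcontfun.rep_eq)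

lemma norm_seq_of_le: "M \<ge> 0 \<Longrightarrow> (\<And>k. k < N \<Longrightarrow> norm (x k) \<le> M) \<Longrightarrow> norm (seq_of N x) \<le> M"
  by (rule norm_bound) simp

lemma norm_le_seq_of: "k < N \<Longrightarrow> norm (x k) \<le> norm (seq_of N x)"
  using norm_bounded[of "seq_of N x" k] by simp

lemma seq_of_sum: "seq_of N x = (\<Sum>k<N. seq_of N (\<lambda>i. if i = k then x k else 0))"
proof -
  have "apply_bcontfun (\<Sum>k\<in>A. g k) i = (\<Sum>k\<in>A. apply_bcontfun (g k) i)"
    if "finite A" for A and g :: "nat \<Rightarrow> nat \<Rightarrow>\<^sub>C 'a" and i
    using that by (induction A rule: finite_induct) (auto simp: plus_bcontfun.rep_eq)
  then show ?thesis
    by (intro bcontfun_eqI) (simp add: if_distrib[of "\<lambda>z. if _ then z else _"] cong: if_cong)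
qed

text \<open>
  The sandwich theorem in \<open>W\<^sup>N\<close>. A functional on \<open>W\<^sup>N\<close> that is bounded by \<open>c\<close> times the
  maximum norm splits into coordinate functionals, whose norms add up to at most \<open>c\<close>.
\<close>

theorem finite_power_sandwich:
  fixes I :: "((nat \<Rightarrow> 'w::real_normed_vector) \<times> real) set"
  assumes c: "c \<ge> 0"
    and zero: "(\<lambda>k. 0, 0) \<in> I"
    and add: "\<And>x r y s. (x, r) \<in> I \<Longrightarrow> (y, s) \<in> I \<Longrightarrow> (\<lambda>k. x k + y k, r + s) \<in> I"
    and scale: "\<And>t x r. t > 0 \<Longrightarrow> (x, r) \<in> I \<Longrightarrow> (\<lambda>k. t *\<^sub>R x k, t * r) \<in> I"
    and le: "\<And>x r M. (x, r) \<in> I \<Longrightarrow> M > 0 \<Longrightarrow> (\<And>k. k < N \<Longrightarrow> norm (x k) \<le> M) \<Longrightarrow> r \<le> c * M"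
  obtains \<psi> :: "nat \<Rightarrow> 'w \<Rightarrow> real" and b :: "nat \<Rightarrow> real"
  where "\<And>k. linear (\<psi> k)" and "\<And>k x. \<psi> k x \<le> b k * norm x"
    and "\<And>k. b k \<ge> 0" and "(\<Sum>k<N. b k) \<le> c"
    and "\<And>x r. (x, r) \<in> I \<Longrightarrow> r \<le> (\<Sum>k<N. \<psi> k (x k))"
proof -
  let ?p = "\<lambda>x::nat \<Rightarrow>\<^sub>C 'w. c * norm x"
  let ?I = "(\<lambda>(x, r). (seq_of N x, r)) ` I"
  have "sublinear ?p"
    using c by (auto simp: sublinear_def distrib_left[symmetric] intro!: mult_left_mono norm_triangle_ineq)
  moreover have "(0, 0) \<in> ?I"
  proof -
    have "seq_of N (\<lambda>k. 0 :: 'w) = 0"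
      by (rule bcontfun_eqI) (simp)
    then show ?thesis
      using zero by force
  qed
  moreover have "(v + w, r + s) \<in> ?I" if vw: "(v, r) \<in> ?I" "(w, s) \<in> ?I" for v r w s
  proof -
    obtain x y where "(x, r) \<in> I" "(y, s) \<in> I" "v = seq_of N x" "w = seq_of N y"
      using vw by auto
    then show ?thesis
      using add[of x r y s] by (auto simp: seq_of_add intro!: image_eqI[of _ _ "(\<lambda>k. x k + y k, r + s)"])
  qed
  moreover have "(t *\<^sub>R v, t * r) \<in> ?I" if "t > 0" and v: "(v, r) \<in> ?I" for t v r
  proof -
    obtain x where "(x, r) \<in> I" "v = seq_of N x"
      using v by auto
    then show ?thesis
      using scale[OF \<open>t > 0\<close>, of x r]
      by (auto simp: seq_of_scaleR intro!: image_eqI[of _ _ "(\<lambda>k. t *\<^sub>R x k, t * r)"])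
  qed
  moreover have "r \<le> ?p v" if v: "(v, r) \<in> ?I" for v r
  proof -
    obtain x where x: "(x, r) \<in> I" "v = seq_of N x"
      using v by auto
    have "r \<le> c * (norm v + e)" if "e > 0" for e
      by (rule le[OF x(1)]) (use norm_le_seq_of[of _ N x] x(2) that in \<open>auto simp: add_nonneg_pos intro: add_increasing2\<close>)
    then have *: "r \<le> ?p v + c * e" if "e > 0" for e
      using that by (simp add: distrib_left)
    show ?thesis
    proof (rule field_le_epsilon)
      fix e :: real assume "e > 0"
      then have "c * (e / (c + 1)) \<le> e" "e / (c + 1) > 0"
        using c by (auto simp: field_simps)
      then show "r \<le> ?p v + e"
        using *[of "e / (c + 1)"] by linarith
    qed
  qed
  ultimately obtain f where f: "linear f" and fp: "\<And>x. f x \<le> ?p x"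
    and fI: "\<And>v r. (v, r) \<in> ?I \<Longrightarrow> r \<le> f v"
    using sandwich_linear[of ?p ?I] by blast
  define \<psi> where "\<psi> k x = f (seq_of N (\<lambda>i. if i = k then x else 0))" for k x
  have lin: "linear (\<psi> k)" for k
  proof (rule linearI)
    show "\<psi> k (x + y) = \<psi> k x + \<psi> k y" for x y
      unfolding \<psi>_def linear_add[OF f, symmetric] seq_of_add by (intro arg_cong[where f = f] arg_cong[where f = "seq_of N"]) auto
    show "\<psi> k (r *\<^sub>R x) = r *\<^sub>R \<psi> k x" for r x
      unfolding \<psi>_def linear_scale[OF f, symmetric] seq_of_scaleR by (intro arg_cong[where f = f] arg_cong[where f = "seq_of N"]) auto
  qed
  have \<psi>_sum: "f (seq_of N x) = (\<Sum>k<N. \<psi> k (x k))" for x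
    unfolding \<psi>_def by (subst seq_of_sum) (rule linear_sum[OF f])
  have \<psi>_c: "\<psi> k x \<le> c * norm x" for k x
    unfolding \<psi>_def by (rule order_trans[OF fp]) (auto intro!: mult_left_mono c norm_seq_of_le)
  define b where "b k = (SUP x\<in>cball 0 1. \<psi> k x)" for k
  have bdd: "bdd_above (\<psi> k ` cball 0 1)" for k
  proof (rule bdd_aboveI2)
    fix x :: 'w assume "x \<in> cball 0 1"
    then have "c * norm x \<le> c"
      using c by (simp add: mult_left_le)
    then show "\<psi> k x \<le> c"
      using \<psi>_c[of k x] by linarith
  qed
  have b_ge: "\<psi> k x \<le> b k" if "norm x \<le> 1" for k x
    unfolding b_def using that by (intro cSUP_upper bdd) auto
  show thesis
  proof
    show "linear (\<psi> k)" for k by (rule lin)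
    show "b k \<ge> 0" for k
      using b_ge[of 0 k] linear_0[OF lin] by simp
    show "\<psi> k x \<le> b k * norm x" for k x
    proof (cases "x = 0")
      case True
      then show ?thesis using linear_0[OF lin] by simp
    next
      case False
      then have "inverse (norm x) * \<psi> k x \<le> b k"
        using b_ge[of "inverse (norm x) *\<^sub>R x" k] linear_scale[OF lin] by simp
      then show ?thesis
        using False by (simp add: field_simps)
    qed
    show "r \<le> (\<Sum>k<N. \<psi> k (x k))" if "(x, r) \<in> I" for x r
      using fI[of "seq_of N x" r] that unfolding \<psi>_sum by force
    show "(\<Sum>k<N. b k) \<le> c"
    proof (rule field_le_epsilon)
      fix e :: real assume e: "e > 0"
      have "\<exists>x. norm x \<le> 1 \<and> b k - e / (N + 1) < \<psi> k x" for k
      proof -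
        have "\<exists>x\<in>cball 0 1. b k - e / (N + 1) < \<psi> k x"
          using less_cSUP_iff[OF _ bdd, of "b k - e / (N + 1)" k] e by (auto simp: b_def[symmetric])
        then show ?thesis by auto
      qed
      then obtain x where x: "\<And>k. norm (x k) \<le> 1" "\<And>k. b k - e / (N + 1) < \<psi> k (x k)"
        by metis
      have "(\<Sum>k<N. b k) \<le> (\<Sum>k<N. \<psi> k (x k) + e / (N + 1))"
        using x(2) by (intro sum_mono) (smt (verit))
      also have "\<dots> = f (seq_of N x) + N * (e / (N + 1))"
        by (simp add: \<psi>_sum sum.distrib)
      also have "\<dots> \<le> c + e"
      proof -
        have "f (seq_of N x) \<le> c * norm (seq_of N x)" by (rule fp)
        also have "\<dots> \<le> c"
          using norm_seq_of_le[of 1 N x] x(1) c by (simp add: mult_left_le)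
        finally have "f (seq_of N x) \<le> c" .
        moreover have "N * (e / (N + 1)) \<le> e"
          using e by (simp add: field_simps)
        ultimately show ?thesis by linarith
      qed
      finally show "(\<Sum>k<N. b k) \<le> c + e" .
    qed
  qed
qed

section \<open>Operators and functionals\<close>

lemma scaleC_minus1: "(-1) *\<^sub>C x = - (x :: 'a::complex_normed_vector)"
  by (metis complex_vector.scale_minus_left scaleC_one)

lemma cblinfun_apply_scaleC_right:
  "cblinfun_apply T (c *\<^sub>C x) = c *\<^sub>C cblinfun_apply T x"
  using blinfun_of_cblinfun[of T] by (simp add: clinear_blinfun_iff cblinfun_apply.rep_eq)

lemma bounded_linear_cblinfun_apply: "bounded_linear (cblinfun_apply T)"
  by (simp add: cblinfun_apply.rep_eq[abs_def] blinfun.bounded_linear_right)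

lemma cblinfun_apply_add_right: "cblinfun_apply T (x + y) = cblinfun_apply T x + cblinfun_apply T y"
  and cblinfun_apply_diff_right: "cblinfun_apply T (x - y) = cblinfun_apply T x - cblinfun_apply T y"
  and cblinfun_apply_zero_right: "cblinfun_apply T 0 = 0"
  and cblinfun_apply_minus_right: "cblinfun_apply T (- x) = - cblinfun_apply T x"
  and cblinfun_apply_sum_right: "cblinfun_apply T (sum g A) = (\<Sum>i\<in>A. cblinfun_apply T (g i))"
  and cblinfun_apply_scaleR_right: "cblinfun_apply T (r *\<^sub>R x) = r *\<^sub>R cblinfun_apply T x"
  using bounded_linear.linear[OF bounded_linear_cblinfun_apply[of T]]
  by (simp_all add: linear_add linear_diff linear_0 linear_neg linear_sum linear_scale)

lemma cblinfun_apply_zero: "cblinfun_apply 0 x = 0"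
  by transfer simp

lemma cblinfun_apply_minus: "cblinfun_apply (S - T) x = cblinfun_apply S x - cblinfun_apply T x"
  by transfer (simp add: blinfun.diff_left)

lemma cblinfun_apply_uminus: "cblinfun_apply (- T) x = - cblinfun_apply T x"
  by transfer (simp add: blinfun.minus_left)

lemma cblinfun_apply_sum: "cblinfun_apply (sum g A) x = (\<Sum>i\<in>A. cblinfun_apply (g i) x)"
  by (induction A rule: infinite_finite_induct) (auto simp: cblinfun_apply_zero cblinfun_apply_plus)

lemma cblinfun_apply_compose: "cblinfun_apply (S o\<^sub>C\<^sub>L T) x = cblinfun_apply S (cblinfun_apply T x)"
  by transfer simp

lemma cblinfun_apply_id: "cblinfun_apply id_cblinfun x = x"
  by transfer simp

lemmas cblinfun_apply_simps =
  cblinfun_apply_plus cblinfun_apply_minus cblinfun_apply_uminus cblinfun_apply_zero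
  cblinfun_apply_scaleC cblinfun_apply_sum cblinfun_apply_compose cblinfun_apply_id
  cblinfun_apply_add_right cblinfun_apply_diff_right cblinfun_apply_minus_right
  cblinfun_apply_zero_right cblinfun_apply_scaleC_right cblinfun_apply_sum_right

lemma cblinfun_compose_assoc: "(R o\<^sub>C\<^sub>L S) o\<^sub>C\<^sub>L T = R o\<^sub>C\<^sub>L (S o\<^sub>C\<^sub>L T)"
  by (rule cblinfun_eqI) (simp add: cblinfun_apply_simps)

lemma cblinfun_compose_add_left: "(R + S) o\<^sub>C\<^sub>L T = R o\<^sub>C\<^sub>L T + S o\<^sub>C\<^sub>L T"
  by (rule cblinfun_eqI) (simp add: cblinfun_apply_simps)

lemma cblinfun_compose_add_right: "R o\<^sub>C\<^sub>L (S + T) = R o\<^sub>C\<^sub>L S + R o\<^sub>C\<^sub>L T"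
  by (rule cblinfun_eqI) (simp add: cblinfun_apply_simps)

lemma cblinfun_compose_diff_left: "(R - S) o\<^sub>C\<^sub>L T = R o\<^sub>C\<^sub>L T - S o\<^sub>C\<^sub>L T"
  by (rule cblinfun_eqI) (simp add: cblinfun_apply_simps)

lemma cblinfun_compose_diff_right: "R o\<^sub>C\<^sub>L (S - T) = R o\<^sub>C\<^sub>L S - R o\<^sub>C\<^sub>L T"
  by (rule cblinfun_eqI) (simp add: cblinfun_apply_simps)

lemma cblinfun_compose_scaleC_left: "(c *\<^sub>C R) o\<^sub>C\<^sub>L T = c *\<^sub>C (R o\<^sub>C\<^sub>L T)"
  by (rule cblinfun_eqI) (simp add: cblinfun_apply_simps)

lemma cblinfun_compose_scaleC_right: "R o\<^sub>C\<^sub>L (c *\<^sub>C T) = c *\<^sub>C (R o\<^sub>C\<^sub>L T)"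
  by (rule cblinfun_eqI) (simp add: cblinfun_apply_simps)

lemma cblinfun_compose_zero_left: "0 o\<^sub>C\<^sub>L T = 0"
  by (rule cblinfun_eqI) (simp add: cblinfun_apply_simps)

lemma cblinfun_compose_zero_right: "R o\<^sub>C\<^sub>L 0 = 0"
  by (rule cblinfun_eqI) (simp add: cblinfun_apply_simps)

lemma cblinfun_compose_id_left: "id_cblinfun o\<^sub>C\<^sub>L T = T"
  by (rule cblinfun_eqI) (simp add: cblinfun_apply_simps)

lemma cblinfun_compose_id_right: "R o\<^sub>C\<^sub>L id_cblinfun = R"
  by (rule cblinfun_eqI) (simp add: cblinfun_apply_simps)

lemma cblinfun_compose_sum_left: "sum g A o\<^sub>C\<^sub>L T = (\<Sum>i\<in>A. g i o\<^sub>C\<^sub>L T)"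
  by (rule cblinfun_eqI) (simp add: cblinfun_apply_simps)

lemma cblinfun_compose_sum_right: "R o\<^sub>C\<^sub>L sum h A = (\<Sum>i\<in>A. R o\<^sub>C\<^sub>L h i)"
  by (rule cblinfun_eqI) (simp add: cblinfun_apply_simps)

lemmas cblinfun_compose_simps =
  cblinfun_compose_assoc cblinfun_compose_add_left cblinfun_compose_add_right
  cblinfun_compose_diff_left cblinfun_compose_diff_right
  cblinfun_compose_scaleC_left cblinfun_compose_scaleC_right
  cblinfun_compose_zero_left cblinfun_compose_zero_right
  cblinfun_compose_id_left cblinfun_compose_id_right
  cblinfun_compose_sum_left cblinfun_compose_sum_right

lemma norm_cblinfun_compose: "norm (S o\<^sub>C\<^sub>L T) \<le> norm S * norm T"
  by transfer (rule norm_blinfun_compose)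

lemma norm_id_cblinfun: "norm id_cblinfun \<le> 1"
  by (rule norm_cblinfun_bound) (auto simp: cblinfun_apply_id)

lemma ex_cblinfun:
  fixes f :: "'a::complex_normed_vector \<Rightarrow> 'b::complex_normed_vector"
  assumes add: "\<And>x y. f (x + y) = f x + f y" and scale: "\<And>c x. f (c *\<^sub>C x) = c *\<^sub>C f x"
    and bound: "\<And>x. norm (f x) \<le> K * norm x"
  obtains T where "\<And>x. cblinfun_apply T x = f x"
proof -
  have "bounded_linear f"
    by (rule bounded_linear_intro[where K = K]) (auto simp: add scaleR_scaleC scale bound mult.commute)
  then have "blinfun_apply (Blinfun f) = f"
    by (rule bounded_linear_Blinfun_apply)
  then have "cblinfun_apply (Abs_cblinfun (Blinfun f)) x = f x" for x
    unfolding cblinfun_apply.rep_eq by (subst Abs_cblinfun_inverse) (auto simp: clinear_blinfun_iff scale)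
  then show thesis by (rule that)
qed

definition rank_one :: "('a::complex_normed_vector \<Rightarrow>\<^sub>C\<^sub>L complex) \<Rightarrow> 'b::complex_normed_vector \<Rightarrow> ('a \<Rightarrow>\<^sub>C\<^sub>L 'b)"
  where "rank_one f u = (SOME T. \<forall>x. cblinfun_apply T x = cblinfun_apply f x *\<^sub>C u)"

lemma rank_one_apply: "cblinfun_apply (rank_one f u) x = cblinfun_apply f x *\<^sub>C u"
proof -
  have "norm (cblinfun_apply f x *\<^sub>C u) \<le> (norm f * norm u) * norm x" for x
    using mult_right_mono[OF norm_cblinfun_apply[of f x] norm_ge_zero[of u]]
    by (simp add: norm_scaleC mult_ac)
  note bound = this
  have add: "cblinfun_apply f (x + y) *\<^sub>C u = cblinfun_apply f x *\<^sub>C u + cblinfun_apply f y *\<^sub>C u" for x y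
    by (simp add: cblinfun_apply_simps scaleC_add_left)
  have scale: "cblinfun_apply f (c *\<^sub>C x) *\<^sub>C u = c *\<^sub>C cblinfun_apply f x *\<^sub>C u" for c x
    by (simp add: cblinfun_apply_simps scaleC_scaleC scaleC_complex_def)
  obtain T where "\<And>x. cblinfun_apply T x = cblinfun_apply f x *\<^sub>C u"
    using ex_cblinfun[of "\<lambda>x. cblinfun_apply f x *\<^sub>C u", OF add scale bound] by blast
  then have "\<exists>T. \<forall>x. cblinfun_apply T x = cblinfun_apply f x *\<^sub>C u" by blast
  from someI_ex[OF this] show ?thesis unfolding rank_one_def by blast
qed

lemma norm_rank_one: "norm (rank_one f u) \<le> norm f * norm u"
proof (rule norm_cblinfun_bound)
  show "norm (cblinfun_apply (rank_one f u) x) \<le> norm f * norm u * norm x" for x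
    using mult_right_mono[OF norm_cblinfun_apply[of f x] norm_ge_zero[of u]]
    by (simp add: rank_one_apply norm_scaleC mult_ac)
qed simp

lemma compose_rank_one: "S o\<^sub>C\<^sub>L rank_one f u = rank_one f (cblinfun_apply S u)"
  by (rule cblinfun_eqI) (simp add: rank_one_apply cblinfun_apply_simps)

lemma rank_one_compose: "rank_one f u o\<^sub>C\<^sub>L S = rank_one (f o\<^sub>C\<^sub>L S) u"
  by (rule cblinfun_eqI) (simp add: rank_one_apply cblinfun_apply_simps)

text \<open>
  The complex functional with real part \<open>\<psi>\<close> is \<open>\<psi> x - \<i> \<psi> (\<i> x)\<close>. Rotating its value to the
  positive real axis shows that its norm is not larger than that of \<open>\<psi>\<close>.
\<close>

lemma complexify:
  fixes \<psi> :: "'a::complex_normed_vector \<Rightarrow> real"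
  assumes lin: "linear \<psi>" and bound: "\<And>x. \<psi> x \<le> b * norm x" and b: "b \<ge> 0"
  obtains f :: "'a \<Rightarrow>\<^sub>C\<^sub>L complex" where "\<And>x. Re (cblinfun_apply f x) = \<psi> x" and "norm f \<le> b"
proof -
  define f where "f x = Complex (\<psi> x) (- \<psi> (\<i> *\<^sub>C x))" for x
  have scR: "complex_of_real r *\<^sub>C x = r *\<^sub>R x" for r and x :: 'a
    by (simp add: scaleR_scaleC)
  have add: "f (x + y) = f x + f y" for x y
    by (simp add: f_def scaleC_add_right linear_add[OF lin] complex_eq_iff)
  have scale: "f (c *\<^sub>C x) = c *\<^sub>C f x" for c x
  proof -
    have c: "c *\<^sub>C x = Re c *\<^sub>R x + Im c *\<^sub>R (\<i> *\<^sub>C x)"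
    proof -
      have "c = of_real (Re c) + of_real (Im c) * \<i>"
        by (simp add: complex_eq_iff)
      then have "c *\<^sub>C x = (of_real (Re c) + of_real (Im c) * \<i>) *\<^sub>C x" by simp
      then show ?thesis
        by (simp only: scaleC_add_left scaleC_scaleC[symmetric] scR)
    qed
    have ii: "\<i> *\<^sub>C \<i> *\<^sub>C x = - x"
      by (simp add: scaleC_scaleC scaleC_minus1)
    have sw: "\<i> *\<^sub>C r *\<^sub>R y = r *\<^sub>R (\<i> *\<^sub>C y)" for r and y :: 'a
      by (simp only: scR[symmetric] scaleC_scaleC mult.commute)
    have ic: "\<i> *\<^sub>C c *\<^sub>C x = Re c *\<^sub>R (\<i> *\<^sub>C x) - Im c *\<^sub>R x"
      unfolding c by (simp only: scaleC_add_right sw ii scaleR_minus_right diff_conv_add_uminus)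
    show ?thesis
      unfolding f_def ic unfolding c
      by (simp add: linear_add[OF lin] linear_diff[OF lin] linear_scale[OF lin] scaleC_complex_def
          complex_eq_iff)
  qed
  have Re: "Re (f x) = \<psi> x" for x
    by (simp add: f_def)
  have nb: "norm (f x) \<le> b * norm x" for x
  proof (cases "f x = 0")
    case False
    \<comment> \<open>rotates the value \<open>f x\<close> to the positive real axis\<close>
    define u where "u = cnj (f x) / cmod (f x)"
    have "cmod u = 1"
      using False by (simp add: u_def norm_divide)
    have "cmod (f x) = Re (u * f x)"
      using False by (simp add: u_def mult.commute[of "cnj _"] complex_norm_square[symmetric]
          power2_eq_square flip: of_real_mult of_real_divide)
    also have "\<dots> = \<psi> (u *\<^sub>C x)"
      by (simp add: Re[symmetric] scale scaleC_complex_def)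
    also have "\<dots> \<le> b * norm x"
      using bound[of "u *\<^sub>C x"] \<open>cmod u = 1\<close> by (simp add: norm_scaleC)
    finally show ?thesis .
  qed (use b in simp)
  obtain T where T: "\<And>x. cblinfun_apply T x = f x"
    using ex_cblinfun[of f, OF add scale nb] by blast
  show thesis
    by (rule that[of T]) (auto simp: T Re nb intro!: norm_cblinfun_bound b)
qed

lemma ex_functional_eq_1:
  fixes u :: "'a::complex_normed_vector"
  assumes "u \<noteq> 0"
  obtains g :: "'a \<Rightarrow>\<^sub>C\<^sub>L complex" where "cblinfun_apply g u = 1"
proof -
  define I where "I = {(t *\<^sub>R u, t * norm u) | t. t \<ge> 0}"
  have "sublinear (norm :: 'a \<Rightarrow> real)"
    by (auto simp: sublinear_def norm_triangle_ineq)
  moreover have "(0, 0) \<in> I"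
    by (auto simp: I_def intro!: exI[of _ 0])
  moreover have "(v + w, r + s) \<in> I" if vw: "(v, r) \<in> I" "(w, s) \<in> I" for v r w s
  proof -
    obtain a b where "a \<ge> 0" "v = a *\<^sub>R u" "r = a * norm u" "b \<ge> 0" "w = b *\<^sub>R u" "s = b * norm u"
      using vw unfolding I_def by blast
    then show ?thesis
      by (auto simp: I_def algebra_simps intro!: exI[of _ "a + b"])
  qed
  moreover have "(t *\<^sub>R v, t * r) \<in> I" if "t > 0" and v: "(v, r) \<in> I" for t v r
  proof -
    obtain a where "a \<ge> 0" "v = a *\<^sub>R u" "r = a * norm u"
      using v unfolding I_def by blast
    then show ?thesis
      using \<open>t > 0\<close> by (auto simp: I_def intro!: exI[of _ "t * a"])
  qed
  moreover have "r \<le> norm v" if "(v, r) \<in> I" for v r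
    using that by (auto simp: I_def)
  ultimately obtain f where "linear f" "\<And>x. f x \<le> norm x" and fI: "\<And>v r. (v, r) \<in> I \<Longrightarrow> r \<le> f v"
    using sandwich_linear[of "norm :: 'a \<Rightarrow> real" I] by blast
  then have "\<And>x. f x \<le> 1 * norm x" by simp
  then obtain g :: "'a \<Rightarrow>\<^sub>C\<^sub>L complex" where g: "\<And>x. Re (cblinfun_apply g x) = f x"
    using complexify[OF \<open>linear f\<close> _ zero_le_one] by blast
  have "(u, norm u) \<in> I"
    by (auto simp: I_def intro!: exI[of _ 1])
  then have "cblinfun_apply g u \<noteq> 0"
    using fI[of u "norm u"] g[of u] assms by auto
  then have "cblinfun_apply (inverse (cblinfun_apply g u) *\<^sub>C g) u = 1"
    by (simp add: cblinfun_apply_scaleC scaleC_complex_def)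
  then show thesis by (rule that)
qed

section \<open>Finite-rank operators and projections\<close>

text \<open>
  The condition that defines \<open>finite_rank_ops\<close>, as a predicate and for operators between two
  spaces that may differ: it is applied on a space and on its dual, and the rank-one
  representation holds in this generality.
\<close>

definition finite_rank :: "('a::complex_normed_vector \<Rightarrow>\<^sub>C\<^sub>L 'b::complex_normed_vector) \<Rightarrow> bool"
  where "finite_rank T \<longleftrightarrow> (\<exists>B. finite B \<and> range (cblinfun_apply T) \<subseteq> complex_vector.span B)"

lemma finite_rank_ops_iff: "T \<in> finite_rank_ops \<longleftrightarrow> finite_rank T"
  by (simp add: finite_rank_ops_def finite_rank_def)

lemma finite_rankI: "finite B \<Longrightarrow> (\<And>x. cblinfun_apply T x \<in> complex_vector.span B) \<Longrightarrow> finite_rank T"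
  by (auto simp: finite_rank_def)

lemma finite_rank_zero [simp]: "finite_rank 0"
  by (rule finite_rankI[of "{}"]) (auto simp: cblinfun_apply_zero)

lemma finite_rank_add:
  assumes "finite_rank S" "finite_rank T"
  shows "finite_rank (S + T)"
proof -
  obtain A B where "finite A" "range (cblinfun_apply S) \<subseteq> complex_vector.span A"
    "finite B" "range (cblinfun_apply T) \<subseteq> complex_vector.span B"
    using assms by (auto simp: finite_rank_def)
  moreover have "complex_vector.span A \<subseteq> complex_vector.span (A \<union> B)"
    "complex_vector.span B \<subseteq> complex_vector.span (A \<union> B)"
    by (auto intro: complex_vector.span_mono[THEN subsetD])
  ultimately show ?thesis
    by (intro finite_rankI[of "A \<union> B"]) (auto simp: cblinfun_apply_plus intro!: complex_vector.span_add)
qed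

lemma finite_rank_scaleC:
  assumes "finite_rank T"
  shows "finite_rank (c *\<^sub>C T)"
  using assms unfolding finite_rank_def
  by (auto simp: cblinfun_apply_scaleC image_subset_iff intro: complex_vector.span_scale)

lemma finite_rank_diff: "finite_rank S \<Longrightarrow> finite_rank T \<Longrightarrow> finite_rank (S - T)"
  using finite_rank_add[of S "(-1) *\<^sub>C T"] finite_rank_scaleC[of T "-1"]
  by (simp add: scaleC_minus1)

lemma finite_rank_sum: "(\<And>i. i \<in> A \<Longrightarrow> finite_rank (g i)) \<Longrightarrow> finite_rank (sum g A)"
  by (induction A rule: infinite_finite_induct) (auto intro: finite_rank_add)

lemma finite_rank_compose_right: "finite_rank S \<Longrightarrow> finite_rank (S o\<^sub>C\<^sub>L T)"
  by (auto simp: finite_rank_def image_subset_iff cblinfun_apply_compose)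

lemma finite_rank_rank_one [simp]: "finite_rank (rank_one f u)"
  by (rule finite_rankI[of "{u}"])
    (auto simp: rank_one_apply intro: complex_vector.span_scale complex_vector.span_base)

lemma finite_rank_compose_left:
  assumes "finite_rank T"
  shows "finite_rank (S o\<^sub>C\<^sub>L T)"
proof -
  obtain B where B: "finite B" "\<And>x. cblinfun_apply T x \<in> complex_vector.span B"
    using assms by (auto simp: finite_rank_def)
  have "cblinfun_apply S v \<in> complex_vector.span (cblinfun_apply S ` B)"
    if "v \<in> complex_vector.span B" for v
    using that
  proof (induction rule: complex_vector.span_induct_alt)
    case base
    then show ?case by (simp add: cblinfun_apply_zero_right complex_vector.span_zero)
  next
    case (step c x y)
    then show ?case
      by (simp add: cblinfun_apply_simps complex_vector.span_add complex_vector.span_scale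
          complex_vector.span_base)
  qed
  with B show ?thesis
    by (intro finite_rankI[of "cblinfun_apply S ` B"]) (auto simp: cblinfun_apply_compose)
qed

lemmas finite_rank_intros =
  finite_rank_add finite_rank_diff finite_rank_scaleC finite_rank_sum
  finite_rank_compose_left finite_rank_compose_right

definition local_unit :: "('a::complex_normed_vector \<Rightarrow>\<^sub>C\<^sub>L 'a) \<Rightarrow> ('a \<Rightarrow>\<^sub>C\<^sub>L 'a) \<Rightarrow> bool"
  where "local_unit e S \<longleftrightarrow> e o\<^sub>C\<^sub>L S = S \<and> S o\<^sub>C\<^sub>L e = S"

lemma local_unit_trans: "local_unit e f \<Longrightarrow> local_unit f S \<Longrightarrow> local_unit e S"
  unfolding local_unit_def by (metis cblinfun_compose_assoc)

text \<open>
  The second condition says that \<open>E\<close> has finite rank and in addition provides continuous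
  coordinates on its range.
\<close>

definition finite_rank_projection :: "('a::complex_normed_vector \<Rightarrow>\<^sub>C\<^sub>L 'a) \<Rightarrow> bool"
  where "finite_rank_projection E \<longleftrightarrow> E o\<^sub>C\<^sub>L E = E \<and> (\<exists>d f u. E = (\<Sum>i<d::nat. rank_one (f i) (u i)))"

lemma finite_rank_projection_zero: "finite_rank_projection 0"
  by (auto simp: finite_rank_projection_def cblinfun_compose_simps intro!: exI[of _ 0])

lemma finite_rank_projection_finite_rank: "finite_rank_projection E \<Longrightarrow> finite_rank E"
  by (auto simp: finite_rank_projection_def intro!: finite_rank_sum)

text \<open>
  Enlarging a projection by one dimension. The three conditions make \<open>rank_one g u\<close> an
  idempotent that is orthogonal to \<open>Q\<close> on both sides.
\<close>

lemma projection_extend: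
  assumes Q: "finite_rank_projection Q" and gQ: "g o\<^sub>C\<^sub>L Q = 0" and Qu: "cblinfun_apply Q u = 0" and gu: "cblinfun_apply g u = 1"
  shows "finite_rank_projection (Q + rank_one g u)" and "local_unit (Q + rank_one g u) Q"
proof -
  have QQ: "Q o\<^sub>C\<^sub>L Q = Q"
    using Q by (simp add: finite_rank_projection_def)
  have gQ': "cblinfun_apply g (cblinfun_apply Q x) = 0" for x
    using arg_cong[OF gQ, of "\<lambda>T. cblinfun_apply T x"] by (simp add: cblinfun_apply_simps)
  have QQ': "cblinfun_apply Q (cblinfun_apply Q x) = cblinfun_apply Q x" for x
    using arg_cong[OF QQ, of "\<lambda>T. cblinfun_apply T x"] by (simp add: cblinfun_apply_simps)
  note s = cblinfun_apply_simps rank_one_apply gQ' QQ' Qu gu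
  obtain d f v where dfv: "Q = (\<Sum>i<d::nat. rank_one (f i) (v i))"
    using Q by (auto simp: finite_rank_projection_def)
  have "Q + rank_one g u = (\<Sum>i<Suc d. rank_one ((f(d := g)) i) ((v(d := u)) i))"
    by (simp add: dfv)
  moreover have "(Q + rank_one g u) o\<^sub>C\<^sub>L (Q + rank_one g u) = Q + rank_one g u"
    by (rule cblinfun_eqI) (simp add: s)
  ultimately show "finite_rank_projection (Q + rank_one g u)"
    unfolding finite_rank_projection_def by blast
  show "local_unit (Q + rank_one g u) Q"
    unfolding local_unit_def by (auto intro!: cblinfun_eqI simp: s)
qed

lemma projection_extend_vector:
  fixes Q :: "'a::complex_normed_vector \<Rightarrow>\<^sub>C\<^sub>L 'a"
  assumes Q: "finite_rank_projection Q"
  obtains Q' where "finite_rank_projection Q'" "local_unit Q' Q" "cblinfun_apply Q' b = b"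
proof (cases "cblinfun_apply Q b = b")
  case True
  then show ?thesis using that[of Q] Q by (simp add: local_unit_def finite_rank_projection_def)
next
  case False
  define u where "u = b - cblinfun_apply Q b"
  have "u \<noteq> 0" using False by (simp add: u_def)
  then obtain g0 :: "'a \<Rightarrow>\<^sub>C\<^sub>L complex" where g0: "cblinfun_apply g0 u = 1"
    by (rule ex_functional_eq_1)
  have QQ: "Q o\<^sub>C\<^sub>L Q = Q"
    using Q by (simp add: finite_rank_projection_def)
  have Qu: "cblinfun_apply Q u = 0"
    using arg_cong[OF QQ, of "\<lambda>T. cblinfun_apply T b"] by (simp add: u_def cblinfun_apply_simps)
  define g where "g = g0 - g0 o\<^sub>C\<^sub>L Q"
  have gQ: "g o\<^sub>C\<^sub>L Q = 0"
    by (simp add: g_def cblinfun_compose_simps QQ)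
  have gu: "cblinfun_apply g u = 1"
    by (simp add: g_def cblinfun_apply_simps Qu g0)
  have "cblinfun_apply g (cblinfun_apply Q b) = 0"
    using arg_cong[OF gQ, of "\<lambda>T. cblinfun_apply T b"] by (simp add: cblinfun_apply_simps)
  then have "cblinfun_apply g b = 1"
    using gu by (simp add: u_def cblinfun_apply_simps)
  then have "cblinfun_apply (Q + rank_one g u) b = b"
    by (simp add: cblinfun_apply_simps rank_one_apply scaleC_one u_def)
  then show ?thesis
    using that projection_extend[OF Q gQ Qu gu] by blast
qed

lemma projection_extend_functional:
  fixes Q :: "'a::complex_normed_vector \<Rightarrow>\<^sub>C\<^sub>L 'a" and h :: "'a \<Rightarrow>\<^sub>C\<^sub>L complex"
  assumes Q: "finite_rank_projection Q"
  obtains Q' where "finite_rank_projection Q'" "local_unit Q' Q" "h o\<^sub>C\<^sub>L Q' = h"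
proof (cases "h o\<^sub>C\<^sub>L Q = h")
  case True
  then show ?thesis using that[of Q] Q by (simp add: local_unit_def finite_rank_projection_def)
next
  case False
  define g where "g = h - h o\<^sub>C\<^sub>L Q"
  have QQ: "Q o\<^sub>C\<^sub>L Q = Q"
    using Q by (simp add: finite_rank_projection_def)
  have gQ: "g o\<^sub>C\<^sub>L Q = 0"
    by (simp add: g_def cblinfun_compose_simps QQ)
  have "g \<noteq> 0" using False by (simp add: g_def)
  then obtain x where x: "cblinfun_apply g x \<noteq> 0"
    by (metis cblinfun_apply_zero cblinfun_eqI)
  define u where "u = inverse (cblinfun_apply g x) *\<^sub>C (x - cblinfun_apply Q x)"
  have "cblinfun_apply g (cblinfun_apply Q x) = 0"
    using arg_cong[OF gQ, of "\<lambda>T. cblinfun_apply T x"] by (simp add: cblinfun_apply_simps)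
  then have gu: "cblinfun_apply g u = 1"
    using x by (simp add: u_def cblinfun_apply_simps scaleC_complex_def)
  have Qu: "cblinfun_apply Q u = 0"
    using arg_cong[OF QQ, of "\<lambda>T. cblinfun_apply T x"] by (simp add: u_def cblinfun_apply_simps)
  have hu: "cblinfun_apply h u = 1"
    using gu by (simp add: g_def cblinfun_apply_simps Qu)
  have "h o\<^sub>C\<^sub>L (Q + rank_one g u) = h"
    by (rule cblinfun_eqI) (simp add: cblinfun_apply_simps rank_one_apply hu g_def scaleC_complex_def)
  then show ?thesis
    using that projection_extend[OF Q gQ Qu gu] by blast
qed

lemma ex_projection_fixing_span:
  assumes "finite B"
  obtains Q where "finite_rank_projection Q" "\<And>b. b \<in> complex_vector.span B \<Longrightarrow> cblinfun_apply Q b = b"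
proof -
  have "\<exists>Q. finite_rank_projection Q \<and> (\<forall>b\<in>B. cblinfun_apply Q b = b)"
    using assms
  proof (induction B rule: finite_induct)
    case empty
    then show ?case using finite_rank_projection_zero by blast
  next
    case (insert b B)
    then obtain Q where Q: "finite_rank_projection Q" "\<forall>b\<in>B. cblinfun_apply Q b = b" by blast
    obtain Q' where Q': "finite_rank_projection Q'" "local_unit Q' Q" "cblinfun_apply Q' b = b"
      using projection_extend_vector[OF Q(1)] by blast
    have "cblinfun_apply Q' (cblinfun_apply Q x) = cblinfun_apply Q x" for x
      using Q'(2) unfolding local_unit_def by (metis cblinfun_apply_compose)
    then have "cblinfun_apply Q' c = c" if "c \<in> B" for c
      using Q(2) that by metis
    then show ?case using Q' by blast
  qed
  then obtain Q where Q: "finite_rank_projection Q" "\<forall>b\<in>B. cblinfun_apply Q b = b" by blast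
  have "cblinfun_apply Q v = v" if "v \<in> complex_vector.span B" for v
    using that
    by (induction rule: complex_vector.span_induct_alt) (use Q in \<open>auto simp: cblinfun_apply_simps\<close>)
  with Q(1) that show thesis by blast
qed

text \<open>
  Coordinates on a finite-dimensional range are continuous: a projection onto the range is a
  sum of rank-one operators, and composing it with \<open>T\<close> does not change \<open>T\<close>.
\<close>

theorem finite_rank_sum_rank_one:
  assumes "finite_rank T"
  obtains d :: nat and f u where "T = (\<Sum>i<d. rank_one (f i) (u i))"
proof -
  obtain B where B: "finite B" "\<And>x. cblinfun_apply T x \<in> complex_vector.span B"
    using assms by (auto simp: finite_rank_def)
  obtain Q where Q: "finite_rank_projection Q" "\<And>b. b \<in> complex_vector.span B \<Longrightarrow> cblinfun_apply Q b = b"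
    using ex_projection_fixing_span[OF B(1)] by blast
  have "Q o\<^sub>C\<^sub>L T = T"
    by (rule cblinfun_eqI) (simp add: cblinfun_apply_simps Q B)
  moreover obtain d :: nat and f u where "Q = (\<Sum>i<d. rank_one (f i) (u i))"
    using Q(1) by (auto simp: finite_rank_projection_def)
  ultimately have "T = (\<Sum>i<d. rank_one (f i o\<^sub>C\<^sub>L T) (u i))"
    by (simp add: cblinfun_compose_simps rank_one_compose)
  then show thesis by (rule that)
qed

text \<open>
  The projection is enlarged step by step to fix the vectors and the functionals in a
  representation of \<open>T\<close>. Since the enlarged projection is a unit for the previous one, nothing
  that was fixed before is lost. In particular any two finite-rank operators have a common
  projection as a local unit.
\<close>

theorem ex_projection_local_unit:
  assumes Q: "finite_rank_projection Q" and T: "finite_rank T"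
  obtains Q' where "finite_rank_projection Q'" "local_unit Q' Q" "local_unit Q' T"
proof -
  obtain d :: nat and f u where T_eq: "T = (\<Sum>i<d. rank_one (f i) (u i))"
    using finite_rank_sum_rank_one[OF T] by blast
  have "\<exists>Q'. finite_rank_projection Q' \<and> local_unit Q' Q \<and> (\<forall>i<k. local_unit Q' (rank_one (f i) (u i)))" for k
  proof (induction k)
    case 0
    then show ?case using Q by (auto simp: local_unit_def finite_rank_projection_def)
  next
    case (Suc k)
    then obtain Q1 where Q1: "finite_rank_projection Q1" "local_unit Q1 Q" "\<forall>i<k. local_unit Q1 (rank_one (f i) (u i))"
      by blast
    obtain Q2 where Q2: "finite_rank_projection Q2" "local_unit Q2 Q1" "cblinfun_apply Q2 (u k) = u k"
      using projection_extend_vector[OF Q1(1)] by blast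
    obtain Q3 where Q3: "finite_rank_projection Q3" "local_unit Q3 Q2" "f k o\<^sub>C\<^sub>L Q3 = f k"
      using projection_extend_functional[OF Q2(1)] by blast
    have "cblinfun_apply Q3 (u k) = cblinfun_apply (Q3 o\<^sub>C\<^sub>L Q2) (u k)"
      by (simp add: cblinfun_apply_simps Q2)
    also have "\<dots> = u k"
      using Q3(2) Q2(3) by (simp add: local_unit_def)
    finally have "local_unit Q3 (rank_one (f k) (u k))"
      by (simp add: local_unit_def compose_rank_one rank_one_compose Q3)
    moreover have "local_unit Q3 Q1"
      using Q2(2) Q3(2) local_unit_trans by blast
    ultimately show ?case
      using Q1 Q3(1) local_unit_trans less_Suc_eq by metis
  qed
  then obtain Q' where Q': "finite_rank_projection Q'" "local_unit Q' Q" "\<forall>i<d. local_unit Q' (rank_one (f i) (u i))"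
    by blast
  then have "local_unit Q' T"
    by (simp add: T_eq local_unit_def cblinfun_compose_simps)
  with Q' that show thesis by blast
qed

section \<open>Separation and the local reflexivity argument\<close>

theorem complex_finite_power_sandwich:
  fixes I :: "((nat \<Rightarrow> 'w::complex_normed_vector) \<times> real) set"
  assumes c: "c \<ge> 0"
    and zero: "(\<lambda>k. 0, 0) \<in> I"
    and add: "\<And>x r y s. (x, r) \<in> I \<Longrightarrow> (y, s) \<in> I \<Longrightarrow> (\<lambda>k. x k + y k, r + s) \<in> I"
    and scale: "\<And>t x r. t > 0 \<Longrightarrow> (x, r) \<in> I \<Longrightarrow> (\<lambda>k. t *\<^sub>R x k, t * r) \<in> I"
    and le: "\<And>x r M. (x, r) \<in> I \<Longrightarrow> M > 0 \<Longrightarrow> (\<And>k. k < N \<Longrightarrow> norm (x k) \<le> M) \<Longrightarrow> r \<le> c * M"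
  obtains \<phi> :: "nat \<Rightarrow> 'w \<Rightarrow>\<^sub>C\<^sub>L complex"
  where "(\<Sum>k<N. norm (\<phi> k)) \<le> c"
    and "\<And>x r. (x, r) \<in> I \<Longrightarrow> r \<le> Re (\<Sum>k<N. cblinfun_apply (\<phi> k) (x k))"
proof -
  obtain \<psi> :: "nat \<Rightarrow> 'w \<Rightarrow> real" and b where \<psi>: "\<And>k. linear (\<psi> k)" "\<And>k x. \<psi> k x \<le> b k * norm x" "\<And>k. b k \<ge> 0"
    and b: "(\<Sum>k<N. b k) \<le> c" and I: "\<And>x r. (x, r) \<in> I \<Longrightarrow> r \<le> (\<Sum>k<N. \<psi> k (x k))"
    using assms by (rule finite_power_sandwich) blast+
  have "\<exists>f :: 'w \<Rightarrow>\<^sub>C\<^sub>L complex. (\<forall>x. Re (cblinfun_apply f x) = \<psi> k x) \<and> norm f \<le> b k" for k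
    using complexify[OF \<psi>(1,2,3)] by metis
  then obtain \<phi> :: "nat \<Rightarrow> 'w \<Rightarrow>\<^sub>C\<^sub>L complex"
    where \<phi>: "\<And>k x. Re (cblinfun_apply (\<phi> k) x) = \<psi> k x" "\<And>k. norm (\<phi> k) \<le> b k"
    by metis
  show thesis
  proof (rule that)
    show "(\<Sum>k<N. norm (\<phi> k)) \<le> c"
      using sum_mono[of "{..<N}" "\<lambda>k. norm (\<phi> k)" b] \<phi>(2) b by (auto intro: order_trans)
    show "r \<le> Re (\<Sum>k<N. cblinfun_apply (\<phi> k) (x k))" if "(x, r) \<in> I" for x r
      using I[OF that] by (simp add: \<phi>(1))
  qed
qed

text \<open>
  If no element of the convex set \<open>K\<close> is mapped \<open>\<epsilon>\<close>-close to \<open>u\<close>, then the origin has distance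
  at least \<open>\<epsilon>\<close> from the convex set of the differences \<open>u - L e\<close>. The separating functional
  comes from the sandwich theorem for the cone spanned by that set at height \<open>\<epsilon>\<close>.
\<close>

theorem finite_power_separation:
  fixes L :: "'e::real_vector \<Rightarrow> nat \<Rightarrow> 'w::complex_normed_vector" and u :: "nat \<Rightarrow> 'w"
  assumes lin: "\<And>k. linear (\<lambda>e. L e k)" and K: "convex K" "K \<noteq> {}" and \<epsilon>: "\<epsilon> > 0"
    and far: "\<And>e. e \<in> K \<Longrightarrow> \<exists>k<N. norm (u k - L e k) \<ge> \<epsilon>"
  obtains \<phi> :: "nat \<Rightarrow> 'w \<Rightarrow>\<^sub>C\<^sub>L complex"
  where "(\<Sum>k<N. norm (\<phi> k)) \<le> 1"
    and "\<And>e. e \<in> K \<Longrightarrow> \<epsilon> \<le> Re (\<Sum>k<N. cblinfun_apply (\<phi> k) (u k - L e k))"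
proof -
  define I where "I = {(\<lambda>k. t *\<^sub>R (u k - L e k), t * \<epsilon>) | t e. t \<ge> 0 \<and> e \<in> K}"
  have II: "(x, r) \<in> I" if "t \<ge> 0" "e \<in> K" "\<And>k. x k = t *\<^sub>R (u k - L e k)" "r = t * \<epsilon>" for x r t e
    using that unfolding I_def by auto
  have ID: "\<exists>t e. t \<ge> 0 \<and> e \<in> K \<and> x = (\<lambda>k. t *\<^sub>R (u k - L e k)) \<and> r = t * \<epsilon>" if "(x, r) \<in> I" for x r
    using that unfolding I_def by auto
  obtain e0 where e0: "e0 \<in> K" using K(2) by blast
  have zero: "(\<lambda>k. 0, 0) \<in> I"
    using e0 by (intro II[of 0 e0]) auto
  have add: "(\<lambda>k. x k + y k, r + s) \<in> I" if xy: "(x, r) \<in> I" "(y, s) \<in> I" for x r y s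
  proof -
    obtain t e where te: "t \<ge> 0" "e \<in> K" "x = (\<lambda>k. t *\<^sub>R (u k - L e k))" "r = t * \<epsilon>"
      using ID[OF xy(1)] by blast
    obtain t' e' where te': "t' \<ge> 0" "e' \<in> K" "y = (\<lambda>k. t' *\<^sub>R (u k - L e' k))" "s = t' * \<epsilon>"
      using ID[OF xy(2)] by blast
    show ?thesis
    proof (cases "t + t' = 0")
      case True
      then have "t = 0" "t' = 0" using te te' by auto
      then show ?thesis using te te' zero by simp
    next
      case False
      let ?e = "(t / (t + t')) *\<^sub>R e + (t' / (t + t')) *\<^sub>R e'"
      have "?e \<in> K"
        using False te te' by (intro convexD K(1)) (auto simp: add_divide_distrib[symmetric])
      moreover have "(t + t') *\<^sub>R L ?e k = t *\<^sub>R L e k + t' *\<^sub>R L e' k" for k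
        using False by (simp add: linear_add[OF lin] linear_scale[OF lin] scaleR_add_right)
      ultimately show ?thesis
        using te te' by (intro II[of "t + t'" ?e]) (auto simp: scaleR_diff_right algebra_simps)
    qed
  qed
  have scale: "(\<lambda>k. t *\<^sub>R x k, t * r) \<in> I" if "t > 0" and x: "(x, r) \<in> I" for t x r
  proof -
    obtain t' e where "t' \<ge> 0" "e \<in> K" "x = (\<lambda>k. t' *\<^sub>R (u k - L e k))" "r = t' * \<epsilon>"
      using ID[OF x] by blast
    then show ?thesis
      using \<open>t > 0\<close> by (intro II[of "t * t'" e]) auto
  qed
  have le: "r \<le> 1 * M" if x: "(x, r) \<in> I" "M > 0" "\<And>k. k < N \<Longrightarrow> norm (x k) \<le> M" for x r M
  proof -
    obtain t e where te: "t \<ge> 0" "e \<in> K" "x = (\<lambda>k. t *\<^sub>R (u k - L e k))" "r = t * \<epsilon>"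
      using ID[OF x(1)] by blast
    obtain k where k: "k < N" "norm (u k - L e k) \<ge> \<epsilon>"
      using far[OF te(2)] by blast
    have "t * \<epsilon> \<le> t * norm (u k - L e k)"
      using k te by (intro mult_left_mono)
    also have "\<dots> \<le> M"
      using x(3)[OF k(1)] te by simp
    finally show ?thesis using te by simp
  qed
  obtain \<phi> :: "nat \<Rightarrow> 'w \<Rightarrow>\<^sub>C\<^sub>L complex"
    where \<phi>: "(\<Sum>k<N. norm (\<phi> k)) \<le> 1"
      "\<And>x r. (x, r) \<in> I \<Longrightarrow> r \<le> Re (\<Sum>k<N. cblinfun_apply (\<phi> k) (x k))"
    using zero_le_one zero add scale le by (rule complex_finite_power_sandwich) blast+
  show thesis
  proof (rule that[OF \<phi>(1)])
    show "\<epsilon> \<le> Re (\<Sum>k<N. cblinfun_apply (\<phi> k) (u k - L e k))" if "e \<in> K" for e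
      by (rule \<phi>(2), rule II[of 1 e]) (use that in auto)
  qed
qed

lemma functional_eqI:
  fixes f g :: "'a::complex_normed_vector \<Rightarrow>\<^sub>C\<^sub>L complex"
  assumes "\<And>x. Re (cblinfun_apply f x) = Re (cblinfun_apply g x)"
  shows "f = g"
proof (rule cblinfun_eqI)
  fix x
  show "cblinfun_apply f x = cblinfun_apply g x"
    using assms[of x] assms[of "\<i> *\<^sub>C x"]
    by (simp add: cblinfun_apply_scaleC_right scaleC_complex_def complex_eq_iff)
qed

text \<open>
  This is Goldstine's theorem in \<open>X\<^sup>d\<close> with the norm \<open>max\<^sub>k \<parallel>\<Sum>\<^sub>i a\<^sub>k\<^sub>i x\<^sub>i\<parallel>\<close>: the bidual tuple
  \<open>G\<close> has norm at most \<open>C\<close>, the functional \<open>x \<mapsto> Re (\<Sum>\<^sub>i f\<^sub>i x\<^sub>i)\<close> has norm at most \<open>c\<close>, so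
  their pairing is bounded by \<open>C c\<close>. The proof extends the functional to \<open>X\<^sup>N\<close>, where it is a
  tuple \<open>\<phi>\<close> with norms of sum at most \<open>c\<close> and \<open>f\<^sub>i = \<Sum>\<^sub>k a\<^sub>k\<^sub>i \<phi>\<^sub>k\<close>; pairing with \<open>G\<close> can then
  be estimated coordinate by coordinate.
\<close>

theorem helly_bidual:
  fixes G :: "nat \<Rightarrow> ('a::complex_normed_vector \<Rightarrow>\<^sub>C\<^sub>L complex) \<Rightarrow>\<^sub>C\<^sub>L complex"
    and a :: "nat \<Rightarrow> nat \<Rightarrow> complex" and f :: "nat \<Rightarrow> 'a \<Rightarrow>\<^sub>C\<^sub>L complex"
  assumes C: "C \<ge> 0"
    and G: "\<And>k \<phi>. k < N \<Longrightarrow> cmod (\<Sum>i<d. a k i * cblinfun_apply (G i) \<phi>) \<le> C * norm \<phi>"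
    and f: "\<And>x. (\<And>k. k < N \<Longrightarrow> norm (\<Sum>i<d. a k i *\<^sub>C x i) \<le> 1) \<Longrightarrow>
      Re (\<Sum>i<d. cblinfun_apply (f i) (x i)) \<le> c"
  shows "Re (\<Sum>i<d. cblinfun_apply (G i) (f i)) \<le> C * c"
proof -
  let ?L = "\<lambda>x k. \<Sum>i<d. a k i *\<^sub>C x i" and ?r = "\<lambda>x. Re (\<Sum>i<d. cblinfun_apply (f i) (x i))"
  have L_scale: "?L (\<lambda>i. t *\<^sub>R x i) k = t *\<^sub>R ?L x k" for t x k
    by (simp add: scaleR_scaleC complex_vector.scale_sum_right scaleC_scaleC mult.commute)
  have r_scale: "?r (\<lambda>i. t *\<^sub>R x i) = t * ?r x" for t x
    by (simp add: cblinfun_apply_scaleR_right sum_distrib_left)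
  define I where "I = range (\<lambda>x. (?L x, ?r x))"
  have II: "(y, s) \<in> I" if "y = ?L x" "s = ?r x" for x y s
    using that unfolding I_def by blast
  have c: "c \<ge> 0"
    using f[of "\<lambda>_. 0"] by (simp add: cblinfun_apply_zero_right)
  have zero: "(\<lambda>k. 0, 0) \<in> I"
    by (rule II[of _ "\<lambda>_. 0"]) (auto simp: cblinfun_apply_zero_right)
  have add: "(\<lambda>k. x k + y k, r + s) \<in> I" if xy: "(x, r) \<in> I" "(y, s) \<in> I" for x r y s
  proof -
    obtain v w where "x = ?L v" "r = ?r v" "y = ?L w" "s = ?r w"
      using xy unfolding I_def by blast
    then show ?thesis
      by (intro II[of _ "\<lambda>i. v i + w i"]) (auto simp: cblinfun_apply_add_right scaleC_add_right sum.distrib)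
  qed
  have scale: "(\<lambda>k. t *\<^sub>R x k, t * r) \<in> I" if "t > 0" and x: "(x, r) \<in> I" for t x r
  proof -
    obtain v where "x = ?L v" "r = ?r v"
      using x unfolding I_def by blast
    then show ?thesis
      by (intro II[of _ "\<lambda>i. t *\<^sub>R v i"]) (simp_all only: L_scale r_scale)
  qed
  have le: "r \<le> c * M" if x: "(x, r) \<in> I" "M > 0" "\<And>k. k < N \<Longrightarrow> norm (x k) \<le> M" for x r M
  proof -
    obtain v where v: "x = ?L v" "r = ?r v"
      using x(1) unfolding I_def by blast
    have "?r (\<lambda>i. (1 / M) *\<^sub>R v i) \<le> c"
    proof (rule f)
      show "norm (?L (\<lambda>i. (1 / M) *\<^sub>R v i) k) \<le> 1" if "k < N" for k
        unfolding L_scale using x(2) x(3)[OF that] v(1) by simp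
    qed
    then show ?thesis
      using x(2) unfolding r_scale v(2)[symmetric] by (simp add: field_simps)
  qed
  obtain \<phi> :: "nat \<Rightarrow> 'a \<Rightarrow>\<^sub>C\<^sub>L complex"
    where \<phi>: "(\<Sum>k<N. norm (\<phi> k)) \<le> c"
      and I\<phi>: "\<And>x r. (x, r) \<in> I \<Longrightarrow> r \<le> Re (\<Sum>k<N. cblinfun_apply (\<phi> k) (x k))"
    using c zero add scale le by (rule complex_finite_power_sandwich) blast+
  have upper: "?r x \<le> Re (\<Sum>k<N. cblinfun_apply (\<phi> k) (?L x k))" for x
    by (rule I\<phi>, rule II) auto
  have "?r x = Re (\<Sum>k<N. cblinfun_apply (\<phi> k) (?L x k))" for x
  proof (rule antisym)
    have "?r (\<lambda>i. (-1) *\<^sub>R x i) \<le> Re (\<Sum>k<N. cblinfun_apply (\<phi> k) (?L (\<lambda>i. (-1) *\<^sub>R x i) k))"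
      by (rule upper)
    then show "Re (\<Sum>k<N. cblinfun_apply (\<phi> k) (?L x k)) \<le> ?r x"
      unfolding L_scale r_scale by (simp add: cblinfun_apply_minus_right sum_negf)
  qed (rule upper)
  then have r_eq: "?r x = Re (\<Sum>k<N. cblinfun_apply (\<phi> k) (?L x k))" for x .
  have f_eq: "f i = (\<Sum>k<N. a k i *\<^sub>C \<phi> k)" if "i < d" for i
  proof (rule functional_eqI)
    fix z
    have "(\<Sum>j<d. cblinfun_apply (f j) (if j = i then z else 0)) = cblinfun_apply (f i) z"
      using that by (subst sum.remove[of _ i]) (auto simp: cblinfun_apply_zero_right)
    moreover have "?L (\<lambda>j. if j = i then z else 0) k = a k i *\<^sub>C z" for k
      using that by (subst sum.remove[of _ i]) auto
    ultimately show "Re (cblinfun_apply (f i) z) = Re (cblinfun_apply (\<Sum>k<N. a k i *\<^sub>C \<phi> k) z)"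
      using r_eq[of "\<lambda>j. if j = i then z else 0"] by (simp add: cblinfun_apply_simps)
  qed
  have "(\<Sum>i<d. cblinfun_apply (G i) (f i)) =
      (\<Sum>i<d. \<Sum>k<N. a k i * cblinfun_apply (G i) (\<phi> k))"
    by (intro sum.cong) (simp_all add: f_eq cblinfun_apply_simps scaleC_complex_def)
  also have "\<dots> = (\<Sum>k<N. \<Sum>i<d. a k i * cblinfun_apply (G i) (\<phi> k))"
    by (rule sum.swap)
  finally have "Re (\<Sum>i<d. cblinfun_apply (G i) (f i)) \<le>
      cmod (\<Sum>k<N. \<Sum>i<d. a k i * cblinfun_apply (G i) (\<phi> k))"
    by (simp add: complex_Re_le_cmod del: Re_sum)
  also have "\<dots> \<le> (\<Sum>k<N. C * norm (\<phi> k))"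
    by (intro sum_norm_le G) auto
  also have "\<dots> \<le> C * c"
    using \<phi> C by (simp add: sum_distrib_left[symmetric] mult_left_mono)
  finally show ?thesis .
qed

text \<open>
  The values of finitely many functionals on the unit ball form a bounded set in \<open>\<complex>\<^sup>d\<close>, which
  meets only finitely many cells of a grid; one representative is chosen for each of them.
\<close>

lemma ball_net_for_functionals:
  fixes r :: "nat \<Rightarrow> 'a::complex_normed_vector \<Rightarrow>\<^sub>C\<^sub>L complex"
  assumes \<delta>: "\<delta> > 0"
  obtains zs where "\<And>z. z \<in> set zs \<Longrightarrow> norm z \<le> 1"
    and "\<And>z. norm z \<le> 1 \<Longrightarrow>
      \<exists>z'\<in>set zs. \<forall>i<d. cmod (cblinfun_apply (r i) z - cblinfun_apply (r i) z') \<le> \<delta>"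
proof -
  define \<eta> where "\<eta> = \<delta> / 2"
  have \<eta>: "\<eta> > 0" using \<delta> by (simp add: \<eta>_def)
  define cell where "cell z = (\<lambda>i\<in>{..<d}. (\<lfloor>Re (cblinfun_apply (r i) z) / \<eta>\<rfloor>, \<lfloor>Im (cblinfun_apply (r i) z) / \<eta>\<rfloor>))" for z
  let ?K = "\<lambda>i. {- \<lceil>norm (r i) / \<eta>\<rceil> .. \<lceil>norm (r i) / \<eta>\<rceil>}"
  have floor_bound: "\<lfloor>t / \<eta>\<rfloor> \<in> ?K i" if "\<bar>t\<bar> \<le> norm (r i)" for t i
  proof -
    have "\<bar>t / \<eta>\<bar> \<le> norm (r i) / \<eta>"
      using that \<eta> by (simp add: abs_divide divide_right_mono)
    then have "- (norm (r i) / \<eta>) \<le> t / \<eta>" "t / \<eta> \<le> norm (r i) / \<eta>" by linarith+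
    then show ?thesis
      by (simp add: le_floor_iff floor_le_iff; linarith)
  qed
  have "cell ` cball 0 1 \<subseteq> (\<Pi>\<^sub>E i\<in>{..<d}. ?K i \<times> ?K i)"
  proof (rule image_subsetI)
    fix z :: 'a assume "z \<in> cball 0 1"
    then have "cmod (cblinfun_apply (r i) z) \<le> norm (r i)" for i
      using norm_cblinfun_apply[of "r i" z] mult_left_le[of "norm z" "norm (r i)"] by simp
    then have "\<bar>Re (cblinfun_apply (r i) z)\<bar> \<le> norm (r i)" "\<bar>Im (cblinfun_apply (r i) z)\<bar> \<le> norm (r i)" for i
      using abs_Re_le_cmod abs_Im_le_cmod order_trans by metis+
    then show "cell z \<in> (\<Pi>\<^sub>E i\<in>{..<d}. ?K i \<times> ?K i)"
      unfolding cell_def using floor_bound by (simp del: atLeastAtMost_iff)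
  qed
  then have "finite (cell ` cball 0 1)"
    by (rule finite_subset) (auto intro!: finite_PiE)
  then obtain Z where Z: "Z \<subseteq> cball 0 1" "finite Z" "cell ` cball 0 1 = cell ` Z"
    using finite_subset_image[of "cell ` cball 0 1" cell "cball 0 1"] by auto
  obtain zs where zs: "set zs = Z"
    using finite_list[OF Z(2)] by blast
  show thesis
  proof (rule that)
    show "norm z \<le> 1" if "z \<in> set zs" for z
      using that Z zs by auto
    fix z :: 'a assume "norm z \<le> 1"
    then have "cell z \<in> cell ` Z"
      using Z(3) by auto
    then obtain z' where z': "z' \<in> Z" "cell z = cell z'" by auto
    have close: "\<bar>s - t\<bar> \<le> \<eta>" if "\<lfloor>s / \<eta>\<rfloor> = \<lfloor>t / \<eta>\<rfloor>" for s t :: real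
    proof -
      have "\<bar>s / \<eta> - t / \<eta>\<bar> < 1"
        using that by linarith
      then show ?thesis
        using \<eta> by (simp add: diff_divide_distrib[symmetric] field_simps abs_divide)
    qed
    have "cmod (cblinfun_apply (r i) z - cblinfun_apply (r i) z') \<le> \<delta>" if "i < d" for i
    proof -
      have "\<bar>Re (cblinfun_apply (r i) z - cblinfun_apply (r i) z')\<bar> \<le> \<eta>"
        "\<bar>Im (cblinfun_apply (r i) z - cblinfun_apply (r i) z')\<bar> \<le> \<eta>"
        using fun_cong[OF z'(2), of i] that by (auto simp: cell_def intro!: close)
      then show ?thesis
        using cmod_le[of "cblinfun_apply (r i) z - cblinfun_apply (r i) z'"] by (simp add: \<eta>_def)
    qed
    then show "\<exists>z'\<in>set zs. \<forall>i<d. cmod (cblinfun_apply (r i) z - cblinfun_apply (r i) z') \<le> \<delta>"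
      using z' zs by blast
  qed
qed

lemma norm_cblinfun_bound_unit_ball:
  assumes b: "b \<ge> 0" and unit: "\<And>x. norm x \<le> 1 \<Longrightarrow> norm (cblinfun_apply T x) \<le> b"
  shows "norm T \<le> b"
proof (rule norm_cblinfun_bound[OF b])
  fix x
  show "norm (cblinfun_apply T x) \<le> b * norm x"
  proof (cases "x = 0")
    case False
    then have "inverse (norm x) * norm (cblinfun_apply T x) \<le> b"
      using unit[of "inverse (norm x) *\<^sub>R x"] by (simp add: cblinfun_apply_scaleR_right)
    then show ?thesis using False by (simp add: field_simps)
  qed (simp add: cblinfun_apply_zero_right)
qed

text \<open>
  A weak form of the principle of local reflexivity: \<open>F\<close> is a limit of adjoints of finite-rank
  operators of norm at most \<open>C + 1\<close>, expressed by the functionals \<open>g\<close> that would separate it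
  from them. Write \<open>F = \<Sum>\<^sub>i G\<^sub>i \<otimes> r\<^sub>i\<close> with \<open>G\<^sub>i\<close> in the bidual. The operators
  \<open>e = \<Sum>\<^sub>i r\<^sub>i \<otimes> x\<^sub>i\<close> turn the assumption into a bound for a functional on \<open>X\<^sup>d\<close>, the
  conclusion is the same bound at the bidual point \<open>(G\<^sub>i)\<close>, and \<open>helly_bidual\<close> leads from one
  to the other. To that end the norm of \<open>e\<close> is controlled by finitely many vectors: its values
  on a net of the ball, and the vectors \<open>\<eta> x\<^sub>i\<close>, which bound the error made in passing to the
  net. The factor \<open>\<eta>\<close> is small enough for \<open>\<eta> G\<^sub>i\<close> to have norm at most \<open>1\<close>.
\<close>

lemma finite_rank_approx_by_adjoints:
  fixes F :: "('a::complex_normed_vector \<Rightarrow>\<^sub>C\<^sub>L complex) \<Rightarrow>\<^sub>C\<^sub>L ('a \<Rightarrow>\<^sub>C\<^sub>L complex)"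
    and g :: "nat \<Rightarrow> ('a \<Rightarrow>\<^sub>C\<^sub>L complex) \<Rightarrow>\<^sub>C\<^sub>L complex"
  assumes F: "finite_rank F" "norm F \<le> C" and C: "C \<ge> 1"
    and bound: "\<And>e. finite_rank e \<Longrightarrow> norm e \<le> C + 1 \<Longrightarrow>
      Re (\<Sum>j<m. cblinfun_apply (g j) (h j o\<^sub>C\<^sub>L e)) \<le> c"
  shows "Re (\<Sum>j<m. cblinfun_apply (g j) (cblinfun_apply F (h j))) \<le> c"
proof -
  obtain d :: nat and G r where F_eq: "F = (\<Sum>i<d. rank_one (G i) (r i))"
    using finite_rank_sum_rank_one[OF F(1)] by blast
  have F_apply: "cblinfun_apply F \<phi> = (\<Sum>i<d. cblinfun_apply (G i) \<phi> *\<^sub>C r i)" for \<phi>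
    by (simp add: F_eq cblinfun_apply_simps rank_one_apply)
  define f where "f i = (\<Sum>j<m. cblinfun_apply (g j) (r i) *\<^sub>C h j)" for i
  \<comment> \<open>the weight of the vectors \<open>x i\<close> in the norm: small enough for \<open>\<eta> * norm (G i) \<le> 1\<close>\<close>
  define \<eta> where "\<eta> = 1 / (1 + (\<Sum>i<d. norm (G i)))"
  have \<eta>: "\<eta> > 0"
    unfolding \<eta>_def by (intro divide_pos_pos add_pos_nonneg sum_nonneg) auto
  have \<eta>G: "\<eta> * norm (G i) \<le> 1" if "i < d" for i
  proof -
    have "norm (G i) \<le> (\<Sum>i<d. norm (G i))"
      using that by (intro member_le_sum) auto
    then show ?thesis
      using sum_nonneg[of "{..<d}" "\<lambda>i. norm (G i)"] by (simp add: \<eta>_def divide_le_eq)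
  qed
  \<comment> \<open>mesh of the net: \<open>norm (x i) \<le> 1 / \<eta>\<close>, so passing to the net costs at most \<open>d * \<delta> / \<eta> \<le> 1 / C\<close>\<close>
  define \<delta> where "\<delta> = \<eta> / (C * (d + 1))"
  have \<delta>: "\<delta> > 0" "C * (d * (\<delta> / \<eta>)) \<le> 1"
  proof -
    have "C * (d + 1) > 0" using C by simp
    then show "\<delta> > 0" using \<eta> by (simp add: \<delta>_def)
    have "C * (d * (\<delta> / \<eta>)) = real d / (d + 1)"
      using \<eta> C by (simp add: \<delta>_def)
    then show "C * (d * (\<delta> / \<eta>)) \<le> 1" by simp
  qed
  obtain zs where zs: "\<And>z. z \<in> set zs \<Longrightarrow> norm z \<le> 1"
    and net: "\<And>z. norm z \<le> 1 \<Longrightarrow>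
      \<exists>z'\<in>set zs. \<forall>i<d. cmod (cblinfun_apply (r i) z - cblinfun_apply (r i) z') \<le> \<delta>"
    using ball_net_for_functionals[OF \<delta>(1), of d r] by blast
  define l where "l = length zs"
  \<comment> \<open>rows below \<open>l\<close> evaluate \<open>\<Sum>i. r i \<otimes> x i\<close> on the net, the \<open>d\<close> rows after them control each \<open>x i\<close>\<close>
  define a where "a k i = (if k < l then cblinfun_apply (r i) (zs ! k)
    else if k = l + i then complex_of_real \<eta> else 0)" for k i
  have "Re (\<Sum>i<d. cblinfun_apply (G i) (f i)) \<le> C * (c / C)"
  proof (rule helly_bidual[where N = "l + d" and a = a])
    show "cmod (\<Sum>i<d. a k i * cblinfun_apply (G i) \<phi>) \<le> C * norm \<phi>" if "k < l + d" for k \<phi>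
    proof (cases "k < l")
      case True
      have "(\<Sum>i<d. a k i * cblinfun_apply (G i) \<phi>) = cblinfun_apply (cblinfun_apply F \<phi>) (zs ! k)"
        using True by (simp add: a_def F_apply cblinfun_apply_simps scaleC_complex_def mult.commute)
      also have "cmod \<dots> \<le> norm (cblinfun_apply F \<phi>) * norm (zs ! k)"
        by (rule norm_cblinfun_apply)
      also have "\<dots> \<le> norm (cblinfun_apply F \<phi>)"
        using zs[of "zs ! k"] True by (simp add: l_def mult_left_le)
      also have "\<dots> \<le> norm F * norm \<phi>"
        by (rule norm_cblinfun_apply)
      also have "\<dots> \<le> C * norm \<phi>"
        using F(2) by (simp add: mult_right_mono)
      finally show ?thesis .
    next
      case False
      then obtain i where i: "k = l + i" "i < d"
        using \<open>k < l + d\<close> by (metis add_less_cancel_left le_Suc_ex not_less)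
      have "(\<Sum>j<d. a k j * cblinfun_apply (G j) \<phi>) = \<eta> * cblinfun_apply (G i) \<phi>"
        using i by (subst sum.remove[of _ i]) (auto simp: a_def intro!: sum.neutral)
      also have "cmod \<dots> \<le> \<eta> * norm (G i) * norm \<phi>"
        using \<eta> norm_cblinfun_apply[of "G i" \<phi>] by (simp add: norm_mult mult_left_mono)
      also have "\<dots> \<le> C * norm \<phi>"
        using \<eta>G[OF i(2)] C by (intro mult_right_mono) auto
      finally show ?thesis .
    qed
    fix x :: "nat \<Rightarrow> 'a"
    assume x: "\<And>k. k < l + d \<Longrightarrow> norm (\<Sum>i<d. a k i *\<^sub>C x i) \<le> 1"
    have x_net: "norm (\<Sum>i<d. cblinfun_apply (r i) z *\<^sub>C x i) \<le> 1" if z: "z \<in> set zs" for z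
    proof -
      obtain k where "k < l" "z = zs ! k"
        using z by (auto simp: l_def in_set_conv_nth)
      then show ?thesis
        using x[of k] by (simp add: a_def)
    qed
    have x_norm: "norm (x i) \<le> 1 / \<eta>" if "i < d" for i
    proof -
      have "(\<Sum>j<d. a (l + i) j *\<^sub>C x j) = complex_of_real \<eta> *\<^sub>C x i"
        using that by (subst sum.remove[of _ i]) (auto simp: a_def intro!: sum.neutral)
      then show ?thesis
        using x[of "l + i"] that \<eta> by (simp add: norm_scaleC field_simps)
    qed
    define e where "e = complex_of_real C *\<^sub>C (\<Sum>i<d. rank_one (r i) (x i))"
    have "norm (\<Sum>i<d. cblinfun_apply (r i) z *\<^sub>C x i) \<le> 1 + d * (\<delta> / \<eta>)" if z: "norm z \<le> 1" for z
    proof -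
      obtain z' where z': "z' \<in> set zs"
        "\<And>i. i < d \<Longrightarrow> cmod (cblinfun_apply (r i) z - cblinfun_apply (r i) z') \<le> \<delta>"
        using net[OF z] by blast
      have "(\<Sum>i<d. cblinfun_apply (r i) z *\<^sub>C x i) = (\<Sum>i<d. cblinfun_apply (r i) z' *\<^sub>C x i)
          + (\<Sum>i<d. (cblinfun_apply (r i) z - cblinfun_apply (r i) z') *\<^sub>C x i)"
        by (simp add: complex_vector.scale_left_diff_distrib sum_subtractf)
      also have "norm \<dots> \<le> 1 + (\<Sum>i<d. \<delta> * (1 / \<eta>))"
      proof (intro norm_triangle_mono x_net z' sum_norm_le)
        show "norm ((cblinfun_apply (r i) z - cblinfun_apply (r i) z') *\<^sub>C x i) \<le> \<delta> * (1 / \<eta>)"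
          if "i \<in> {..<d}" for i
          unfolding norm_scaleC using that z' x_norm \<delta>(1) by (intro mult_mono) auto
      qed
      finally show ?thesis by simp
    qed
    then have "norm (\<Sum>i<d. rank_one (r i) (x i)) \<le> 1 + d * (\<delta> / \<eta>)"
      using \<delta>(1) \<eta> by (intro norm_cblinfun_bound_unit_ball) (auto simp: cblinfun_apply_simps rank_one_apply)
    then have "norm e \<le> C * (1 + d * (\<delta> / \<eta>))"
      using C by (simp add: e_def norm_scaleC mult_left_mono)
    also have "\<dots> \<le> C + 1"
      using \<delta>(2) by (simp add: distrib_left)
    finally have "Re (\<Sum>j<m. cblinfun_apply (g j) (h j o\<^sub>C\<^sub>L e)) \<le> c"
      by (intro bound) (auto simp: e_def intro!: finite_rank_intros)
    moreover have "(\<Sum>j<m. cblinfun_apply (g j) (h j o\<^sub>C\<^sub>L e)) = C * (\<Sum>i<d. cblinfun_apply (f i) (x i))"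
    proof -
      have "cblinfun_apply (g j) (h j o\<^sub>C\<^sub>L e) =
          C * (\<Sum>i<d. cblinfun_apply (h j) (x i) * cblinfun_apply (g j) (r i))" for j
      proof -
        have "h j o\<^sub>C\<^sub>L rank_one (r i) (x i) = cblinfun_apply (h j) (x i) *\<^sub>C r i" for i
          by (rule cblinfun_eqI)
            (simp add: cblinfun_apply_simps rank_one_apply scaleC_complex_def mult.commute)
        then show ?thesis
          by (simp add: e_def cblinfun_compose_simps cblinfun_apply_simps scaleC_complex_def)
      qed
      moreover have "(\<Sum>i<d. cblinfun_apply (f i) (x i)) =
          (\<Sum>j<m. \<Sum>i<d. cblinfun_apply (h j) (x i) * cblinfun_apply (g j) (r i))"
        by (subst sum.swap) (simp add: f_def cblinfun_apply_simps scaleC_complex_def mult.commute)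
      ultimately show ?thesis
        by (simp add: sum_distrib_left)
    qed
    ultimately show "Re (\<Sum>i<d. cblinfun_apply (f i) (x i)) \<le> c / C"
      using C by (simp add: field_simps del: Re_sum)
  qed (use C in simp)
  moreover have "(\<Sum>j<m. cblinfun_apply (g j) (cblinfun_apply F (h j))) = (\<Sum>i<d. cblinfun_apply (G i) (f i))"
  proof -
    have "(\<Sum>j<m. cblinfun_apply (g j) (cblinfun_apply F (h j))) =
        (\<Sum>j<m. \<Sum>i<d. cblinfun_apply (G i) (h j) * cblinfun_apply (g j) (r i))"
      by (simp add: F_apply cblinfun_apply_simps scaleC_complex_def)
    also have "\<dots> = (\<Sum>i<d. \<Sum>j<m. cblinfun_apply (G i) (h j) * cblinfun_apply (g j) (r i))"
      by (rule sum.swap)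
    also have "\<dots> = (\<Sum>i<d. cblinfun_apply (G i) (f i))"
      by (simp add: f_def cblinfun_apply_simps scaleC_complex_def mult.commute)
    finally show ?thesis .
  qed
  ultimately show ?thesis
    using C by (simp del: Re_sum)
qed

section \<open>Bounded local units\<close>

lemma convex_finite_rank_ball: "convex {e. finite_rank e \<and> norm e \<le> C}"
proof (rule convexI, clarify, intro conjI)
  fix e f :: "'a \<Rightarrow>\<^sub>C\<^sub>L 'b" and s t :: real
  assume e: "finite_rank e" "norm e \<le> C" "finite_rank f" "norm f \<le> C" and st: "s \<ge> 0" "t \<ge> 0" "s + t = 1"
  show "finite_rank (s *\<^sub>R e + t *\<^sub>R f)"
    using e by (simp add: scaleR_scaleC finite_rank_intros)
  have "norm (s *\<^sub>R e + t *\<^sub>R f) \<le> s * C + t * C"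
    using e st by (intro norm_triangle_mono) (auto intro: mult_left_mono)
  then show "norm (s *\<^sub>R e + t *\<^sub>R f) \<le> C"
    using st by (simp add: distrib_right[symmetric])
qed

definition finite_rank_right_approximation :: "real \<Rightarrow> 'a::complex_normed_vector itself \<Rightarrow> bool"
  where "finite_rank_right_approximation C _ \<longleftrightarrow> (\<forall>(h :: nat \<Rightarrow> 'a \<Rightarrow>\<^sub>C\<^sub>L complex) m. \<forall>\<epsilon>>0.
    \<exists>e. finite_rank e \<and> norm e \<le> C \<and> (\<forall>j<m. norm (h j - h j o\<^sub>C\<^sub>L e) \<le> \<epsilon>))"

text \<open>
  Otherwise separate the tuple \<open>h\<close> from all tuples \<open>h \<circ> e\<close> by elements \<open>g\<close> of the bidual. By
  local reflexivity \<open>g\<close> also separates \<open>h\<close> from \<open>F h\<close>, although the approximation property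
  provides an \<open>F\<close> with \<open>F h\<close> arbitrarily close to \<open>h\<close>.
\<close>

theorem right_approximation:
  assumes "bounded_approximation_property TYPE('a::complex_normed_vector \<Rightarrow>\<^sub>C\<^sub>L complex)"
  obtains C where "finite_rank_right_approximation C TYPE('a)"
proof -
  obtain C0 where C0: "\<And>(K :: ('a \<Rightarrow>\<^sub>C\<^sub>L complex) set) \<epsilon>. compact K \<Longrightarrow> \<epsilon> > 0 \<Longrightarrow>
      \<exists>F\<in>finite_rank_ops. norm F \<le> C0 \<and> (\<forall>z\<in>K. norm (cblinfun_apply F z - z) < \<epsilon>)"
    using assms unfolding bounded_approximation_property_def by blast
  define C where "C = max C0 1"
  have "\<exists>e. finite_rank e \<and> norm e \<le> C + 1 \<and> (\<forall>j<m. norm (h j - h j o\<^sub>C\<^sub>L e) \<le> \<epsilon>)"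
    if \<epsilon>: "\<epsilon> > 0" for h :: "nat \<Rightarrow> 'a \<Rightarrow>\<^sub>C\<^sub>L complex" and m \<epsilon>
  proof (rule ccontr)
    assume contra: "\<not> ?thesis"
    let ?K = "{e :: 'a \<Rightarrow>\<^sub>C\<^sub>L 'a. finite_rank e \<and> norm e \<le> C + 1}"
    have "linear (\<lambda>e. h k o\<^sub>C\<^sub>L e)" for k
      by (rule linearI) (simp_all add: cblinfun_compose_simps scaleR_scaleC)
    moreover have "0 \<in> ?K"
      by (simp add: C_def)
    then have "?K \<noteq> {}" by blast
    moreover have "\<exists>k<m. norm (h k - h k o\<^sub>C\<^sub>L e) \<ge> \<epsilon>" if "e \<in> ?K" for e
      using contra that by (force simp: not_le)
    ultimately obtain g where g: "(\<Sum>k<m. norm (g k)) \<le> 1"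
      and sep: "\<And>e. e \<in> ?K \<Longrightarrow> \<epsilon> \<le> Re (\<Sum>k<m. cblinfun_apply (g k) (h k - h k o\<^sub>C\<^sub>L e))"
      using finite_power_separation[of "\<lambda>e k. h k o\<^sub>C\<^sub>L e" ?K \<epsilon> m h, OF _ convex_finite_rank_ball] \<epsilon>
      by blast
    obtain F where F: "F \<in> finite_rank_ops" "norm F \<le> C0"
      "\<And>z. z \<in> h ` {..<m} \<Longrightarrow> norm (cblinfun_apply F z - z) < \<epsilon> / 2"
      using C0[of "h ` {..<m}" "\<epsilon> / 2"] \<epsilon> by (auto simp: finite_imp_compact)
    have "Re (\<Sum>k<m. cblinfun_apply (g k) (cblinfun_apply F (h k))) \<le>
        Re (\<Sum>k<m. cblinfun_apply (g k) (h k)) - \<epsilon>"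
    proof (rule finite_rank_approx_by_adjoints)
      show "Re (\<Sum>k<m. cblinfun_apply (g k) (h k o\<^sub>C\<^sub>L e)) \<le> Re (\<Sum>k<m. cblinfun_apply (g k) (h k)) - \<epsilon>"
        if "finite_rank e" "norm e \<le> C + 1" for e
        using sep[of e] that by (simp add: cblinfun_apply_simps sum_subtractf)
    qed (use F in \<open>auto simp: finite_rank_ops_iff C_def\<close>)
    then have "\<epsilon> \<le> Re (\<Sum>k<m. cblinfun_apply (g k) (h k - cblinfun_apply F (h k)))"
      by (simp add: cblinfun_apply_simps sum_subtractf)
    also have "\<dots> \<le> cmod (\<Sum>k<m. cblinfun_apply (g k) (h k - cblinfun_apply F (h k)))"
      by (rule complex_Re_le_cmod)
    also have "\<dots> \<le> (\<Sum>k<m. norm (g k) * (\<epsilon> / 2))"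
    proof (rule sum_norm_le)
      fix k assume "k \<in> {..<m}"
      then have "norm (h k - cblinfun_apply F (h k)) \<le> \<epsilon> / 2"
        using F(3)[of "h k"] by (simp add: norm_minus_commute)
      then show "cmod (cblinfun_apply (g k) (h k - cblinfun_apply F (h k))) \<le> norm (g k) * (\<epsilon> / 2)"
        using norm_cblinfun_apply[of "g k" "h k - cblinfun_apply F (h k)"]
        by (meson mult_left_mono norm_ge_zero order_trans)
    qed
    also have "\<dots> \<le> \<epsilon> / 2"
      unfolding sum_distrib_right[symmetric] using g \<epsilon> mult_right_mono[OF g, of "\<epsilon> / 2"] by simp
    finally show False using \<epsilon> by simp
  qed
  then have "finite_rank_right_approximation (C + 1) TYPE('a)"
    unfolding finite_rank_right_approximation_def by blast
  then show thesis by (rule that)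
qed

text \<open>
  Right approximation of \<open>\<phi>\<close> says that \<open>\<phi> (e b)\<close> is close to \<open>\<phi> b\<close>. So \<open>b\<close> lies in the weak
  closure of a convex set and hence, by separation, in its norm closure.
\<close>

theorem left_approximation:
  fixes b :: "nat \<Rightarrow> 'a::complex_normed_vector"
  assumes right: "finite_rank_right_approximation C TYPE('a)" and \<epsilon>: "\<epsilon> > 0"
  shows "\<exists>e :: 'a \<Rightarrow>\<^sub>C\<^sub>L 'a. finite_rank e \<and> norm e \<le> C \<and> (\<forall>j<m. norm (b j - cblinfun_apply e (b j)) \<le> \<epsilon>)"
proof (rule ccontr)
  assume contra: "\<not> ?thesis"
  have right': "\<exists>e. finite_rank e \<and> norm e \<le> C \<and> (\<forall>j<m. norm (h j - h j o\<^sub>C\<^sub>L e) \<le> \<delta>)"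
    if "\<delta> > 0" for h :: "nat \<Rightarrow> 'a \<Rightarrow>\<^sub>C\<^sub>L complex" and \<delta>
    using right that unfolding finite_rank_right_approximation_def by blast
  let ?K = "{e :: 'a \<Rightarrow>\<^sub>C\<^sub>L 'a. finite_rank e \<and> norm e \<le> C}"
  have "linear (\<lambda>e. cblinfun_apply e (b k))" for k
    by (rule linearI) (simp_all add: cblinfun_apply_simps cblinfun_apply_scaleR)
  moreover have "?K \<noteq> {}"
    using right'[of 1 "\<lambda>_. 0"] by auto
  moreover have "\<exists>k<m. norm (b k - cblinfun_apply e (b k)) \<ge> \<epsilon>" if "e \<in> ?K" for e
    using contra that by (force simp: not_le)
  ultimately obtain \<phi> where \<phi>: "(\<Sum>k<m. norm (\<phi> k)) \<le> 1"
    and sep: "\<And>e. e \<in> ?K \<Longrightarrow> \<epsilon> \<le> Re (\<Sum>k<m. cblinfun_apply (\<phi> k) (b k - cblinfun_apply e (b k)))"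
    using finite_power_separation[of "\<lambda>e k. cblinfun_apply e (b k)" ?K \<epsilon> m b, OF _ convex_finite_rank_ball] \<epsilon>
    by blast
  let ?B = "\<Sum>k<m. norm (b k)"
  have B: "?B \<ge> 0" by (intro sum_nonneg) auto
  define \<delta> where "\<delta> = (\<epsilon> / 2) / (1 + ?B)"
  have \<delta>: "\<delta> > 0" "\<delta> * ?B < \<epsilon>"
  proof -
    show "\<delta> > 0" using \<epsilon> B by (simp add: \<delta>_def)
    have "1 + ?B \<noteq> 0" using B by linarith
    then have "\<delta> * (1 + ?B) = \<epsilon> / 2"
      using \<delta>_def by (rule nonzero_eq_divide_eq[THEN iffD1])
    then show "\<delta> * ?B < \<epsilon>" using \<open>\<delta> > 0\<close> \<epsilon> by (simp add: distrib_left)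
  qed
  obtain e where e: "finite_rank e" "norm e \<le> C" "\<And>j. j < m \<Longrightarrow> norm (\<phi> j - \<phi> j o\<^sub>C\<^sub>L e) \<le> \<delta>"
    using right'[OF \<delta>(1), of \<phi>] by blast
  have "\<epsilon> \<le> Re (\<Sum>k<m. cblinfun_apply (\<phi> k) (b k - cblinfun_apply e (b k)))"
    by (rule sep) (use e in simp)
  also have "\<dots> = Re (\<Sum>k<m. cblinfun_apply (\<phi> k - \<phi> k o\<^sub>C\<^sub>L e) (b k))"
    by (simp add: cblinfun_apply_simps)
  also have "\<dots> \<le> cmod (\<Sum>k<m. cblinfun_apply (\<phi> k - \<phi> k o\<^sub>C\<^sub>L e) (b k))"
    by (rule complex_Re_le_cmod)
  also have "\<dots> \<le> (\<Sum>k<m. \<delta> * norm (b k))"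
    by (rule sum_norm_le, rule order_trans[OF norm_cblinfun_apply]) (auto intro: mult_right_mono e(3))
  also have "\<dots> < \<epsilon>"
    using \<delta>(2) by (simp add: sum_distrib_left)
  finally show False by simp
qed

text \<open>
  Let \<open>v = (1 - e\<^sub>R)(1 - e\<^sub>L)\<close> with \<open>E (1 - e\<^sub>R)\<close> and \<open>(1 - e\<^sub>L) E\<close> small. Then \<open>E v\<close> and
  \<open>v E\<close> are small, while the norm of \<open>v\<close> is at most \<open>(1 + C)\<^sup>2\<close>. Compressing \<open>v\<close> to the
  complement of \<open>E\<close>, \<open>w = 1 - (1 - E) v (1 - E)\<close> satisfies \<open>w E = E w = E\<close> exactly and differs
  little from the finite-rank operator \<open>1 - v\<close>. The bound does not involve \<open>E\<close>, because \<open>e\<^sub>R\<close>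
  and \<open>e\<^sub>L\<close> are chosen after \<open>E\<close>.
\<close>

theorem bounded_local_units:
  assumes right: "finite_rank_right_approximation C TYPE('a::complex_normed_vector)" and E: "finite_rank_projection (E :: 'a \<Rightarrow>\<^sub>C\<^sub>L 'a)"
  shows "\<exists>w. finite_rank w \<and> norm w \<le> (1 + C)\<^sup>2 + 4 \<and> local_unit w E"
proof -
  have right': "\<exists>e. finite_rank e \<and> norm e \<le> C \<and> (\<forall>j<m. norm (h j - h j o\<^sub>C\<^sub>L e) \<le> \<delta>)"
    if "\<delta> > 0" for h :: "nat \<Rightarrow> 'a \<Rightarrow>\<^sub>C\<^sub>L complex" and \<delta> m
    using right that unfolding finite_rank_right_approximation_def by blast
  obtain e :: "'a \<Rightarrow>\<^sub>C\<^sub>L 'a" where "norm e \<le> C"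
    using right'[of 1 0] by auto
  then have C: "C \<ge> 0"
    by (rule order_trans[OF norm_ge_zero])
  have EE: "E o\<^sub>C\<^sub>L E = E"
    using E by (simp add: finite_rank_projection_def)
  obtain d :: nat and f u where E_eq: "E = (\<Sum>i<d. rank_one (f i) (u i))"
    using E by (auto simp: finite_rank_projection_def)
  let ?f = "\<Sum>i<d. norm (f i)" and ?u = "\<Sum>i<d. norm (u i)"
  have fu: "?f \<ge> 0" "?u \<ge> 0" by (auto intro: sum_nonneg)
  define k where "k = (1 + C) * (1 + norm E)"
  have k: "k > 0"
    unfolding k_def using C by (intro mult_pos_pos) (auto simp: add_pos_nonneg)
  \<comment> \<open>makes the norms of \<open>E v\<close>, \<open>v E\<close> and \<open>E v E\<close> at most \<open>1\<close>\<close>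
  define \<delta> where "\<delta> = 1 / (k * (1 + (?f + ?u)))"
  have \<delta>: "\<delta> > 0"
    unfolding \<delta>_def using k fu by (intro divide_pos_pos mult_pos_pos) auto
  have "\<delta> * (?f + ?u) * k \<le> 1"
  proof -
    have "\<delta> * (?f + ?u) * k = (?f + ?u) / (1 + (?f + ?u))"
      using k by (simp add: \<delta>_def)
    also have "\<dots> \<le> 1" using fu by simp
    finally show ?thesis .
  qed
  then have \<delta>_le: "\<delta> * (?f + ?u) * (1 + C) * (1 + norm E) \<le> 1"
    by (simp add: k_def mult.assoc)
  obtain eR where eR: "finite_rank eR" "norm eR \<le> C" "\<And>i. i < d \<Longrightarrow> norm (f i - f i o\<^sub>C\<^sub>L eR) \<le> \<delta>"
    using right'[OF \<delta>, of d f] by blast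
  obtain eL :: "'a \<Rightarrow>\<^sub>C\<^sub>L 'a" where eL: "finite_rank eL" "norm eL \<le> C"
    "\<And>i. i < d \<Longrightarrow> norm (u i - cblinfun_apply eL (u i)) \<le> \<delta>"
    using left_approximation[OF right \<delta>, of d u] by blast
  let ?I = "id_cblinfun :: 'a \<Rightarrow>\<^sub>C\<^sub>L 'a"
  have nR: "norm (?I - eR) \<le> 1 + C" and nL: "norm (?I - eL) \<le> 1 + C"
    using norm_triangle_ineq4[of ?I eR] norm_triangle_ineq4[of ?I eL] norm_id_cblinfun eR(2) eL(2)
    by (smt (verit))+
  have ER: "norm (E o\<^sub>C\<^sub>L (?I - eR)) \<le> \<delta> * (?f + ?u)"
  proof -
    have "E o\<^sub>C\<^sub>L (?I - eR) = (\<Sum>i<d. rank_one (f i - f i o\<^sub>C\<^sub>L eR) (u i))"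
      by (rule cblinfun_eqI) (simp add: E_eq cblinfun_apply_simps rank_one_apply
          complex_vector.scale_left_diff_distrib sum_subtractf)
    also have "norm \<dots> \<le> (\<Sum>i<d. \<delta> * norm (u i))"
      by (intro sum_norm_le order_trans[OF norm_rank_one] mult_right_mono eR(3)) auto
    also have "\<dots> = \<delta> * ?u" by (simp add: sum_distrib_left)
    also have "\<dots> \<le> \<delta> * (?f + ?u)"
      using fu \<delta> by (intro mult_left_mono) auto
    finally show ?thesis .
  qed
  have LE: "norm ((?I - eL) o\<^sub>C\<^sub>L E) \<le> \<delta> * (?f + ?u)"
  proof -
    have "(?I - eL) o\<^sub>C\<^sub>L E = (\<Sum>i<d. rank_one (f i) (u i - cblinfun_apply eL (u i)))"
      by (simp add: E_eq cblinfun_compose_sum_right compose_rank_one cblinfun_apply_simps)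
    also have "norm \<dots> \<le> (\<Sum>i<d. norm (f i) * \<delta>)"
      by (intro sum_norm_le order_trans[OF norm_rank_one] mult_left_mono eL(3)) auto
    also have "\<dots> = \<delta> * ?f" by (simp add: sum_distrib_left mult.commute)
    also have "\<dots> \<le> \<delta> * (?f + ?u)"
      using fu \<delta> by (intro mult_left_mono) auto
    finally show ?thesis .
  qed
  define v where "v = (?I - eR) o\<^sub>C\<^sub>L (?I - eL)"
  have v: "norm v \<le> (1 + C)\<^sup>2"
    unfolding v_def power2_eq_square
    by (rule order_trans[OF norm_cblinfun_compose]) (use nR nL C in \<open>auto intro: mult_mono\<close>)
  have Ev0: "norm (E o\<^sub>C\<^sub>L v) \<le> \<delta> * (?f + ?u) * (1 + C)"
  proof -
    have "E o\<^sub>C\<^sub>L v = (E o\<^sub>C\<^sub>L (?I - eR)) o\<^sub>C\<^sub>L (?I - eL)"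
      unfolding v_def by (simp only: cblinfun_compose_assoc)
    then show ?thesis
      using norm_cblinfun_compose[of "E o\<^sub>C\<^sub>L (?I - eR)" "?I - eL"] mult_mono[OF ER nL] C \<delta> fu by simp
  qed
  have vE0: "norm (v o\<^sub>C\<^sub>L E) \<le> \<delta> * (?f + ?u) * (1 + C)"
  proof -
    have "v o\<^sub>C\<^sub>L E = (?I - eR) o\<^sub>C\<^sub>L ((?I - eL) o\<^sub>C\<^sub>L E)"
      unfolding v_def by (simp only: cblinfun_compose_assoc)
    then show ?thesis
      using norm_cblinfun_compose[of "?I - eR" "(?I - eL) o\<^sub>C\<^sub>L E"] mult_mono[OF nR LE] C \<delta> fu
      by (simp add: mult.commute)
  qed
  let ?s = "\<delta> * (?f + ?u) * (1 + C)"
  have s: "?s \<ge> 0" "?s + norm E * ?s \<le> 1"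
    using \<delta>_le C \<delta> fu by (auto simp: algebra_simps)
  have EvE: "norm (E o\<^sub>C\<^sub>L (v o\<^sub>C\<^sub>L E)) \<le> norm E * ?s"
    by (rule order_trans[OF norm_cblinfun_compose]) (intro mult_left_mono vE0 norm_ge_zero)
  define w where "w = ?I - (?I - E) o\<^sub>C\<^sub>L v o\<^sub>C\<^sub>L (?I - E)"
  have w_eq: "w = ?I - v + E o\<^sub>C\<^sub>L v + v o\<^sub>C\<^sub>L E - E o\<^sub>C\<^sub>L (v o\<^sub>C\<^sub>L E)"
    by (simp add: w_def cblinfun_compose_simps)
  have "norm w \<le> norm ?I + norm v + norm (E o\<^sub>C\<^sub>L v) + norm (v o\<^sub>C\<^sub>L E) + norm (E o\<^sub>C\<^sub>L (v o\<^sub>C\<^sub>L E))"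
    unfolding w_eq by (intro norm_triangle_le norm_triangle_le_diff add_right_mono order_refl)
  also have "\<dots> \<le> 1 + (1 + C)\<^sup>2 + ?s + ?s + norm E * ?s"
    by (intro add_mono norm_id_cblinfun v Ev0 vE0 EvE)
  also have "\<dots> \<le> (1 + C)\<^sup>2 + 4"
  proof -
    have "norm E * ?s \<ge> 0" using s by simp
    then show ?thesis using s by linarith
  qed
  finally have "norm w \<le> (1 + C)\<^sup>2 + 4" .
  moreover have "finite_rank w"
  proof -
    have "?I - v = eR + eL - eR o\<^sub>C\<^sub>L eL"
      by (simp add: v_def cblinfun_compose_simps)
    then have "finite_rank (?I - v)"
      using eR(1) eL(1) by (simp add: finite_rank_diff finite_rank_add finite_rank_compose_left)
    moreover have "finite_rank (E o\<^sub>C\<^sub>L v)" "finite_rank (v o\<^sub>C\<^sub>L E)" "finite_rank (E o\<^sub>C\<^sub>L (v o\<^sub>C\<^sub>L E))"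
      using finite_rank_projection_finite_rank[OF E] by (simp_all add: finite_rank_compose_left finite_rank_compose_right)
    ultimately show ?thesis
      unfolding w_eq by (intro finite_rank_diff[of "_ + _"] finite_rank_add)
  qed
  moreover have "local_unit w E"
  proof -
    have "E o\<^sub>C\<^sub>L (E o\<^sub>C\<^sub>L S) = E o\<^sub>C\<^sub>L S" for S :: "'a \<Rightarrow>\<^sub>C\<^sub>L 'a"
      by (metis EE cblinfun_compose_assoc)
    then show ?thesis
      by (simp add: local_unit_def w_eq cblinfun_compose_simps EE)
  qed
  ultimately show ?thesis by blast
qed

section \<open>Density of the diagonalizable operators\<close>

lemma finite_span_relation:
  fixes x :: "nat \<Rightarrow> 'a::complex_normed_vector"
  assumes B: "finite B" and x: "\<And>i. x i \<in> complex_vector.span B"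
  obtains c where "\<exists>i\<le>card B. c i \<noteq> 0" and "(\<Sum>i\<le>card B. c i *\<^sub>C x i) = 0"
proof (cases "inj_on x {..card B}")
  case True
  let ?S = "x ` {..card B}"
  have "card ?S = Suc (card B)"
    using card_image[OF True] by simp
  then have "complex_vector.dependent ?S"
    using complex_vector.independent_span_bound[OF B, of ?S] x by auto
  then obtain u where u: "\<exists>v\<in>?S. u v \<noteq> 0" "(\<Sum>v\<in>?S. u v *\<^sub>C v) = 0"
    by (auto simp: complex_vector.dependent_finite)
  then show thesis
    by (intro that[of "\<lambda>i. u (x i)"]) (auto simp: sum.reindex[OF True])
next
  case False
  then obtain i j where ij: "i \<le> card B" "j \<le> card B" "i \<noteq> j" "x i = x j"
    by (auto simp: inj_on_def)
  let ?c = "\<lambda>k. if k = i then 1 else if k = j then - 1 else 0 :: complex"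
  have "(\<Sum>k\<le>card B. ?c k *\<^sub>C x k) = x i + (\<Sum>k\<in>{..card B} - {i}. ?c k *\<^sub>C x k)"
    using ij by (subst sum.remove[of _ i]) (auto simp: scaleC_one)
  also have "(\<Sum>k\<in>{..card B} - {i}. ?c k *\<^sub>C x k) = - x j"
    using ij by (subst sum.remove[of _ j]) (auto simp: scaleC_minus1 intro!: sum.neutral)
  finally show thesis
    using ij by (intro that[of ?c]) auto
qed

definition poly_apply :: "('a::complex_normed_vector \<Rightarrow>\<^sub>C\<^sub>L 'a) \<Rightarrow> 'a \<Rightarrow> complex poly \<Rightarrow> 'a"
  where "poly_apply T v p = (\<Sum>i\<le>degree p. coeff p i *\<^sub>C cblinfun_apply (cblinfun_power T i) v)"

lemma poly_apply_eq:
  assumes "degree p \<le> n"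
  shows "poly_apply T v p = (\<Sum>i\<le>n. coeff p i *\<^sub>C cblinfun_apply (cblinfun_power T i) v)"
  unfolding poly_apply_def
  by (rule sum.mono_neutral_left) (use assms in \<open>auto simp: coeff_eq_0\<close>)

lemma poly_apply_linear_factor:
  "poly_apply T v ([:- c, 1:] * q) = cblinfun_apply T (poly_apply T v q) - c *\<^sub>C poly_apply T v q"
proof -
  let ?n = "degree q" and ?T = "\<lambda>i. cblinfun_apply (cblinfun_power T i) v"
  have "degree ([:- c, 1:] * q) \<le> Suc ?n"
    using degree_mult_le[of "[:- c, 1:]" q] by simp
  then have "poly_apply T v ([:- c, 1:] * q) =
      (\<Sum>i\<le>Suc ?n. coeff (pCons 0 q) i *\<^sub>C ?T i) - (\<Sum>i\<le>Suc ?n. (c * coeff q i) *\<^sub>C ?T i)"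
    by (simp add: poly_apply_eq complex_vector.scale_left_diff_distrib sum_subtractf[symmetric]
        scaleC_add_left[symmetric] del: sum.atMost_Suc)
  also have "(\<Sum>i\<le>Suc ?n. coeff (pCons 0 q) i *\<^sub>C ?T i) = cblinfun_apply T (poly_apply T v q)"
    by (subst sum.atMost_Suc_shift)
      (simp add: poly_apply_def cblinfun_apply_simps)
  also have "(\<Sum>i\<le>Suc ?n. (c * coeff q i) *\<^sub>C ?T i) = c *\<^sub>C poly_apply T v q"
    by (simp add: poly_apply_eq[of q "Suc ?n"] complex_vector.scale_sum_right scaleC_scaleC
        del: sum.atMost_Suc)
  finally show ?thesis .
qed

text \<open>
  Split off linear factors of the annihilating polynomial until the remaining factor no longer
  annihilates \<open>v\<close>.
\<close>

lemma eigenvector_of_annihilator: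
  assumes "p \<noteq> 0" "poly_apply T v p = 0" "v \<noteq> 0"
  shows "\<exists>q \<mu>. poly_apply T v q \<noteq> 0 \<and> cblinfun_apply T (poly_apply T v q) = \<mu> *\<^sub>C poly_apply T v q"
  using assms(1,2)
proof (induction "degree p" arbitrary: p rule: less_induct)
  case less
  have "degree p \<noteq> 0"
  proof
    assume "degree p = 0"
    then obtain a where "p = [:a:]" by (rule degree_eq_zeroE)
    then show False
      using less.prems assms(3) by (simp add: poly_apply_def cblinfun_apply_id)
  qed
  then obtain \<mu> where "poly p \<mu> = 0"
    using fundamental_theorem_of_algebra[of p] by (auto simp: constant_degree)
  then obtain q where q: "p = [:- \<mu>, 1:] * q"
    by (metis dvd_def poly_eq_0_iff_dvd)
  show ?case
  proof (cases "poly_apply T v q = 0")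
    case True
    have "q \<noteq> 0" using less.prems q by auto
    moreover have "degree p = Suc (degree q)"
      using \<open>q \<noteq> 0\<close> unfolding q by (subst degree_mult_eq) auto
    ultimately show ?thesis
      using less.hyps[of q] True by simp
  next
    case False
    then show ?thesis
      using less.prems(2) unfolding q poly_apply_linear_factor by auto
  qed
qed

theorem ex_eigenvector:
  fixes E T :: "'a::complex_normed_vector \<Rightarrow>\<^sub>C\<^sub>L 'a"
  assumes B: "finite B" "\<And>x. cblinfun_apply E x \<in> complex_vector.span B"
    and ET: "local_unit E T" and E: "E \<noteq> 0" "E o\<^sub>C\<^sub>L E = E"
  obtains v \<mu> where "v \<noteq> 0" "cblinfun_apply E v = v" "cblinfun_apply T v = \<mu> *\<^sub>C v"
proof -
  obtain x where x: "cblinfun_apply E x \<noteq> 0"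
    using E(1) by (metis cblinfun_apply_zero cblinfun_eqI)
  define v where "v = cblinfun_apply E x"
  have E_pow: "cblinfun_apply E (cblinfun_apply (cblinfun_power T i) v) = cblinfun_apply (cblinfun_power T i) v" for i
  proof (cases i)
    case 0
    then show ?thesis
      using arg_cong[OF E(2), of "\<lambda>T. cblinfun_apply T x"] by (simp add: v_def cblinfun_apply_simps)
  next
    case (Suc j)
    have "E o\<^sub>C\<^sub>L (T o\<^sub>C\<^sub>L S) = T o\<^sub>C\<^sub>L S" for S :: "'a \<Rightarrow>\<^sub>C\<^sub>L 'a"
      using ET unfolding local_unit_def by (metis cblinfun_compose_assoc)
    then show ?thesis
      using Suc by (simp flip: cblinfun_apply_compose)
  qed
  have "cblinfun_apply (cblinfun_power T i) v \<in> complex_vector.span B" for i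
    using B(2) E_pow by metis
  then obtain c where c: "\<exists>i\<le>card B. c i \<noteq> 0"
    "(\<Sum>i\<le>card B. c i *\<^sub>C cblinfun_apply (cblinfun_power T i) v) = 0"
    using finite_span_relation[OF B(1), of "\<lambda>i. cblinfun_apply (cblinfun_power T i) v"] by blast
  define p where "p = (\<Sum>i\<le>card B. monom (c i) i)"
  have coeff: "coeff p i = (if i \<le> card B then c i else 0)" for i
    by (simp add: p_def coeff_sum)
  have "degree p \<le> card B"
    by (rule degree_le) (simp add: coeff)
  then have "poly_apply T v p = 0"
    using c(2) by (simp add: poly_apply_eq coeff)
  moreover have "p \<noteq> 0"
    using c(1) coeff by (metis coeff_0)
  ultimately obtain q \<mu> where "poly_apply T v q \<noteq> 0"
    "cblinfun_apply T (poly_apply T v q) = \<mu> *\<^sub>C poly_apply T v q"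
    using eigenvector_of_annihilator[of p T v] x by (auto simp: v_def)
  moreover have "cblinfun_apply E (poly_apply T v q) = poly_apply T v q"
    by (simp add: poly_apply_def cblinfun_apply_simps E_pow)
  ultimately show thesis
    using that by blast
qed

text \<open>
  Diagonalizable in the algebra of all operators with local unit \<open>E\<close>, whose unit is \<open>E\<close>. The
  \<open>lam i\<close> need not be distinct.
\<close>

definition diagonalizable :: "('a::complex_normed_vector \<Rightarrow>\<^sub>C\<^sub>L 'a) \<Rightarrow> ('a \<Rightarrow>\<^sub>C\<^sub>L 'a) \<Rightarrow> bool"
  where "diagonalizable E T \<longleftrightarrow> (\<exists>(k::nat) lam e.
    (\<forall>i<k. \<forall>j<k. e i o\<^sub>C\<^sub>L e j = (if i = j then e i else 0)) \<and>
    (\<Sum>i<k. e i) = E \<and> T = (\<Sum>i<k. lam i *\<^sub>C e i))"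

text \<open>
  The operator is block triangular, with diagonal blocks \<open>\<mu> e\<close> and \<open>\<Sum>\<^sub>i lam\<^sub>i f\<^sub>i\<close> and with
  the corner \<open>N = e N E'\<close>. As \<open>\<mu>\<close> is not an eigenvalue of the second block, the corner is
  removed by the correction \<open>c\<^sub>i = (lam\<^sub>i - \<mu>)\<^sup>-\<^sup>1 N f\<^sub>i\<close> of the idempotents: the new ones are
  \<open>f\<^sub>i + c\<^sub>i\<close> and \<open>e - \<Sum>\<^sub>i c\<^sub>i\<close>.
\<close>

lemma diagonalizable_block:
  fixes f :: "nat \<Rightarrow> 'a::complex_normed_vector \<Rightarrow>\<^sub>C\<^sub>L 'a"
  assumes orth: "\<And>i j. i < k \<Longrightarrow> j < k \<Longrightarrow> f i o\<^sub>C\<^sub>L f j = (if i = j then f i else 0)"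
    and sum: "(\<Sum>i<k. f i) = E'" and e: "e o\<^sub>C\<^sub>L e = e" "e o\<^sub>C\<^sub>L E' = 0" "E' o\<^sub>C\<^sub>L e = 0"
    and N: "e o\<^sub>C\<^sub>L N = N" "N o\<^sub>C\<^sub>L E' = N" and \<mu>: "\<And>i. i < k \<Longrightarrow> lam i \<noteq> \<mu>"
  shows "diagonalizable (e + E') (\<mu> *\<^sub>C e + N + (\<Sum>i<k. lam i *\<^sub>C f i))"
proof -
  have fE: "f i o\<^sub>C\<^sub>L E' = f i" "E' o\<^sub>C\<^sub>L f i = f i" if "i < k" for i
    using that orth by (simp_all add: sum[symmetric] cblinfun_compose_simps sum.delta cong: if_cong)
  have fe: "f i o\<^sub>C\<^sub>L e = 0" "e o\<^sub>C\<^sub>L f i = 0" if "i < k" for i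
    using fE[OF that] e by (metis cblinfun_compose_assoc cblinfun_compose_zero_left cblinfun_compose_zero_right)+
  have Ne: "N o\<^sub>C\<^sub>L e = 0" and EN: "E' o\<^sub>C\<^sub>L N = 0"
    using N e by (metis cblinfun_compose_assoc cblinfun_compose_zero_left cblinfun_compose_zero_right)+
  have fN: "f i o\<^sub>C\<^sub>L N = 0" if "i < k" for i
    using fE[OF that] EN by (metis cblinfun_compose_assoc cblinfun_compose_zero_right)
  define c where "c i = (1 / (lam i - \<mu>)) *\<^sub>C (N o\<^sub>C\<^sub>L f i)" for i
  have ec: "e o\<^sub>C\<^sub>L c i = c i" for i
    using N by (simp add: c_def cblinfun_compose_scaleC_right flip: cblinfun_compose_assoc)
  have ce: "c i o\<^sub>C\<^sub>L e = 0" if "i < k" for i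
    using fe[OF that] by (simp add: c_def cblinfun_compose_simps)
  have cf: "c i o\<^sub>C\<^sub>L f j = (if i = j then c i else 0)" if "i < k" "j < k" for i j
    using orth[OF that] by (simp add: c_def cblinfun_compose_simps)
  have fc: "f j o\<^sub>C\<^sub>L c i = 0" if "i < k" "j < k" for i j
    using fN[OF that(2)] by (simp add: c_def cblinfun_compose_scaleC_right cblinfun_compose_zero_left
        flip: cblinfun_compose_assoc)
  have cc: "c i o\<^sub>C\<^sub>L c j = 0" if "i < k" "j < k" for i j
    using ce[OF that(1)] ec[of j] by (metis cblinfun_compose_assoc cblinfun_compose_zero_left)
  define e' where "e' = e - (\<Sum>i<k. c i)"
  have e'f: "e' o\<^sub>C\<^sub>L (f j + c j) = 0" if "j < k" for j
  proof -
    have "(\<Sum>i<k. c i o\<^sub>C\<^sub>L f j) = c j"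
      using that cf by (simp add: sum.delta cong: if_cong)
    then show ?thesis
      using that fe ec cc by (simp add: e'_def cblinfun_compose_simps)
  qed
  have fe': "(f j + c j) o\<^sub>C\<^sub>L e' = 0" if "j < k" for j
    using that fe ce fc cc by (simp add: e'_def cblinfun_compose_simps)
  have e'e': "e' o\<^sub>C\<^sub>L e' = e'"
    using ec ce cc e by (simp add: e'_def cblinfun_compose_simps)
  have ff: "(f i + c i) o\<^sub>C\<^sub>L (f j + c j) = (if i = j then f i + c i else 0)" if "i < k" "j < k" for i j
    using that orth cf fc cc by (simp add: cblinfun_compose_simps)
  let ?e = "\<lambda>i. if i < k then f i + c i else e'" and ?lam = "\<lambda>i. if i < k then lam i else \<mu>"
  have "?e i o\<^sub>C\<^sub>L ?e j = (if i = j then ?e i else 0)" if "i < Suc k" "j < Suc k" for i j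
    using that e'f fe' e'e' ff by (auto simp: less_Suc_eq)
  moreover have "(\<Sum>i<Suc k. ?e i) = e + E'"
    by (simp add: e'_def sum.distrib sum[symmetric])
  moreover have "(\<Sum>i<Suc k. ?lam i *\<^sub>C ?e i) = \<mu> *\<^sub>C e + N + (\<Sum>i<k. lam i *\<^sub>C f i)"
  proof -
    have "(lam i - \<mu>) *\<^sub>C c i = N o\<^sub>C\<^sub>L f i" if "i < k" for i
      using \<mu>[OF that] by (simp add: c_def scaleC_scaleC scaleC_one)
    then have "(\<Sum>i<k. (lam i - \<mu>) *\<^sub>C c i) = N o\<^sub>C\<^sub>L E'"
      by (simp add: sum[symmetric] cblinfun_compose_sum_right)
    then have "N = (\<Sum>i<k. lam i *\<^sub>C c i) - \<mu> *\<^sub>C (\<Sum>i<k. c i)"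
      by (simp add: N complex_vector.scale_left_diff_distrib sum_subtractf complex_vector.scale_sum_right)
    then show ?thesis
      by (simp add: e'_def scaleC_add_right sum.distrib complex_vector.scale_right_diff_distrib)
  qed
  ultimately show ?thesis
    unfolding diagonalizable_def by (intro exI[of _ "Suc k"] exI[of _ ?lam] exI[of _ ?e]) auto
qed

text \<open>
  This is the decrease of the rank in the induction below, expressed by the size of a spanning
  set. The relation \<open>S v = 0\<close> makes the image of one spanning vector redundant.
\<close>

lemma range_in_smaller_span:
  assumes B: "finite B" and E: "\<And>x. cblinfun_apply E x \<in> complex_vector.span B"
    and SE: "S o\<^sub>C\<^sub>L E = S" and v: "v \<noteq> 0" "cblinfun_apply E v = v" "cblinfun_apply S v = 0"
  obtains B' where "finite B'" "card B' < card B" "\<And>x. cblinfun_apply S x \<in> complex_vector.span B'"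
proof -
  have "v \<in> complex_vector.span B"
    using E[of v] v(2) by simp
  then obtain u where u: "v = (\<Sum>b\<in>B. u b *\<^sub>C b)"
    using complex_vector.span_finite[OF B] by auto
  then obtain b where b: "b \<in> B" "u b \<noteq> 0"
    using v(1) by (metis (no_types, lifting) complex_vector.scale_zero_left sum.neutral)
  let ?B = "cblinfun_apply S ` (B - {b})"
  have Sb: "cblinfun_apply S b \<in> complex_vector.span ?B"
  proof -
    have "0 = (\<Sum>b\<in>B. u b *\<^sub>C cblinfun_apply S b)"
      using v(3) by (simp add: u cblinfun_apply_simps)
    also have "\<dots> = u b *\<^sub>C cblinfun_apply S b + (\<Sum>b\<in>B - {b}. u b *\<^sub>C cblinfun_apply S b)"
      using B b by (intro sum.remove)
    finally have relation: "u b *\<^sub>C cblinfun_apply S b = - (\<Sum>b\<in>B - {b}. u b *\<^sub>C cblinfun_apply S b)"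
      by (simp add: eq_neg_iff_add_eq_0)
    have "cblinfun_apply S b = inverse (u b) *\<^sub>C u b *\<^sub>C cblinfun_apply S b"
      using b by (simp add: scaleC_scaleC scaleC_one)
    also have "\<dots> \<in> complex_vector.span ?B"
      unfolding relation
      by (intro complex_vector.span_scale complex_vector.span_neg complex_vector.span_sum
          complex_vector.span_base) auto
    finally show ?thesis .
  qed
  have "cblinfun_apply S y \<in> complex_vector.span ?B" if "y \<in> complex_vector.span B" for y
    using that
  proof (induction rule: complex_vector.span_induct_alt)
    case base
    then show ?case by (simp add: cblinfun_apply_zero_right complex_vector.span_zero)
  next
    case (step c x y)
    then have "cblinfun_apply S x \<in> complex_vector.span ?B"
      using Sb by (cases "x = b") (auto intro: complex_vector.span_base)
    then show ?case
      using step by (simp add: cblinfun_apply_simps complex_vector.span_add complex_vector.span_scale)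
  qed
  then have "cblinfun_apply S x \<in> complex_vector.span ?B" for x
    using E[of x] SE by (metis cblinfun_apply_compose)
  moreover have "card ?B < card B"
    using B b card_image_le[of "B - {b}" "cblinfun_apply S"] card_Diff1_less[OF B b(1)] by simp
  ultimately show thesis
    using B by (intro that[of ?B]) auto
qed

text \<open>
  By induction on the rank of \<open>E\<close>. An eigenvector of \<open>T\<close> splits \<open>E\<close> into a rank-one idempotent
  \<open>e\<close> and \<open>E' = E - e\<close>, with respect to which \<open>T\<close> is block triangular. The block \<open>E' T E'\<close> is
  perturbed by the induction hypothesis, the eigenvalue so as to differ from those of the
  perturbed block.
\<close>

theorem diagonalizable_dense:
  fixes E T :: "'a::complex_normed_vector \<Rightarrow>\<^sub>C\<^sub>L 'a"
  assumes "finite B" "\<And>x. cblinfun_apply E x \<in> complex_vector.span B"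
    and "E o\<^sub>C\<^sub>L E = E" and "local_unit E T" and "\<delta> > 0"
  shows "\<exists>T'. norm (T' - T) < \<delta> \<and> diagonalizable E T'"
  using assms
proof (induction "card B" arbitrary: B E T \<delta> rule: less_induct)
  case less
  note B = less.prems(1,2) and EE = less.prems(3) and ET = less.prems(4) and \<delta> = less.prems(5)
  show ?case
  proof (cases "E = 0")
    case True
    then have "T = 0"
      using ET by (simp add: local_unit_def cblinfun_compose_simps)
    then have "diagonalizable E T"
      using True unfolding diagonalizable_def by (intro exI[of _ 0]) auto
    then show ?thesis
      using \<delta> by (intro exI[of _ T]) simp
  next
    case False
    obtain v \<mu>0 where v: "v \<noteq> 0" "cblinfun_apply E v = v" "cblinfun_apply T v = \<mu>0 *\<^sub>C v"
      using ex_eigenvector[OF B ET False EE] by blast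
    obtain g0 :: "'a \<Rightarrow>\<^sub>C\<^sub>L complex" where g0: "cblinfun_apply g0 v = 1"
      using v(1) by (rule ex_functional_eq_1)
    define g where "g = g0 o\<^sub>C\<^sub>L E"
    have gv: "cblinfun_apply g v = 1"
      by (simp add: g_def cblinfun_apply_simps v g0)
    define e where "e = rank_one g v"
    define E' where "E' = E - e"
    have ee: "e o\<^sub>C\<^sub>L e = e"
      by (rule cblinfun_eqI) (simp add: e_def cblinfun_apply_simps rank_one_apply gv scaleC_complex_def)
    have Ee: "E o\<^sub>C\<^sub>L e = e"
      by (simp add: e_def compose_rank_one v)
    have eE: "e o\<^sub>C\<^sub>L E = e"
      by (simp add: e_def rank_one_compose g_def cblinfun_compose_assoc EE)
    have Te: "T o\<^sub>C\<^sub>L e = \<mu>0 *\<^sub>C e"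
      by (rule cblinfun_eqI)
        (simp add: e_def cblinfun_apply_simps rank_one_apply v scaleC_scaleC mult.commute)
    have eE': "e o\<^sub>C\<^sub>L E' = 0" and E'e: "E' o\<^sub>C\<^sub>L e = 0" and E'E: "E' o\<^sub>C\<^sub>L E = E'"
      and E'E': "E' o\<^sub>C\<^sub>L E' = E'" and EE': "E o\<^sub>C\<^sub>L E' = E'"
      by (simp_all add: E'_def cblinfun_compose_simps ee Ee eE EE)
    define T0 where "T0 = E' o\<^sub>C\<^sub>L T o\<^sub>C\<^sub>L E'"
    define N where "N = e o\<^sub>C\<^sub>L T o\<^sub>C\<^sub>L E'"
    have T_eq: "T = \<mu>0 *\<^sub>C e + N + T0"
    proof -
      have "T o\<^sub>C\<^sub>L E' = T - \<mu>0 *\<^sub>C e"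
        using ET by (simp add: E'_def cblinfun_compose_simps Te local_unit_def)
      moreover have "E o\<^sub>C\<^sub>L T = T" using ET by (simp add: local_unit_def)
      ultimately show ?thesis
        by (simp add: N_def T0_def cblinfun_compose_assoc)
          (simp add: E'_def cblinfun_compose_simps ee Ee)
    qed
    have "cblinfun_apply E' v = 0"
      by (simp add: E'_def e_def cblinfun_apply_simps rank_one_apply gv v scaleC_one)
    then obtain B' where B': "finite B'" "card B' < card B"
      "\<And>x. cblinfun_apply E' x \<in> complex_vector.span B'"
      using range_in_smaller_span[OF B E'E v(1,2)] by blast
    have "local_unit E' T0"
      by (metis E'E' T0_def cblinfun_compose_assoc local_unit_def)
    then obtain T1 where T1: "norm (T1 - T0) < \<delta> / 2" "diagonalizable E' T1"
      using less.hyps[OF B'(2) B'(1) B'(3) E'E', of T0 "\<delta> / 2"] \<delta> by auto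
    obtain k :: nat and lam f where f: "\<And>i j. i < k \<Longrightarrow> j < k \<Longrightarrow> f i o\<^sub>C\<^sub>L f j = (if i = j then f i else 0)"
      "(\<Sum>i<k. f i) = E'" "T1 = (\<Sum>i<k. lam i *\<^sub>C f i)"
      using T1(2) unfolding diagonalizable_def by blast
    \<comment> \<open>moving the eigenvalue by less than \<open>\<rho>\<close> moves the operator by less than \<open>\<delta> / 2\<close>\<close>
    define \<rho> where "\<rho> = \<delta> / (2 * (1 + norm e))"
    have \<rho>: "\<rho> > 0" "\<rho> * norm e < \<delta> / 2"
    proof -
      have "2 * (1 + norm e) > 0" by (simp add: add_pos_nonneg)
      then show "\<rho> > 0" using \<delta> by (simp add: \<rho>_def)
      have "\<rho> * (2 * (1 + norm e)) = \<delta>"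
        using \<open>2 * (1 + norm e) > 0\<close> unfolding \<rho>_def by (intro nonzero_eq_divide_eq[THEN iffD1]) auto
      then show "\<rho> * norm e < \<delta> / 2"
        using \<open>\<rho> > 0\<close> by (simp add: algebra_simps)
    qed
    have "infinite (ball \<mu>0 \<rho>)"
      using uncountable_ball[OF \<rho>(1)] countable_finite by blast
    then have "\<not> ball \<mu>0 \<rho> \<subseteq> lam ` {..<k}"
      by (meson finite_imageI finite_lessThan finite_subset)
    then obtain \<mu> where \<mu>: "\<mu> \<in> ball \<mu>0 \<rho>" "\<And>i. i < k \<Longrightarrow> lam i \<noteq> \<mu>"
      by blast
    have "diagonalizable (e + E') (\<mu> *\<^sub>C e + N + T1)"
      unfolding f(3)
    proof (rule diagonalizable_block[OF f(1,2) ee eE' E'e])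
      show "e o\<^sub>C\<^sub>L N = N" "N o\<^sub>C\<^sub>L E' = N"
        unfolding N_def by (metis ee E'E' cblinfun_compose_assoc)+
    qed (use \<mu> in auto)
    moreover have "e + E' = E" by (simp add: E'_def)
    moreover have "norm ((\<mu> *\<^sub>C e + N + T1) - T) < \<delta>"
    proof -
      have "(\<mu> *\<^sub>C e + N + T1) - T = (\<mu> - \<mu>0) *\<^sub>C e + (T1 - T0)"
        by (subst T_eq) (simp add: complex_vector.scale_left_diff_distrib)
      also have "norm \<dots> \<le> cmod (\<mu> - \<mu>0) * norm e + norm (T1 - T0)"
        by (rule norm_triangle_mono) (simp_all add: norm_scaleC)
      also have "\<dots> \<le> \<rho> * norm e + norm (T1 - T0)"
        using \<mu>(1) by (intro add_right_mono mult_right_mono) (auto simp: dist_norm norm_minus_commute)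
      finally show ?thesis
        using \<rho>(2) T1(1) by simp
    qed
    ultimately show ?thesis by auto
  qed
qed

section \<open>Homogeneous polynomials along lines\<close>

text \<open>
  For a polynomial \<open>f\<close> of degree at most \<open>n\<close> this is the coefficient of the linear term. The
  discrete Fourier formula over the roots of unity of order \<open>n + 1\<close> makes it visible that the
  coefficient depends continuously on, and is bounded by, the values of \<open>f\<close> on the unit
  circle. The weight \<open>\<omega>\<^sup>j\<^sup>n\<close> is \<open>\<omega>\<^sup>-\<^sup>j\<close>.
\<close>

definition linear_coefficient :: "nat \<Rightarrow> (complex \<Rightarrow> 'w::complex_normed_vector) \<Rightarrow> 'w"
  where "linear_coefficient n f = (1 / of_nat (Suc n)) *\<^sub>C
    (\<Sum>j\<le>n. exp (2 * of_real pi * \<i> * of_nat (j * n) / of_nat (Suc n)) *\<^sub>C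
      f (exp (2 * of_real pi * \<i> * of_nat j / of_nat (Suc n))))"

lemma linear_coefficient_sum:
  "linear_coefficient n (\<lambda>s. \<Sum>i\<in>A. f i s) = (\<Sum>i\<in>A. linear_coefficient n (f i))"
  unfolding linear_coefficient_def complex_vector.scale_sum_right by (rule sum.swap)

lemma linear_coefficient_scaleC:
  "linear_coefficient n (\<lambda>s. c *\<^sub>C f s) = c *\<^sub>C linear_coefficient n f"
  unfolding linear_coefficient_def complex_vector.scale_sum_right
  by (simp add: scaleC_scaleC mult_ac)

lemma linear_coefficient_monomial:
  assumes n: "n \<ge> 1" and m: "m \<le> n"
  shows "linear_coefficient n (\<lambda>s. s ^ m *\<^sub>C a) = (if m = 1 then a else 0)"
proof -
  let ?w = "\<lambda>k. exp (2 * of_real pi * \<i> * of_nat k / of_nat (Suc n)) :: complex"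
  have w_pow: "?w k ^ j = ?w (k * j)" for k j
    by (simp add: exp_of_nat_mult[symmetric] mult_ac)
  have w_add: "?w k * ?w l = ?w (k + l)" for k l
    by (simp add: exp_add[symmetric] add_divide_distrib[symmetric] distrib_left)
  have w_1: "?w k = 1 \<longleftrightarrow> Suc n dvd k" for k
    using complex_root_unity_eq_1[of "Suc n" k] by simp
  have "linear_coefficient n (\<lambda>s. s ^ m *\<^sub>C a) =
      (1 / of_nat (Suc n)) *\<^sub>C (\<Sum>j\<le>n. (?w (j * n) * ?w j ^ m) *\<^sub>C a)"
    by (simp add: linear_coefficient_def scaleC_scaleC)
  also have "(\<Sum>j\<le>n. (?w (j * n) * ?w j ^ m) *\<^sub>C a) = (\<Sum>j\<le>n. ?w (n + m) ^ j *\<^sub>C a)"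
  proof (rule sum.cong[OF refl])
    fix j
    have "?w (j * n) * ?w j ^ m = ?w (n + m) ^ j"
      unfolding w_pow w_add by (simp add: algebra_simps)
    then show "(?w (j * n) * ?w j ^ m) *\<^sub>C a = ?w (n + m) ^ j *\<^sub>C a" by simp
  qed
  also have "\<dots> = (\<Sum>j\<le>n. ?w (n + m) ^ j) *\<^sub>C a"
    by (simp only: complex_vector.scale_sum_left)
  also have "(\<Sum>j\<le>n. ?w (n + m) ^ j) = (if m = 1 then of_nat (Suc n) else 0)"
  proof (cases "m = 1")
    case True
    then have "?w (n + m) = 1"
      unfolding w_1 by simp
    then show ?thesis using True by simp
  next
    case False
    have "\<not> Suc n dvd n + m"
    proof (cases m)
      case 0
      then show ?thesis using n by (auto dest: dvd_imp_le)
    next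
      case (Suc l)
      then have "n + m = Suc n + l" by simp
      moreover have "\<not> Suc n dvd l"
        using Suc False m by (auto dest: dvd_imp_le)
      ultimately show ?thesis by (metis dvd_add_right_iff dvd_refl)
    qed
    moreover have "?w (n + m) ^ Suc n = 1"
      unfolding w_pow w_1 by (rule dvd_triv_right)
    ultimately show ?thesis
      using False sum_gp0[of "?w (n + m)" n] w_1[of "n + m"] by simp
  qed
  finally show ?thesis
    by (simp add: scaleC_scaleC scaleC_one del: of_nat_Suc)
qed

lemma norm_linear_coefficient:
  assumes "\<And>s. cmod s = 1 \<Longrightarrow> norm (f s) \<le> b"
  shows "norm (linear_coefficient n f) \<le> b"
proof -
  have cm: "cmod (exp (2 * of_real pi * \<i> * of_nat k / of_nat (Suc n))) = 1" for k
    by (simp add: norm_exp_eq_Re)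
  have "norm (\<Sum>j\<le>n. exp (2 * of_real pi * \<i> * of_nat (j * n) / of_nat (Suc n)) *\<^sub>C
      f (exp (2 * of_real pi * \<i> * of_nat j / of_nat (Suc n)))) \<le> (\<Sum>j\<le>n. b)"
    using assms cm by (intro sum_norm_le) (simp add: norm_scaleC)
  then show ?thesis
    by (simp add: linear_coefficient_def norm_scaleC norm_divide field_simps del: of_nat_Suc)
qed

lemma clinear_on_add: "clinear_on V f \<Longrightarrow> x \<in> V \<Longrightarrow> y \<in> V \<Longrightarrow> f (x + y) = f x + f y"
  by (simp add: clinear_on_def)

lemma clinear_on_scaleC: "clinear_on V f \<Longrightarrow> x \<in> V \<Longrightarrow> f (c *\<^sub>C x) = c *\<^sub>C f x"
  by (simp add: clinear_on_def)

lemma clinear_on_0: "clinear_on V f \<Longrightarrow> 0 \<in> V \<Longrightarrow> f 0 = 0"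
  using clinear_on_scaleC[of V f 0 0] by simp

text \<open>
  The induction replaces the arguments one coordinate at a time, so the statement allows
  arbitrary arguments \<open>x i\<close> outside \<open>I\<close>.
\<close>

lemma multilinear_expand:
  assumes \<phi>: "multilinear_on n V \<phi>" and V: "complex_vector.subspace V" and AB: "A \<in> V" "B \<in> V"
    and I: "finite I" "I \<subseteq> {..<n}" and x: "x \<in> {..<n} \<rightarrow>\<^sub>E V"
  shows "\<phi> (\<lambda>i. if i \<in> I then A + s *\<^sub>C B else x i) =
    (\<Sum>J\<in>Pow I. s ^ card J *\<^sub>C \<phi> (\<lambda>i. if i \<in> J then B else if i \<in> I then A else x i))"
  using I x
proof (induction I arbitrary: x rule: finite_induct)
  case empty
  then show ?case by (simp add: scaleC_one)
next
  case (insert k I)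
  let ?z = "\<lambda>J i. if i \<in> J then B else if i \<in> I then A else x i"
  have kn: "k < n" and In: "I \<subseteq> {..<n}" using insert.prems by auto
  have ABs: "A + s *\<^sub>C B \<in> V"
    using V AB by (intro complex_vector.subspace_add complex_vector.subspace_scale)
  have y: "x(k := A + s *\<^sub>C B) \<in> {..<n} \<rightarrow>\<^sub>E V"
    using insert.prems(2) kn ABs by (auto simp: PiE_iff extensional_def)
  have z: "?z J \<in> {..<n} \<rightarrow>\<^sub>E V" if "J \<subseteq> I" for J
    using insert.prems(2) In AB that by (auto simp: PiE_iff extensional_def)
  have lin: "\<phi> ((?z J)(k := A + s *\<^sub>C B)) = \<phi> ((?z J)(k := A)) + s *\<^sub>C \<phi> ((?z J)(k := B))" if "J \<subseteq> I" for J
  proof -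
    have "clinear_on V (\<lambda>v. \<phi> ((?z J)(k := v)))"
      using \<phi> z[OF that] kn unfolding multilinear_on_def by blast
    moreover have "s *\<^sub>C B \<in> V"
      using V AB by (intro complex_vector.subspace_scale)
    ultimately have "\<phi> ((?z J)(k := A + s *\<^sub>C B)) = \<phi> ((?z J)(k := A)) + \<phi> ((?z J)(k := s *\<^sub>C B))"
      "\<phi> ((?z J)(k := s *\<^sub>C B)) = s *\<^sub>C \<phi> ((?z J)(k := B))"
      using AB unfolding clinear_on_def by blast+
    then show ?thesis by (simp only:)
  qed
  have "\<phi> (\<lambda>i. if i \<in> insert k I then A + s *\<^sub>C B else x i) =
      \<phi> (\<lambda>i. if i \<in> I then A + s *\<^sub>C B else (x(k := A + s *\<^sub>C B)) i)"
    by (intro arg_cong[where f = \<phi>]) auto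
  also have "\<dots> = (\<Sum>J\<in>Pow I. s ^ card J *\<^sub>C \<phi> (\<lambda>i. if i \<in> J then B else if i \<in> I then A
      else (x(k := A + s *\<^sub>C B)) i))"
    by (rule insert.IH[OF In y])
  also have "\<dots> = (\<Sum>J\<in>Pow I. s ^ card J *\<^sub>C \<phi> ((?z J)(k := A)) +
      s ^ card (insert k J) *\<^sub>C \<phi> ((?z J)(k := B)))"
  proof (rule sum.cong[OF refl])
    fix J assume J: "J \<in> Pow I"
    have "(\<lambda>i. if i \<in> J then B else if i \<in> I then A else (x(k := A + s *\<^sub>C B)) i) = (?z J)(k := A + s *\<^sub>C B)"
      by (rule ext) (use J insert.hyps in auto)
    moreover have "card (insert k J) = Suc (card J)"
      using J insert.hyps by (subst card_insert_disjoint) (auto dest: finite_subset)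
    ultimately show "s ^ card J *\<^sub>C \<phi> (\<lambda>i. if i \<in> J then B else if i \<in> I then A
        else (x(k := A + s *\<^sub>C B)) i) =
      s ^ card J *\<^sub>C \<phi> ((?z J)(k := A)) + s ^ card (insert k J) *\<^sub>C \<phi> ((?z J)(k := B))"
      using lin J by (simp add: scaleC_add_right scaleC_scaleC mult.commute)
  qed
  also have "\<dots> = (\<Sum>J\<in>Pow I. s ^ card J *\<^sub>C \<phi> ((?z J)(k := A))) +
      (\<Sum>J\<in>insert k ` Pow I. s ^ card J *\<^sub>C \<phi> ((?z (J - {k}))(k := B)))"
  proof -
    have inj: "inj_on (insert k) (Pow I)"
      using insert.hyps by (auto simp: inj_on_def)
    have diff: "insert k J - {k} = J" if "J \<in> Pow I" for J
      using that insert.hyps by auto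
    have "(\<Sum>J\<in>insert k ` Pow I. s ^ card J *\<^sub>C \<phi> ((?z (J - {k}))(k := B))) =
        (\<Sum>J\<in>Pow I. s ^ card (insert k J) *\<^sub>C \<phi> ((?z J)(k := B)))"
      unfolding sum.reindex[OF inj] o_def by (rule sum.cong[OF refl]) (simp only: diff)
    then show ?thesis
      by (simp only: sum.distrib)
  qed
  also have "\<dots> = (\<Sum>J\<in>Pow (insert k I). s ^ card J *\<^sub>C
      \<phi> (\<lambda>i. if i \<in> J then B else if i \<in> insert k I then A else x i))"
  proof -
    have 1: "(?z J)(k := A) = (\<lambda>i. if i \<in> J then B else if i \<in> insert k I then A else x i)" if "J \<in> Pow I" for J
      by (rule ext) (use that insert.hyps in auto)
    have 2: "(?z (J - {k}))(k := B) = (\<lambda>i. if i \<in> J then B else if i \<in> insert k I then A else x i)"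
      if "J \<in> insert k ` Pow I" for J
      by (rule ext) (use that in auto)
    have "Pow I \<inter> insert k ` Pow I = {}"
      using insert.hyps by auto
    then show ?thesis
      unfolding Pow_insert using insert.hyps(1)
      by (simp only: sum.union_disjoint finite_Pow_iff finite_imageI)
        (intro arg_cong2[where f = "(+)"] sum.cong refl; simp only: 1 2)
  qed
  finally show ?case .
qed

theorem polynomial_expand:
  assumes \<phi>: "multilinear_on n V \<phi>" and P: "\<And>x. x \<in> V \<Longrightarrow> P x = \<phi> (\<lambda>i\<in>{..<n}. x)"
    and V: "complex_vector.subspace V" and AB: "A \<in> V" "B \<in> V"
  shows "P (A + s *\<^sub>C B) =
    (\<Sum>J\<in>Pow {..<n}. s ^ card J *\<^sub>C \<phi> (\<lambda>i\<in>{..<n}. if i \<in> J then B else A))"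
proof -
  have "P (A + s *\<^sub>C B) = \<phi> (\<lambda>i. if i \<in> {..<n} then A + s *\<^sub>C B else (\<lambda>i\<in>{..<n}. A) i)"
    using V AB by (subst P) (auto intro!: complex_vector.subspace_add complex_vector.subspace_scale
        arg_cong[where f = \<phi>])
  also have "\<dots> = (\<Sum>J\<in>Pow {..<n}. s ^ card J *\<^sub>C
      \<phi> (\<lambda>i. if i \<in> J then B else if i \<in> {..<n} then A else (\<lambda>i\<in>{..<n}. A) i))"
    by (rule multilinear_expand[OF \<phi> V AB]) (use AB in \<open>auto simp: PiE_iff extensional_def\<close>)
  also have "\<dots> = (\<Sum>J\<in>Pow {..<n}. s ^ card J *\<^sub>C \<phi> (\<lambda>i\<in>{..<n}. if i \<in> J then B else A))"
    by (intro sum.cong refl arg_cong2[where f = scaleC] arg_cong[where f = \<phi>] ext) auto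
  finally show ?thesis .
qed

theorem homogeneous_polynomial_scaleC:
  assumes P: "homogeneous_polynomial_on n V P" and V: "complex_vector.subspace V" and B: "B \<in> V"
  shows "P (s *\<^sub>C B) = s ^ n *\<^sub>C P B"
proof -
  obtain \<phi> where \<phi>: "multilinear_on n V \<phi>" "\<And>x. x \<in> V \<Longrightarrow> P x = \<phi> (\<lambda>i\<in>{..<n}. x)"
    using P unfolding homogeneous_polynomial_on_def by blast
  have 0: "0 \<in> V" by (rule complex_vector.subspace_0[OF V])
  have zero: "\<phi> (\<lambda>i\<in>{..<n}. if i \<in> J then B else 0) = 0" if J: "J \<in> Pow {..<n} - {{..<n}}" for J
  proof -
    let ?z = "\<lambda>i\<in>{..<n}. if i \<in> J then B else 0"
    obtain i where i: "i < n" "i \<notin> J"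
      using J by auto
    have "?z \<in> {..<n} \<rightarrow>\<^sub>E V"
      using 0 B by (simp add: restrict_PiE_iff)
    then have "clinear_on V (\<lambda>v. \<phi> (?z(i := v)))"
      using \<phi>(1) i(1) unfolding multilinear_on_def by blast
    then have "\<phi> (?z(i := 0 *\<^sub>C 0)) = 0 *\<^sub>C \<phi> (?z(i := 0))"
      using 0 unfolding clinear_on_def by blast
    moreover have "?z(i := 0) = ?z" using i by auto
    ultimately show ?thesis by simp
  qed
  have "P (s *\<^sub>C B) = P (0 + s *\<^sub>C B)" by simp
  also have "\<dots> = (\<Sum>J\<in>Pow {..<n}. s ^ card J *\<^sub>C \<phi> (\<lambda>i\<in>{..<n}. if i \<in> J then B else 0))"
    by (rule polynomial_expand[OF \<phi> V 0 B])
  also have "\<dots> = s ^ card {..<n} *\<^sub>C \<phi> (\<lambda>i\<in>{..<n}. if i \<in> {..<n} then B else 0) +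
      (\<Sum>J\<in>Pow {..<n} - {{..<n}}. s ^ card J *\<^sub>C \<phi> (\<lambda>i\<in>{..<n}. if i \<in> J then B else 0))"
    by (rule sum.remove) auto
  also have "(\<Sum>J\<in>Pow {..<n} - {{..<n}}. s ^ card J *\<^sub>C \<phi> (\<lambda>i\<in>{..<n}. if i \<in> J then B else 0)) = 0"
    by (rule sum.neutral, rule ballI, subst zero) (auto simp only: complex_vector.scale_zero_right)
  also have "(\<lambda>i\<in>{..<n}. if i \<in> {..<n} then B else 0) = (\<lambda>i\<in>{..<n}. B)"
    by (rule restrict_ext) simp
  finally show ?thesis
    unfolding \<phi>(2)[OF B] by (simp only: card_lessThan add_0_right)
qed

definition polynomial_derivative ::
  "nat \<Rightarrow> ('v::complex_normed_vector \<Rightarrow> 'w::complex_normed_vector) \<Rightarrow> 'v \<Rightarrow> 'v \<Rightarrow> 'w"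
  where "polynomial_derivative n P A B = linear_coefficient n (\<lambda>s. P (A + s *\<^sub>C B))"

text \<open>
  Only the singletons \<open>J\<close> contribute to the linear term of the expansion, which is therefore
  \<open>\<Sum>\<^sub>j \<phi>(A, \<dots>, B, \<dots>, A)\<close> with \<open>B\<close> in position \<open>j\<close>.
\<close>

theorem clinear_polynomial_derivative:
  assumes n: "n \<ge> 1" and P: "homogeneous_polynomial_on n V P" and V: "complex_vector.subspace V" and A: "A \<in> V"
  shows "clinear_on V (polynomial_derivative n P A)"
proof -
  obtain \<phi> where \<phi>: "multilinear_on n V \<phi>" "\<And>x. x \<in> V \<Longrightarrow> P x = \<phi> (\<lambda>i\<in>{..<n}. x)"
    using P unfolding homogeneous_polynomial_on_def by blast
  let ?z = "\<lambda>i\<in>{..<n}. A"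
  have D: "polynomial_derivative n P A B = (\<Sum>j<n. \<phi> (?z(j := B)))" if B: "B \<in> V" for B
  proof -
    have card_le: "card J \<le> n" if "J \<in> Pow {..<n}" for J
      using that card_mono[of "{..<n}" J] by auto
    have "polynomial_derivative n P A B =
        (\<Sum>J\<in>Pow {..<n}. linear_coefficient n (\<lambda>s. s ^ card J *\<^sub>C \<phi> (\<lambda>i\<in>{..<n}. if i \<in> J then B else A)))"
    proof -
      have "(\<lambda>s. P (A + s *\<^sub>C B)) =
          (\<lambda>s. \<Sum>J\<in>Pow {..<n}. s ^ card J *\<^sub>C \<phi> (\<lambda>i\<in>{..<n}. if i \<in> J then B else A))"
        by (rule ext) (rule polynomial_expand[OF \<phi> V A B])
      then show ?thesis
        unfolding polynomial_derivative_def linear_coefficient_sum[symmetric] by (rule arg_cong)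
    qed
    also have "\<dots> = (\<Sum>J\<in>Pow {..<n}. if card J = 1 then \<phi> (\<lambda>i\<in>{..<n}. if i \<in> J then B else A) else 0)"
      using n card_le by (intro sum.cong refl linear_coefficient_monomial) auto
    also have "\<dots> = (\<Sum>J\<in>{J\<in>Pow {..<n}. card J = 1}. \<phi> (\<lambda>i\<in>{..<n}. if i \<in> J then B else A))"
      by (subst sum.inter_filter) auto
    also have "{J\<in>Pow {..<n}. card J = 1} = (\<lambda>j. {j}) ` {..<n}"
      by (auto simp: card_1_singleton_iff)
    also have "(\<Sum>J\<in>(\<lambda>j. {j}) ` {..<n}. \<phi> (\<lambda>i\<in>{..<n}. if i \<in> J then B else A)) =
        (\<Sum>j<n. \<phi> (\<lambda>i\<in>{..<n}. if i \<in> {j} then B else A))"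
      by (subst sum.reindex) auto
    also have "\<dots> = (\<Sum>j<n. \<phi> (?z(j := B)))"
      by (intro sum.cong refl arg_cong[where f = \<phi>]) auto
    finally show ?thesis .
  qed
  have "?z \<in> {..<n} \<rightarrow>\<^sub>E V" using A by (simp add: restrict_PiE_iff)
  then have lin: "clinear_on V (\<lambda>v. \<phi> (?z(j := v)))" if "j < n" for j
    using \<phi>(1) that unfolding multilinear_on_def by blast
  show ?thesis
    unfolding clinear_on_def
  proof (intro conjI ballI allI)
    fix x y assume xy: "x \<in> V" "y \<in> V"
    then have "x + y \<in> V" using V by (rule complex_vector.subspace_add[rotated])
    then have "polynomial_derivative n P A (x + y) = (\<Sum>j<n. \<phi> (?z(j := x)) + \<phi> (?z(j := y)))"
      unfolding D[OF \<open>x + y \<in> V\<close>]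
      by (intro sum.cong refl) (use lin xy in \<open>auto simp: clinear_on_def\<close>)
    then show "polynomial_derivative n P A (x + y) =
        polynomial_derivative n P A x + polynomial_derivative n P A y"
      by (simp add: D xy sum.distrib)
  next
    fix c x assume x: "x \<in> V"
    then have "c *\<^sub>C x \<in> V" using V by (rule complex_vector.subspace_scale[rotated])
    then have "polynomial_derivative n P A (c *\<^sub>C x) = (\<Sum>j<n. c *\<^sub>C \<phi> (?z(j := x)))"
      unfolding D[OF \<open>c *\<^sub>C x \<in> V\<close>]
      by (intro sum.cong refl) (use lin x in \<open>auto simp: clinear_on_def\<close>)
    then show "polynomial_derivative n P A (c *\<^sub>C x) = c *\<^sub>C polynomial_derivative n P A x"
      by (simp add: D x complex_vector.scale_sum_right)
  qed
qed

section \<open>Approximable operators and their powers\<close>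

lemma subspace_finite_rank_ops: "complex_vector.subspace (finite_rank_ops :: ('a::complex_normed_vector \<Rightarrow>\<^sub>C\<^sub>L 'a) set)"
  by (rule complex_vector.subspaceI) (auto simp: finite_rank_ops_iff finite_rank_add finite_rank_scaleC)

lemma finite_rank_ops_subset: "finite_rank_ops \<subseteq> approximable_ops"
  unfolding approximable_ops_def by (rule closure_subset)

lemma approximable_sequence:
  assumes "T \<in> approximable_ops"
  obtains F where "\<And>m. F m \<in> finite_rank_ops" "F \<longlonglongrightarrow> T"
  using assms unfolding approximable_ops_def closure_sequential by blast

lemma approximable_limit:
  assumes "\<And>m. F m \<in> finite_rank_ops" "F \<longlonglongrightarrow> T"
  shows "T \<in> approximable_ops"
  using assms unfolding approximable_ops_def closure_sequential by blast

lemma tendsto_scaleC: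
  fixes f :: "nat \<Rightarrow> 'a::complex_normed_vector"
  assumes "f \<longlonglongrightarrow> x"
  shows "(\<lambda>m. c *\<^sub>C f m) \<longlonglongrightarrow> c *\<^sub>C x"
  by (rule bounded_linear.tendsto[OF bounded_linear_scaleC assms])

lemma subspace_approximable_ops: "complex_vector.subspace (approximable_ops :: ('a::complex_normed_vector \<Rightarrow>\<^sub>C\<^sub>L 'a) set)"
proof (rule complex_vector.subspaceI)
  show "(0 :: 'a \<Rightarrow>\<^sub>C\<^sub>L 'a) \<in> approximable_ops"
    using finite_rank_ops_subset subspace_finite_rank_ops complex_vector.subspace_0 by blast
next
  fix S T :: "'a \<Rightarrow>\<^sub>C\<^sub>L 'a" assume "S \<in> approximable_ops" "T \<in> approximable_ops"
  then obtain F G where "\<And>m. F m \<in> finite_rank_ops" "F \<longlonglongrightarrow> S" "\<And>m. G m \<in> finite_rank_ops" "G \<longlonglongrightarrow> T"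
    by (meson approximable_sequence)
  then show "S + T \<in> approximable_ops"
    by (intro approximable_limit[of "\<lambda>m. F m + G m"] tendsto_add complex_vector.subspace_add
        subspace_finite_rank_ops)
next
  fix c and T :: "'a \<Rightarrow>\<^sub>C\<^sub>L 'a" assume "T \<in> approximable_ops"
  then obtain F where "\<And>m. F m \<in> finite_rank_ops" "F \<longlonglongrightarrow> T"
    by (meson approximable_sequence)
  then show "c *\<^sub>C T \<in> approximable_ops"
    by (intro approximable_limit[of "\<lambda>m. c *\<^sub>C F m"] tendsto_scaleC complex_vector.subspace_scale
        subspace_finite_rank_ops)
qed

lemma bounded_bilinear_compose: "bounded_bilinear (\<lambda>S T. S o\<^sub>C\<^sub>L T)"
proof
  show "\<exists>K. \<forall>a b. norm (a o\<^sub>C\<^sub>L b) \<le> norm a * norm b * K"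
    using norm_cblinfun_compose by (metis mult.right_neutral)
qed (simp_all add: cblinfun_compose_simps scaleR_scaleC)

lemma tendsto_cblinfun_power:
  assumes "F \<longlonglongrightarrow> T"
  shows "(\<lambda>m. cblinfun_power (F m) n) \<longlonglongrightarrow> cblinfun_power T n"
  by (induction n) (use assms in \<open>auto intro: bounded_bilinear.tendsto[OF bounded_bilinear_compose]\<close>)

lemma finite_rank_power: "n \<ge> 1 \<Longrightarrow> finite_rank T \<Longrightarrow> finite_rank (cblinfun_power T n)"
  by (cases n) (auto intro: finite_rank_compose_right)

lemma power_approximable:
  assumes n: "n \<ge> 1" and T: "T \<in> approximable_ops"
  shows "cblinfun_power T n \<in> approximable_ops"
proof -
  obtain F where F: "\<And>m. F m \<in> finite_rank_ops" "F \<longlonglongrightarrow> T"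
    using approximable_sequence[OF T] by blast
  show ?thesis
    by (rule approximable_limit[OF _ tendsto_cblinfun_power[OF F(2)]])
      (use F(1) n in \<open>auto simp: finite_rank_ops_iff intro: finite_rank_power\<close>)
qed

lemma power_add_orthogonal:
  assumes "n \<ge> 1" and "S o\<^sub>C\<^sub>L T = 0" "T o\<^sub>C\<^sub>L S = 0"
  shows "cblinfun_power (S + T) n = cblinfun_power S n + cblinfun_power T n"
  using assms(1)
proof (induction n rule: nat_induct_at_least)
  case base
  then show ?case by (simp add: cblinfun_compose_id_right)
next
  case (Suc n)
  obtain k where k: "n = Suc k" using Suc.hyps by (cases n) auto
  have "S o\<^sub>C\<^sub>L (T o\<^sub>C\<^sub>L R) = 0" "T o\<^sub>C\<^sub>L (S o\<^sub>C\<^sub>L R) = 0" for R :: "'a \<Rightarrow>\<^sub>C\<^sub>L 'a"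
    by (simp_all add: assms(2,3) cblinfun_compose_zero_left flip: cblinfun_compose_assoc)
  then show ?case
    using Suc.IH by (simp add: k cblinfun_compose_add_left cblinfun_compose_add_right)
qed

text \<open>
  The coefficient of \<open>s\<^sup>k\<close> in \<open>(e + s T)\<^sup>n\<close>.
\<close>

fun pencil_coeff :: "('a::complex_normed_vector \<Rightarrow>\<^sub>C\<^sub>L 'a) \<Rightarrow> ('a \<Rightarrow>\<^sub>C\<^sub>L 'a) \<Rightarrow> nat \<Rightarrow> nat \<Rightarrow> ('a \<Rightarrow>\<^sub>C\<^sub>L 'a)"
  where
    "pencil_coeff e T 0 0 = id_cblinfun"
  | "pencil_coeff e T 0 (Suc k) = 0"
  | "pencil_coeff e T (Suc n) 0 = e o\<^sub>C\<^sub>L pencil_coeff e T n 0"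
  | "pencil_coeff e T (Suc n) (Suc k) = e o\<^sub>C\<^sub>L pencil_coeff e T n (Suc k) + T o\<^sub>C\<^sub>L pencil_coeff e T n k"

lemma pencil_coeff_eq_0: "n < k \<Longrightarrow> pencil_coeff e T n k = 0"
  by (induction e T n k rule: pencil_coeff.induct) (auto simp: cblinfun_compose_simps)

lemma power_pencil:
  "cblinfun_power (e + s *\<^sub>C T) n = (\<Sum>k\<le>n. s ^ k *\<^sub>C pencil_coeff e T n k)"
proof (induction n)
  case 0
  then show ?case by (simp add: scaleC_one)
next
  case (Suc n)
  have "(\<Sum>k\<le>Suc n. s ^ k *\<^sub>C pencil_coeff e T (Suc n) k) =
      e o\<^sub>C\<^sub>L pencil_coeff e T n 0 +
      (\<Sum>k\<le>n. s ^ Suc k *\<^sub>C (e o\<^sub>C\<^sub>L pencil_coeff e T n (Suc k))) +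
      (\<Sum>k\<le>n. s ^ Suc k *\<^sub>C (T o\<^sub>C\<^sub>L pencil_coeff e T n k))"
    by (subst sum.atMost_Suc_shift) (simp add: scaleC_one scaleC_add_right sum.distrib add.assoc)
  also have "e o\<^sub>C\<^sub>L pencil_coeff e T n 0 +
      (\<Sum>k\<le>n. s ^ Suc k *\<^sub>C (e o\<^sub>C\<^sub>L pencil_coeff e T n (Suc k))) =
      (\<Sum>k\<le>Suc n. s ^ k *\<^sub>C (e o\<^sub>C\<^sub>L pencil_coeff e T n k))"
    by (subst sum.atMost_Suc_shift) (simp add: scaleC_one)
  also have "\<dots> = (\<Sum>k\<le>n. s ^ k *\<^sub>C (e o\<^sub>C\<^sub>L pencil_coeff e T n k))"
    by (simp add: pencil_coeff_eq_0 cblinfun_compose_zero_right)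
  also have "\<dots> + (\<Sum>k\<le>n. s ^ Suc k *\<^sub>C (T o\<^sub>C\<^sub>L pencil_coeff e T n k)) =
      (e + s *\<^sub>C T) o\<^sub>C\<^sub>L (\<Sum>k\<le>n. s ^ k *\<^sub>C pencil_coeff e T n k)"
    by (simp add: cblinfun_compose_simps sum.distrib complex_vector.scale_sum_right scaleC_add_right
        scaleC_scaleC mult.commute)
  finally show ?case
    using Suc by simp
qed

lemma pencil_coeff_1:
  assumes "local_unit e T"
  shows "pencil_coeff e T n 1 = of_nat n *\<^sub>C T"
proof -
  have 0: "T o\<^sub>C\<^sub>L pencil_coeff e T n 0 = T" for n
  proof (induction n)
    case (Suc n)
    have "T o\<^sub>C\<^sub>L (e o\<^sub>C\<^sub>L pencil_coeff e T n 0) = (T o\<^sub>C\<^sub>L e) o\<^sub>C\<^sub>L pencil_coeff e T n 0"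
      by (simp only: cblinfun_compose_assoc)
    then show ?case using Suc assms by (simp add: local_unit_def)
  qed (simp add: cblinfun_compose_id_right)
  have "e o\<^sub>C\<^sub>L T = T" using assms by (simp add: local_unit_def)
  then show ?thesis
    by (induction n) (simp_all add: 0 cblinfun_compose_scaleC_right scaleC_add_left scaleC_one add.commute)
qed

lemma finite_rank_pencil_coeff:
  assumes "n \<ge> 1" "finite_rank e" "finite_rank T"
  shows "finite_rank (pencil_coeff e T n k)"
  using assms(1)
  by (cases n; cases k) (auto intro!: finite_rank_add finite_rank_compose_right assms)

lemma linear_coefficient_power:
  assumes n: "n \<ge> 1"
  shows "linear_coefficient n (\<lambda>s. (1 + s * c) ^ n *\<^sub>C y) = (of_nat n * c) *\<^sub>C y"
proof -
  have "(\<lambda>s. (1 + s * c) ^ n *\<^sub>C y) = (\<lambda>s. \<Sum>k\<le>n. s ^ k *\<^sub>C ((of_nat (n choose k) * c ^ k) *\<^sub>C y))"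
  proof
    fix s
    have "(1 + s * c) ^ n = (\<Sum>k\<le>n. s ^ k * (of_nat (n choose k) * c ^ k))"
      using binomial_ring[of "s * c" 1 n] by (simp add: add.commute power_mult_distrib mult_ac)
    then show "(1 + s * c) ^ n *\<^sub>C y = (\<Sum>k\<le>n. s ^ k *\<^sub>C ((of_nat (n choose k) * c ^ k) *\<^sub>C y))"
      by (simp add: complex_vector.scale_sum_left scaleC_scaleC)
  qed
  then have "linear_coefficient n (\<lambda>s. (1 + s * c) ^ n *\<^sub>C y) =
      (\<Sum>k\<le>n. linear_coefficient n (\<lambda>s. s ^ k *\<^sub>C ((of_nat (n choose k) * c ^ k) *\<^sub>C y)))"
    by (simp only: linear_coefficient_sum)
  also have "\<dots> = (\<Sum>k\<le>n. if k = 1 then (of_nat (n choose k) * c ^ k) *\<^sub>C y else 0)"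
    by (intro sum.cong refl linear_coefficient_monomial n) auto
  also have "\<dots> = (of_nat n * c) *\<^sub>C y"
    using n by (simp add: sum.delta)
  finally show ?thesis .
qed

lemma clinear_on_sum:
  assumes f: "clinear_on V f" and V: "complex_vector.subspace V" and x: "\<And>i. i \<in> A \<Longrightarrow> x i \<in> V"
  shows "f (\<Sum>i\<in>A. c i *\<^sub>C x i) = (\<Sum>i\<in>A. c i *\<^sub>C f (x i))"
  using x
proof (induction A rule: infinite_finite_induct)
  case (insert i A)
  have "(\<Sum>i\<in>A. c i *\<^sub>C x i) \<in> V" "c i *\<^sub>C x i \<in> V"
    using insert.prems V by (auto intro!: complex_vector.subspace_sum complex_vector.subspace_scale)
  then have "f (c i *\<^sub>C x i + (\<Sum>i\<in>A. c i *\<^sub>C x i)) = c i *\<^sub>C f (x i) + f (\<Sum>i\<in>A. c i *\<^sub>C x i)"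
    using insert.prems by (simp add: clinear_on_add[OF f] clinear_on_scaleC[OF f])
  then show ?case using insert by simp
qed (simp_all add: clinear_on_0[OF f] complex_vector.subspace_0[OF V])

text \<open>
  The linear term of \<open>(e + s T)\<^sup>n\<close> is \<open>n T\<close>, so a linear map is recovered from its values on
  \<open>n\<close>-th powers.
\<close>

lemma linear_coefficient_of_power:
  assumes n: "n \<ge> 1" and f: "clinear_on finite_rank_ops f" and e: "finite_rank e" "finite_rank T" "local_unit e T"
  shows "linear_coefficient n (\<lambda>s. f (cblinfun_power (e + s *\<^sub>C T) n)) = of_nat n *\<^sub>C f T"
proof -
  have R: "pencil_coeff e T n k \<in> finite_rank_ops" for k
    unfolding finite_rank_ops_iff by (rule finite_rank_pencil_coeff[OF n e(1,2)])
  have "linear_coefficient n (\<lambda>s. f (cblinfun_power (e + s *\<^sub>C T) n)) =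
      linear_coefficient n (\<lambda>s. \<Sum>k\<le>n. s ^ k *\<^sub>C f (pencil_coeff e T n k))"
    unfolding power_pencil by (subst clinear_on_sum[OF f subspace_finite_rank_ops R]) auto
  also have "\<dots> = (\<Sum>k\<le>n. if k = 1 then f (pencil_coeff e T n k) else 0)"
    unfolding linear_coefficient_sum by (intro sum.cong refl linear_coefficient_monomial n) auto
  also have "\<dots> = f (of_nat n *\<^sub>C T)"
    using n pencil_coeff_1[OF e(3)] by (simp add: sum.delta)
  also have "\<dots> = of_nat n *\<^sub>C f T"
    using f e(2) unfolding clinear_on_def by (simp add: finite_rank_ops_iff)
  finally show ?thesis .
qed

section \<open>Orthogonally additive polynomials\<close>

lemma power_diagonal:
  fixes k :: nat
  assumes "n \<ge> 1" and orth: "\<And>i j. i < k \<Longrightarrow> j < k \<Longrightarrow> e i o\<^sub>C\<^sub>L e j = (if i = j then e i else 0)"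
  shows "cblinfun_power (\<Sum>i<k. lam i *\<^sub>C e i) n = (\<Sum>i<k. lam i ^ n *\<^sub>C e i)"
  using assms(1)
proof (induction n rule: nat_induct_at_least)
  case base
  then show ?case by (simp add: cblinfun_compose_id_right)
next
  case (Suc n)
  have "(\<Sum>i<k. lam i *\<^sub>C e i) o\<^sub>C\<^sub>L (\<Sum>j<k. lam j ^ n *\<^sub>C e j) =
      (\<Sum>i<k. \<Sum>j<k. (lam i * lam j ^ n) *\<^sub>C (e i o\<^sub>C\<^sub>L e j))"
    by (subst cblinfun_compose_sum_left)
      (simp add: cblinfun_compose_sum_right cblinfun_compose_scaleC_left cblinfun_compose_scaleC_right
        complex_vector.scale_sum_right scaleC_scaleC mult.commute)
  also have "\<dots> = (\<Sum>i<k. \<Sum>j<k. if i = j then (lam i * lam j ^ n) *\<^sub>C e i else 0)"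
    by (intro sum.cong refl) (simp add: orth)
  also have "\<dots> = (\<Sum>i<k. lam i ^ Suc n *\<^sub>C e i)"
    by (intro sum.cong refl) (simp add: sum.delta)
  finally show ?case
    using Suc.IH by simp
qed

lemma diagonalizableE:
  assumes E: "finite_rank E" and T: "diagonalizable E T"
  obtains k :: nat and e lam
  where "\<And>i j. i < k \<Longrightarrow> j < k \<Longrightarrow> e i o\<^sub>C\<^sub>L e j = (if i = j then e i else 0)"
    and "(\<Sum>i<k. e i) = E" and "T = (\<Sum>i<k. lam i *\<^sub>C e i)" and "\<And>i. i < k \<Longrightarrow> finite_rank (e i)"
proof -
  obtain k :: nat and lam e where e: "\<And>i j. i < k \<Longrightarrow> j < k \<Longrightarrow> e i o\<^sub>C\<^sub>L e j = (if i = j then e i else 0)"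
    "(\<Sum>i<k. e i) = E" "T = (\<Sum>i<k. lam i *\<^sub>C e i)"
    using T unfolding diagonalizable_def by blast
  have "E o\<^sub>C\<^sub>L e i = e i" if "i < k" for i
    using that by (simp add: e(2)[symmetric] cblinfun_compose_sum_left e(1) cong: if_cong)
  then have "finite_rank (e i)" if "i < k" for i
    using finite_rank_compose_right[OF E, of "e i"] that by simp
  with e show thesis by (rule that)
qed

lemma diagonalizable_finite_rank:
  assumes "finite_rank E" "diagonalizable E T"
  shows "finite_rank T"
proof -
  obtain k :: nat and e lam
    where "\<And>i j. i < k \<Longrightarrow> j < k \<Longrightarrow> e i o\<^sub>C\<^sub>L e j = (if i = j then e i else 0)"
      and "(\<Sum>i<k. e i) = E" and "T = (\<Sum>i<k. lam i *\<^sub>C e i)" and "\<And>i. i < k \<Longrightarrow> finite_rank (e i)"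
    by (rule diagonalizableE[OF assms]) blast
  then show ?thesis
    by (auto intro!: finite_rank_sum finite_rank_scaleC)
qed

locale orthogonally_additive_polynomial =
  fixes P :: "('x::complex_banach \<Rightarrow>\<^sub>C\<^sub>L 'x) \<Rightarrow> 'y::complex_banach" and n :: nat
  assumes n: "n \<ge> 1"
    and hom: "homogeneous_polynomial_on n approximable_ops P"
    and cont: "continuous_on approximable_ops P"
    and orth: "orthogonally_additive_on finite_rank_ops P"
begin

abbreviation D :: "('x \<Rightarrow>\<^sub>C\<^sub>L 'x) \<Rightarrow> ('x \<Rightarrow>\<^sub>C\<^sub>L 'x) \<Rightarrow> 'y"
  where "D \<equiv> polynomial_derivative n P"

lemma approximable_finite_rank: "finite_rank (T :: 'x \<Rightarrow>\<^sub>C\<^sub>L 'x) \<Longrightarrow> T \<in> approximable_ops"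
  using finite_rank_ops_subset finite_rank_ops_iff by blast

lemma P_scaleC: "T \<in> approximable_ops \<Longrightarrow> P (s *\<^sub>C T) = s ^ n *\<^sub>C P T"
  by (rule homogeneous_polynomial_scaleC[OF hom subspace_approximable_ops])

lemma P_0: "P 0 = 0"
  using P_scaleC[of 0 0] n complex_vector.subspace_0[OF subspace_approximable_ops] by (simp add: power_0_left)

lemma D_clinear: "e \<in> approximable_ops \<Longrightarrow> clinear_on approximable_ops (D e)"
  by (rule clinear_polynomial_derivative[OF n hom subspace_approximable_ops])

lemma D_clinear_finite_rank: "finite_rank e \<Longrightarrow> clinear_on finite_rank_ops (D e)"
  using D_clinear[OF approximable_finite_rank, of e] finite_rank_ops_subset
  unfolding clinear_on_def by blast

lemma P_diagonal:
  fixes k :: nat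
  assumes fin: "\<And>i. i < k \<Longrightarrow> finite_rank (e i)"
    and e: "\<And>i j. i < k \<Longrightarrow> j < k \<Longrightarrow> e i o\<^sub>C\<^sub>L e j = (if i = j then e i else 0)"
  shows "P (\<Sum>i<k. lam i *\<^sub>C e i) = (\<Sum>i<k. lam i ^ n *\<^sub>C P (e i))"
  using assms
proof (induction k)
  case 0
  then show ?case by (simp add: P_0)
next
  case (Suc k)
  let ?S = "\<Sum>i<k. lam i *\<^sub>C e i" and ?T = "lam k *\<^sub>C e k"
  have "e i o\<^sub>C\<^sub>L e k = 0" "e k o\<^sub>C\<^sub>L e i = 0" if "i < k" for i
    using Suc.prems(2)[of i k] Suc.prems(2)[of k i] that by auto
  then have "?S o\<^sub>C\<^sub>L ?T = 0" "?T o\<^sub>C\<^sub>L ?S = 0"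
    by (simp_all add: cblinfun_compose_simps)
  moreover have "?S \<in> finite_rank_ops" "?T \<in> finite_rank_ops"
    unfolding finite_rank_ops_iff by (intro finite_rank_sum finite_rank_scaleC Suc.prems(1); simp)+
  ultimately have "P (?S + ?T) = P ?S + P ?T"
    using orth unfolding orthogonally_additive_on_def by blast
  moreover have "P ?S = (\<Sum>i<k. lam i ^ n *\<^sub>C P (e i))"
    using Suc.prems by (intro Suc.IH) auto
  moreover have "P ?T = lam k ^ n *\<^sub>C P (e k)"
    using Suc.prems(1) by (intro P_scaleC approximable_finite_rank) auto
  ultimately show ?case by simp
qed

lemma P_eq_D_diagonalizable:
  assumes E: "finite_rank E" and T: "diagonalizable E T"
  shows "of_nat n *\<^sub>C P T = D E (cblinfun_power T n)"
proof -
  obtain k :: nat and e lam where e: "\<And>i j. i < k \<Longrightarrow> j < k \<Longrightarrow> e i o\<^sub>C\<^sub>L e j = (if i = j then e i else 0)"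
    "(\<Sum>i<k. e i) = E" "T = (\<Sum>i<k. lam i *\<^sub>C e i)" and fin: "\<And>i. i < k \<Longrightarrow> finite_rank (e i)"
    by (rule diagonalizableE[OF E T]) blast
  have power: "cblinfun_power T n = (\<Sum>i<k. lam i ^ n *\<^sub>C e i)"
    unfolding e(3) by (rule power_diagonal[OF n e(1)])
  have P_T: "P T = (\<Sum>i<k. lam i ^ n *\<^sub>C P (e i))"
    unfolding e(3) by (rule P_diagonal[OF fin e(1)])
  have "P (E + s *\<^sub>C cblinfun_power T n) = (\<Sum>i<k. (1 + s * lam i ^ n) ^ n *\<^sub>C P (e i))" for s
  proof -
    have "E + s *\<^sub>C cblinfun_power T n = (\<Sum>i<k. (1 + s * lam i ^ n) *\<^sub>C e i)"
      unfolding power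
      by (simp add: e(2)[symmetric] scaleC_add_left scaleC_one sum.distrib complex_vector.scale_sum_right scaleC_scaleC)
    then show ?thesis
      using P_diagonal[of k e, OF fin e(1)] by simp
  qed
  then have "D E (cblinfun_power T n) = (\<Sum>i<k. linear_coefficient n (\<lambda>s. (1 + s * lam i ^ n) ^ n *\<^sub>C P (e i)))"
    unfolding polynomial_derivative_def by (simp only: linear_coefficient_sum)
  also have "\<dots> = of_nat n *\<^sub>C P T"
    by (simp add: P_T linear_coefficient_power[OF n] complex_vector.scale_sum_right scaleC_scaleC)
  finally show ?thesis by simp
qed

lemma P_tendsto:
  assumes "\<And>m. F m \<in> approximable_ops" "T \<in> approximable_ops" "F \<longlonglongrightarrow> T"
  shows "(\<lambda>m. P (F m)) \<longlonglongrightarrow> P T"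
  using continuous_on_tendsto_compose[OF cont assms(3,2)] assms(1) by auto

lemma D_tendsto:
  assumes F: "\<And>m. F m \<in> approximable_ops" "T \<in> approximable_ops" "F \<longlonglongrightarrow> T" and e: "e \<in> approximable_ops"
  shows "(\<lambda>m. D e (F m)) \<longlonglongrightarrow> D e T"
  unfolding polynomial_derivative_def linear_coefficient_def
  by (intro tendsto_scaleC tendsto_sum P_tendsto complex_vector.subspace_add
      complex_vector.subspace_scale subspace_approximable_ops F e tendsto_add tendsto_const)

theorem P_eq_D:
  assumes E: "finite_rank_projection E" and T: "local_unit E T"
  shows "of_nat n *\<^sub>C P T = D E (cblinfun_power T n)"
proof -
  have fE: "finite_rank E" by (rule finite_rank_projection_finite_rank[OF E])
  then obtain B where B: "finite B" "\<And>x. cblinfun_apply E x \<in> complex_vector.span B"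
    by (auto simp: finite_rank_def)
  have EE: "E o\<^sub>C\<^sub>L E = E" using E by (simp add: finite_rank_projection_def)
  have "\<exists>T'. norm (T' - T) < 1 / real (Suc m) \<and> diagonalizable E T'" for m
    using diagonalizable_dense[OF B EE T] by simp
  then obtain F where F: "\<And>m. norm (F m - T) < 1 / real (Suc m)" "\<And>m. diagonalizable E (F m)"
    by metis
  have lim: "F \<longlonglongrightarrow> T"
    by (rule LIM_zero_cancel, rule LIMSEQ_norm_0) (rule F(1))
  have fF: "F m \<in> approximable_ops" for m
    using F(2) diagonalizable_finite_rank[OF fE] approximable_finite_rank by blast
  have fT: "T \<in> approximable_ops"
    using T finite_rank_compose_right[OF fE, of T] by (intro approximable_finite_rank) (simp add: local_unit_def)
  have "(\<lambda>m. of_nat n *\<^sub>C P (F m)) \<longlonglongrightarrow> of_nat n *\<^sub>C P T"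
    by (intro tendsto_scaleC P_tendsto fF fT lim)
  moreover have "(\<lambda>m. D E (cblinfun_power (F m) n)) \<longlonglongrightarrow> D E (cblinfun_power T n)"
    by (intro D_tendsto power_approximable n fF fT tendsto_cblinfun_power lim approximable_finite_rank fE)
  ultimately show ?thesis
    unfolding P_eq_D_diagonalizable[OF fE F(2)] by (rule LIMSEQ_unique)
qed

text \<open>
  On the operators with local unit \<open>E\<close>, the map \<open>D E\<close> represents \<open>n P\<close> on powers. Comparing
  linear terms in \<open>n P (e + s T) = D E ((e + s T)\<^sup>n)\<close> gives the claim.
\<close>

theorem D_eq_D:
  assumes e: "finite_rank e" and T: "local_unit e T" and E: "finite_rank_projection E" "local_unit E e" "local_unit E T"
  shows "D e T = D E T"
proof -
  have fE: "finite_rank E" by (rule finite_rank_projection_finite_rank[OF E(1)])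
  have fT: "finite_rank T"
    using T finite_rank_compose_right[OF e, of T] by (simp add: local_unit_def)
  have "local_unit E (e + s *\<^sub>C T)" for s
    using E(2,3) by (simp add: local_unit_def cblinfun_compose_simps)
  then have "of_nat n *\<^sub>C D e T = linear_coefficient n (\<lambda>s. D E (cblinfun_power (e + s *\<^sub>C T) n))"
    unfolding polynomial_derivative_def[of n P e] linear_coefficient_scaleC[symmetric]
    by (simp only: P_eq_D[OF E(1)])
  also have "\<dots> = of_nat n *\<^sub>C D E T"
    by (rule linear_coefficient_of_power[OF n D_clinear_finite_rank[OF fE] e fT T])
  finally show ?thesis
    using n by auto
qed

text \<open>
  The choice of the local unit is immaterial by \<open>power_functional_eq\<close>.
\<close>

definition power_functional :: "('x \<Rightarrow>\<^sub>C\<^sub>L 'x) \<Rightarrow> 'y"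
  where "power_functional T = (1 / of_nat n) *\<^sub>C D (SOME E. finite_rank_projection E \<and> local_unit E T) T"

text \<open>
  The chosen projection and \<open>e\<close> are compared with a projection that is a unit for both of
  them.
\<close>

theorem power_functional_eq:
  assumes e: "finite_rank e" and T: "local_unit e T"
  shows "power_functional T = (1 / of_nat n) *\<^sub>C D e T"
proof -
  have fT: "finite_rank T"
    using T finite_rank_compose_right[OF e, of T] by (simp add: local_unit_def)
  define E where "E = (SOME E. finite_rank_projection E \<and> local_unit E T)"
  have "\<exists>E. finite_rank_projection E \<and> local_unit E T"
    using ex_projection_local_unit[OF finite_rank_projection_zero fT] by metis
  then have E: "finite_rank_projection E" "local_unit E T"
    unfolding E_def by (metis (mono_tags, lifting) someI_ex)+
  obtain E' where E': "finite_rank_projection E'" "local_unit E' E" "local_unit E' e"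
    using ex_projection_local_unit[OF E(1) e] by metis
  have "D E T = D E' T"
    by (rule D_eq_D[OF finite_rank_projection_finite_rank[OF E(1)] E(2) E'(1,2)]) (rule local_unit_trans[OF E'(2) E(2)])
  also have "\<dots> = D e T"
    by (rule D_eq_D[OF e T E'(1,3), symmetric]) (rule local_unit_trans[OF E'(2) E(2)])
  finally show ?thesis
    by (simp add: power_functional_def E_def)
qed

theorem clinear_power_functional: "clinear_on finite_rank_ops power_functional"
  unfolding clinear_on_def
proof (intro conjI ballI allI)
  fix S T :: "'x \<Rightarrow>\<^sub>C\<^sub>L 'x" assume "S \<in> finite_rank_ops" "T \<in> finite_rank_ops"
  then have ST: "finite_rank S" "finite_rank T" by (simp_all add: finite_rank_ops_iff)
  obtain E0 where E0: "finite_rank_projection E0" "local_unit E0 S"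
    using ex_projection_local_unit[OF finite_rank_projection_zero ST(1)] by metis
  obtain E where E: "finite_rank_projection E" "local_unit E E0" "local_unit E T"
    using ex_projection_local_unit[OF E0(1) ST(2)] by metis
  have fE: "finite_rank E" by (rule finite_rank_projection_finite_rank[OF E(1)])
  have ES: "local_unit E S" by (rule local_unit_trans[OF E(2) E0(2)])
  have EST: "local_unit E (S + T)"
    using ES E(3) by (simp add: local_unit_def cblinfun_compose_simps)
  have "D E (S + T) = D E S + D E T"
    by (rule clinear_on_add[OF D_clinear_finite_rank[OF fE]]) (simp_all add: finite_rank_ops_iff ST)
  then show "power_functional (S + T) = power_functional S + power_functional T"
    by (simp add: power_functional_eq[OF fE] ES E(3) EST scaleC_add_right)
next
  fix c and T :: "'x \<Rightarrow>\<^sub>C\<^sub>L 'x" assume "T \<in> finite_rank_ops"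
  then have fT: "finite_rank T" by (simp add: finite_rank_ops_iff)
  obtain E where E: "finite_rank_projection E" "local_unit E T"
    using ex_projection_local_unit[OF finite_rank_projection_zero fT] by metis
  have fE: "finite_rank E" by (rule finite_rank_projection_finite_rank[OF E(1)])
  have EcT: "local_unit E (c *\<^sub>C T)"
    using E(2) by (simp add: local_unit_def cblinfun_compose_simps)
  have "D E (c *\<^sub>C T) = c *\<^sub>C D E T"
    by (rule clinear_on_scaleC[OF D_clinear_finite_rank[OF fE]]) (simp add: finite_rank_ops_iff fT)
  then show "power_functional (c *\<^sub>C T) = c *\<^sub>C power_functional T"
    by (simp add: power_functional_eq[OF fE] E(2) EcT scaleC_scaleC mult.commute)
qed

theorem P_eq_power_functional:
  assumes T: "finite_rank T"
  shows "P T = power_functional (cblinfun_power T n)"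
proof -
  obtain E where E: "finite_rank_projection E" "local_unit E T"
    using ex_projection_local_unit[OF finite_rank_projection_zero T] by metis
  have ET: "local_unit E (cblinfun_power T m)" if "m \<ge> 1" for m
    using that
  proof (induction m rule: nat_induct_at_least)
    case base
    then show ?case using E(2) by (simp add: cblinfun_compose_id_right)
  next
    case (Suc m)
    then show ?case
      using E(2) by (simp add: local_unit_def cblinfun_compose_assoc) (metis cblinfun_compose_assoc)
  qed
  show ?thesis
    using n by (simp add: power_functional_eq[OF finite_rank_projection_finite_rank[OF E(1)] ET[OF n]] P_eq_D[OF E, symmetric]
        scaleC_scaleC scaleC_one)
qed

lemma P_bounded_on_balls:
  obtains K where "\<And>T. T \<in> approximable_ops \<Longrightarrow> norm T \<le> r \<Longrightarrow> norm (P T) \<le> K"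
proof -
  have 0: "0 \<in> approximable_ops"
    by (rule complex_vector.subspace_0[OF subspace_approximable_ops])
  obtain d where d: "d > 0" "\<And>T. T \<in> approximable_ops \<Longrightarrow> norm T < d \<Longrightarrow> norm (P T) < 1"
    using cont[unfolded continuous_on_iff, rule_format, OF 0 zero_less_one] by (auto simp: P_0)
  \<comment> \<open>\<open>1 / t\<close> scales the ball of radius \<open>r\<close> into the ball of radius \<open>d\<close>\<close>
  define t where "t = (\<bar>r\<bar> + 1) / d"
  have t: "t > 0" using d(1) by (simp add: t_def)
  show thesis
  proof
    fix T :: "'x \<Rightarrow>\<^sub>C\<^sub>L 'x" assume T: "T \<in> approximable_ops" "norm T \<le> r"
    let ?S = "complex_of_real (1 / t) *\<^sub>C T"
    have S: "?S \<in> approximable_ops"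
      using T(1) by (intro complex_vector.subspace_scale subspace_approximable_ops)
    have "norm ?S = norm T / t"
      using t by (simp add: norm_scaleC norm_divide)
    also have "\<dots> < d"
    proof -
      have "t * d = \<bar>r\<bar> + 1" using d(1) by (simp add: t_def)
      then show ?thesis using t T(2) by (simp add: pos_divide_less_eq mult.commute)
    qed
    finally have "norm (P ?S) < 1"
      using d(2) S by blast
    have "P T = P (complex_of_real t *\<^sub>C ?S)"
      using t by (simp add: scaleC_scaleC scaleC_one flip: of_real_mult)
    also have "\<dots> = complex_of_real t ^ n *\<^sub>C P ?S"
      by (rule P_scaleC[OF S])
    finally have "norm (P T) = t ^ n * norm (P ?S)"
      using t by (simp add: norm_scaleC norm_power)
    also have "\<dots> \<le> t ^ n * 1"
      using \<open>norm (P ?S) < 1\<close> t by (intro mult_left_mono) auto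
    finally show "norm (P T) \<le> t ^ n" by simp
  qed
qed

text \<open>
  For \<open>T\<close> in the unit ball, \<open>D w T\<close> is bounded by the values of \<open>P\<close> on a ball whose radius is
  given by the uniform bound of the local units \<open>w\<close>.
\<close>

theorem power_functional_bounded:
  assumes bap: "bounded_approximation_property TYPE('x \<Rightarrow>\<^sub>C\<^sub>L complex)"
  obtains K where "K \<ge> 0" "\<And>T. finite_rank T \<Longrightarrow> norm (power_functional T) \<le> K * norm T"
proof -
  obtain C where right: "finite_rank_right_approximation C TYPE('x)"
    using right_approximation[OF bap] by blast
  let ?M = "(1 + C)\<^sup>2 + 4"
  obtain K where K: "\<And>T. T \<in> approximable_ops \<Longrightarrow> norm T \<le> ?M + 1 \<Longrightarrow> norm (P T) \<le> K"
    using P_bounded_on_balls by blast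
  have unit: "norm (power_functional T) \<le> K" if T: "finite_rank T" "norm T \<le> 1" for T
  proof -
    obtain E where E: "finite_rank_projection E" "local_unit E T"
      using ex_projection_local_unit[OF finite_rank_projection_zero T(1)] by metis
    obtain w where w: "finite_rank w" "norm w \<le> ?M" "local_unit w E"
      using bounded_local_units[OF right E(1)] by blast
    have "norm (D w T) \<le> K"
      unfolding polynomial_derivative_def
    proof (rule norm_linear_coefficient)
      fix s :: complex assume s: "cmod s = 1"
      have "norm (w + s *\<^sub>C T) \<le> ?M + 1"
        by (rule norm_triangle_mono) (use w T s in \<open>auto simp: norm_scaleC\<close>)
      then show "norm (P (w + s *\<^sub>C T)) \<le> K"
        by (intro K approximable_finite_rank finite_rank_add finite_rank_scaleC w T)
    qed
    moreover have "norm (power_functional T) = norm (D w T) / n"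
      by (simp add: power_functional_eq[OF w(1) local_unit_trans[OF w(3) E(2)]] norm_scaleC norm_divide)
    moreover have "norm (D w T) / n \<le> norm (D w T)"
      using n by (simp add: divide_le_eq mult_le_cancel_left1)
    ultimately show ?thesis by simp
  qed
  have "K \<ge> 0"
    using unit[of 0] norm_ge_zero order_trans by (metis finite_rank_zero norm_zero zero_le_one)
  moreover have "norm (power_functional T) \<le> K * norm T" if T: "finite_rank T" for T
  proof (cases "T = 0")
    case True
    then show ?thesis
      using clinear_on_0[OF clinear_power_functional complex_vector.subspace_0[OF subspace_finite_rank_ops]] by simp
  next
    case False
    let ?c = "complex_of_real (1 / norm T)"
    have "norm (power_functional (?c *\<^sub>C T)) \<le> K"
      using False by (intro unit finite_rank_scaleC T) (simp add: norm_scaleC norm_divide)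
    moreover have "power_functional (?c *\<^sub>C T) = ?c *\<^sub>C power_functional T"
      by (rule clinear_on_scaleC[OF clinear_power_functional]) (simp add: finite_rank_ops_iff T)
    ultimately show ?thesis
      using False by (simp add: norm_scaleC norm_divide field_simps)
  qed
  ultimately show thesis by (rule that)
qed

end

section \<open>The representation theorem\<close>

lemma clinear_on_closure:
  fixes f :: "'v::complex_normed_vector \<Rightarrow> 'w::complex_normed_vector"
  assumes f: "clinear_on V f" and V: "complex_vector.subspace V" and cont: "continuous_on (closure V) f"
  shows "clinear_on (closure V) f"
proof -
  have tendsto: "(\<lambda>m. f (F m)) \<longlonglongrightarrow> f x" if "\<And>m. F m \<in> V" "F \<longlonglongrightarrow> x" for F x
  proof (rule continuous_on_tendsto_compose[OF cont that(2)])
    show "x \<in> closure V" using that unfolding closure_sequential by blast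
    show "\<forall>\<^sub>F m in sequentially. F m \<in> closure V"
      using that(1) closure_subset by (intro always_eventually) blast
  qed
  have seq: "\<exists>F. (\<forall>m. F m \<in> V) \<and> F \<longlonglongrightarrow> x" if "x \<in> closure V" for x
    using that unfolding closure_sequential by blast
  show ?thesis
    unfolding clinear_on_def
  proof (intro conjI ballI allI)
    fix x y assume "x \<in> closure V" "y \<in> closure V"
    then obtain F G where F: "\<And>m. F m \<in> V" "F \<longlonglongrightarrow> x" and G: "\<And>m. G m \<in> V" "G \<longlonglongrightarrow> y"
      using seq by metis
    have "(\<lambda>m. f (F m + G m)) \<longlonglongrightarrow> f (x + y)"
      by (intro tendsto tendsto_add F G complex_vector.subspace_add[OF V])
    moreover have "(\<lambda>m. f (F m + G m)) \<longlonglongrightarrow> f x + f y"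
      unfolding clinear_on_add[OF f F(1) G(1)] by (intro tendsto_add tendsto F G)
    ultimately show "f (x + y) = f x + f y" by (rule LIMSEQ_unique)
  next
    fix c x assume "x \<in> closure V"
    then obtain F where F: "\<And>m. F m \<in> V" "F \<longlonglongrightarrow> x"
      using seq by metis
    have "(\<lambda>m. f (c *\<^sub>C F m)) \<longlonglongrightarrow> f (c *\<^sub>C x)"
      by (intro tendsto tendsto_scaleC F complex_vector.subspace_scale[OF V])
    moreover have "(\<lambda>m. f (c *\<^sub>C F m)) \<longlonglongrightarrow> c *\<^sub>C f x"
      unfolding clinear_on_scaleC[OF f F(1)] by (intro tendsto_scaleC tendsto F)
    ultimately show "f (c *\<^sub>C x) = c *\<^sub>C f x" by (rule LIMSEQ_unique)
  qed
qed

lemma continuous_eq_on_approximable: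
  fixes f g :: "('x::complex_normed_vector \<Rightarrow>\<^sub>C\<^sub>L 'x) \<Rightarrow> 'y::t2_space"
  assumes "continuous_on approximable_ops f" "continuous_on approximable_ops g"
    and eq: "\<And>T. finite_rank T \<Longrightarrow> f T = g T" and T: "T \<in> approximable_ops"
  shows "f T = g T"
proof -
  obtain F where F: "\<And>m. F m \<in> finite_rank_ops" "F \<longlonglongrightarrow> T"
    using approximable_sequence[OF T] by blast
  have A: "\<forall>\<^sub>F m in sequentially. F m \<in> approximable_ops"
    using F(1) finite_rank_ops_subset by (intro always_eventually) blast
  have "(\<lambda>m. f (F m)) \<longlonglongrightarrow> f T" "(\<lambda>m. g (F m)) \<longlonglongrightarrow> g T"
    using assms(1,2) by (auto intro: continuous_on_tendsto_compose[OF _ F(2) T A])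
  moreover have "f (F m) = g (F m)" for m
    using F(1) eq by (simp add: finite_rank_ops_iff)
  ultimately show ?thesis
    by (simp add: LIMSEQ_unique)
qed

lemma continuous_on_power: "continuous_on A (\<lambda>T. cblinfun_power T n)"
  by (induction n)
    (auto intro: bounded_bilinear.continuous_on[OF bounded_bilinear_compose] continuous_on_id)

theorem linear_representation_unique:
  fixes \<Phi> \<Psi> :: "('x::complex_normed_vector \<Rightarrow>\<^sub>C\<^sub>L 'x) \<Rightarrow> 'y::complex_normed_vector"
  assumes n: "n \<ge> 1"
    and \<Phi>: "clinear_on approximable_ops \<Phi>" "continuous_on approximable_ops \<Phi>"
    and \<Psi>: "clinear_on approximable_ops \<Psi>" "continuous_on approximable_ops \<Psi>"
    and eq: "\<And>T. T \<in> approximable_ops \<Longrightarrow> \<Phi> (cblinfun_power T n) = \<Psi> (cblinfun_power T n)"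
    and T: "T \<in> approximable_ops"
  shows "\<Phi> T = \<Psi> T"
proof (rule continuous_eq_on_approximable[OF \<Phi>(2) \<Psi>(2) _ T])
  fix T :: "'x \<Rightarrow>\<^sub>C\<^sub>L 'x" assume T: "finite_rank T"
  obtain E where E: "finite_rank_projection E" "local_unit E T"
    using ex_projection_local_unit[OF finite_rank_projection_zero T] by metis
  have fE: "finite_rank E" by (rule finite_rank_projection_finite_rank[OF E(1)])
  have "clinear_on finite_rank_ops \<Phi>" "clinear_on finite_rank_ops \<Psi>"
    using \<Phi>(1) \<Psi>(1) finite_rank_ops_subset unfolding clinear_on_def by blast+
  note lin = this
  have "E + s *\<^sub>C T \<in> approximable_ops" for s
    using finite_rank_ops_subset finite_rank_add[OF fE finite_rank_scaleC[OF T]] finite_rank_ops_iff by blast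
  then have "of_nat n *\<^sub>C \<Phi> T = (of_nat n :: complex) *\<^sub>C \<Psi> T"
    unfolding linear_coefficient_of_power[OF n lin(1) fE T E(2), symmetric]
      linear_coefficient_of_power[OF n lin(2) fE T E(2), symmetric]
    by (simp only: eq)
  then show "\<Phi> T = \<Psi> T"
    using n by auto
qed

theorem orthogonally_additive_representation:
  fixes P :: "('x::complex_banach \<Rightarrow>\<^sub>C\<^sub>L 'x) \<Rightarrow> 'y::complex_banach"
  assumes n: "n \<ge> 1"
    and hom: "homogeneous_polynomial_on n approximable_ops P"
    and cont: "continuous_on approximable_ops P"
    and bap: "bounded_approximation_property TYPE('x \<Rightarrow>\<^sub>C\<^sub>L complex)"
    and orth: "orthogonally_additive_on finite_rank_ops P"
  obtains \<Phi> where "clinear_on approximable_ops \<Phi>" "continuous_on approximable_ops \<Phi>"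
    "\<And>T. T \<in> approximable_ops \<Longrightarrow> P T = \<Phi> (cblinfun_power T n)"
proof -
  interpret orthogonally_additive_polynomial P n
    by standard (rule n hom cont orth)+
  obtain K where K: "K \<ge> 0" "\<And>T. finite_rank T \<Longrightarrow> norm (power_functional T) \<le> K * norm T"
    using power_functional_bounded[OF bap] by blast
  have "K-lipschitz_on finite_rank_ops power_functional"
  proof (rule lipschitz_onI[OF _ K(1)])
    fix S T :: "'x \<Rightarrow>\<^sub>C\<^sub>L 'x" assume ST: "S \<in> finite_rank_ops" "T \<in> finite_rank_ops"
    have "S - T \<in> finite_rank_ops"
      using ST by (simp add: finite_rank_ops_iff finite_rank_diff)
    have "power_functional S = power_functional ((S - T) + T)" by simp
    also have "\<dots> = power_functional (S - T) + power_functional T"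
      by (rule clinear_on_add[OF clinear_power_functional \<open>S - T \<in> finite_rank_ops\<close> ST(2)])
    finally show "dist (power_functional S) (power_functional T) \<le> K * dist S T"
      using K(2)[of "S - T"] \<open>S - T \<in> finite_rank_ops\<close> by (simp add: dist_norm finite_rank_ops_iff)
  qed
  then have "uniformly_continuous_on finite_rank_ops power_functional"
    by (rule lipschitz_on_uniformly_continuous)
  then obtain \<Phi> where uc: "uniformly_continuous_on (closure finite_rank_ops) \<Phi>"
    and ext: "\<And>T. T \<in> finite_rank_ops \<Longrightarrow> power_functional T = \<Phi> T"
    using uniformly_continuous_on_extension_on_closure by metis
  have c: "continuous_on approximable_ops \<Phi>"
    using uniformly_continuous_imp_continuous[OF uc] by (simp add: approximable_ops_def)
  have "clinear_on finite_rank_ops \<Phi>"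
    unfolding clinear_on_def
  proof (intro conjI ballI allI)
    fix S T :: "'x \<Rightarrow>\<^sub>C\<^sub>L 'x" and c assume ST: "S \<in> finite_rank_ops" "T \<in> finite_rank_ops"
    then show "\<Phi> (S + T) = \<Phi> S + \<Phi> T"
      using clinear_on_add[OF clinear_power_functional ST] ext complex_vector.subspace_add[OF subspace_finite_rank_ops ST]
      by simp
  next
    fix T :: "'x \<Rightarrow>\<^sub>C\<^sub>L 'x" and c assume T: "T \<in> finite_rank_ops"
    then show "\<Phi> (c *\<^sub>C T) = c *\<^sub>C \<Phi> T"
      using clinear_on_scaleC[OF clinear_power_functional T] ext complex_vector.subspace_scale[OF subspace_finite_rank_ops T]
      by simp
  qed
  then have lin: "clinear_on approximable_ops \<Phi>"
    using clinear_on_closure[OF _ subspace_finite_rank_ops] c unfolding approximable_ops_def by blast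
  have "P T = \<Phi> (cblinfun_power T n)" if T: "T \<in> approximable_ops" for T
  proof (rule continuous_eq_on_approximable[OF cont _ _ T])
    show "continuous_on approximable_ops (\<lambda>T. \<Phi> (cblinfun_power T n))"
      by (rule continuous_on_compose2[OF c continuous_on_power]) (auto intro: power_approximable n)
    show "P T = \<Phi> (cblinfun_power T n)" if "finite_rank T" for T
      using P_eq_power_functional[OF that] ext finite_rank_power[OF n that] by (simp add: finite_rank_ops_iff)
  qed
  with lin c that show thesis by blast
qed

lemma linear_representation_imp_orthogonally_additive:
  assumes n: "n \<ge> 1" and \<Phi>: "clinear_on approximable_ops \<Phi>"
    and P: "\<And>T. T \<in> approximable_ops \<Longrightarrow> P T = \<Phi> (cblinfun_power T n)"
  shows "orthogonally_additive_on approximable_ops P"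
  unfolding orthogonally_additive_on_def
proof (intro ballI impI)
  fix S T :: "'a \<Rightarrow>\<^sub>C\<^sub>L 'a"
  assume ST: "S \<in> approximable_ops" "T \<in> approximable_ops" and "S o\<^sub>C\<^sub>L T = 0 \<and> T o\<^sub>C\<^sub>L S = 0"
  then have "cblinfun_power (S + T) n = cblinfun_power S n + cblinfun_power T n"
    using n by (simp add: power_add_orthogonal)
  moreover have "S + T \<in> approximable_ops"
    by (rule complex_vector.subspace_add[OF subspace_approximable_ops ST])
  ultimately show "P (S + T) = P S + P T"
    using ST clinear_on_add[OF \<Phi> power_approximable[OF n ST(1)] power_approximable[OF n ST(2)]]
    by (simp add: P)
qed

theorem theorem3p3:
  fixes P :: "('x::complex_banach \<Rightarrow>\<^sub>C\<^sub>L 'x) \<Rightarrow> 'y::complex_banach"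
    and n :: nat
  assumes "n \<ge> 1"
    and "homogeneous_polynomial_on n approximable_ops P"
    and "continuous_on approximable_ops P"
    and "bounded_approximation_property TYPE('x \<Rightarrow>\<^sub>C\<^sub>L complex)"
  shows "(orthogonally_additive_on approximable_ops P \<longleftrightarrow>
          orthogonally_additive_on finite_rank_ops P) \<and>
         (orthogonally_additive_on finite_rank_ops P \<longleftrightarrow>
          (\<exists>!\<Phi>. \<Phi> \<in> extensional approximable_ops \<and>
            clinear_on approximable_ops \<Phi> \<and> continuous_on approximable_ops \<Phi> \<and>
            (\<forall>T\<in>approximable_ops. P T = \<Phi> (cblinfun_power T n))))"
proof -
  let ?one = "orthogonally_additive_on approximable_ops P"
  let ?two = "orthogonally_additive_on finite_rank_ops P"
  let ?rep = "\<lambda>\<Phi>. \<Phi> \<in> extensional approximable_ops \<and>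
    clinear_on approximable_ops \<Phi> \<and> continuous_on approximable_ops \<Phi> \<and>
    (\<forall>T\<in>approximable_ops. P T = \<Phi> (cblinfun_power T n))"
  let ?A = "approximable_ops :: ('x \<Rightarrow>\<^sub>C\<^sub>L 'x) set"
  note n = assms(1)
  have 12: ?two if ?one
    using that finite_rank_ops_subset unfolding orthogonally_additive_on_def by blast
  have 31: ?one if "?rep \<Phi>" for \<Phi>
    using that by (intro linear_representation_imp_orthogonally_additive[OF n, of \<Phi>]) auto
  have 23: "\<exists>!\<Phi>. ?rep \<Phi>" if two: ?two
  proof (rule ex_ex1I)
    obtain \<Phi> where \<Phi>: "clinear_on ?A \<Phi>" "continuous_on ?A \<Phi>"
      "\<And>T. T \<in> ?A \<Longrightarrow> P T = \<Phi> (cblinfun_power T n)"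
      using orthogonally_additive_representation[OF assms two] by metis
    have "clinear_on ?A (restrict \<Phi> ?A)"
      using \<Phi>(1) complex_vector.subspace_add[OF subspace_approximable_ops]
        complex_vector.subspace_scale[OF subspace_approximable_ops]
      unfolding clinear_on_def by auto
    moreover have "continuous_on ?A (restrict \<Phi> ?A)"
      using \<Phi>(2) by (simp cong: continuous_on_cong)
    ultimately show "\<exists>\<Phi>. ?rep \<Phi>"
      using \<Phi>(3) power_approximable[OF n] by (intro exI[of _ "restrict \<Phi> ?A"]) auto
  next
    fix \<Phi> \<Psi> assume rep: "?rep \<Phi>" "?rep \<Psi>"
    show "\<Phi> = \<Psi>"
    proof (rule extensionalityI[of _ ?A])
      show "\<Phi> T = \<Psi> T" if "T \<in> ?A" for T
        by (rule linear_representation_unique[OF n _ _ _ _ _ that]) (use rep in auto)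
    qed (use rep in auto)
  qed
  show ?thesis
    using 12 23 31 by blast
qed

end
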